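(* Let $n\geq 13$ and $k\geq 1$ with $n\geq 2k$, and let $G\in\mathfrak{C}_{n,k}(k)$. Then $F(G)\geq F(L_{n,n-k})$. Furthermore, if $n\neq 2k+1$, equality holds if and only if $G\cong L_{n,n-k}$, and if $n=2k+1$, equality holds if and only if $G\in\{L_{2k+1,k+1},\,Q_{2k+1,k}\}$.
   Context: All graphs are simple, finite, undirected and connected. $F(G)$ is the number of connected subgraphs of $G$ (nonempty connected subgraphs consisting of a vertex subset and a subset of edges among them; distinct subgraphs counted separately). $\mathfrak{C}_{n,k}$ is the family of connected graphs on $n$ vertices with exactly $k$ cut vertices; $\mathfrak{C}_{n,k}(g)$ is its subfamily of graphs with girth at least $g$ (trees are considered to have infinite girth). $L_{n,n-k}$ is obtained by identifying an end vertex of the path $P_{k+1}$ with a vertex of the cycle $C_{n-k}$. The path-star tree $P_{m,r}$ is obtained by identifying one end vertex of $P_m$ with the center of the star $K_{1,r}$; its path-part pendant vertex is the other end of $P_m$. $Q_{n,k}$ is obtained by identifying a vertex of $C_{n-k-1}$ with the path-part pendant vertex of $P_{k,2}$. *)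

theory Defs
  imports Main "HOL-Library.Extended_Nat"
begin

text \<open>A graph is a pair of a vertex set and a set of edges, each edge being a two-element set
  of vertices.\<close>

type_synonym 'a ugraph = "'a set \<times> 'a set set"

abbreviation verts :: "'a ugraph \<Rightarrow> 'a set" where "verts G \<equiv> fst G"
abbreviation edges :: "'a ugraph \<Rightarrow> 'a set set" where "edges G \<equiv> snd G"

definition simple_graph :: "'a ugraph \<Rightarrow> bool" where
  "simple_graph G \<longleftrightarrow> finite (verts G) \<and> (\<forall>e\<in>edges G. e \<subseteq> verts G \<and> card e = 2)"

definition reachable :: "'a ugraph \<Rightarrow> 'a \<Rightarrow> 'a \<Rightarrow> bool" where
  "reachable G u v \<longleftrightarrow> (u, v) \<in> {(x, y). {x, y} \<in> edges G}\<^sup>*"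

definition connected_graph :: "'a ugraph \<Rightarrow> bool" where
  "connected_graph G \<longleftrightarrow> verts G \<noteq> {} \<and> (\<forall>u\<in>verts G. \<forall>v\<in>verts G. reachable G u v)"

definition subgraph :: "'a ugraph \<Rightarrow> 'a ugraph \<Rightarrow> bool" where
  "subgraph H G \<longleftrightarrow> simple_graph H \<and> verts H \<subseteq> verts G \<and> edges H \<subseteq> edges G"

definition graph_iso :: "'a ugraph \<Rightarrow> 'b ugraph \<Rightarrow> bool" where
  "graph_iso G H \<longleftrightarrow> (\<exists>f. bij_betw f (verts G) (verts H) \<and>
     (\<forall>u\<in>verts G. \<forall>v\<in>verts G. {u, v} \<in> edges G \<longleftrightarrow> {f u, f v} \<in> edges H))"

definition num_conn_subgraphs :: "'a ugraph \<Rightarrow> nat" where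
  "num_conn_subgraphs G = card {H. subgraph H G \<and> connected_graph H}"

definition delete_vertex :: "'a ugraph \<Rightarrow> 'a \<Rightarrow> 'a ugraph" where
  "delete_vertex G v = (verts G - {v}, {e \<in> edges G. v \<notin> e})"

text \<open>For use with connected \<open>G\<close> only: \<open>v\<close> is a cut vertex if \<open>G - v\<close> is disconnected, that is, has
  two vertices not joined by a walk. The graph without vertices does not count as disconnected, so
  a one-vertex graph has no cut vertex.\<close>

definition cut_vertex :: "'a ugraph \<Rightarrow> 'a \<Rightarrow> bool" where
  "cut_vertex G v \<longleftrightarrow> v \<in> verts G \<and>
     (\<exists>u\<in>verts (delete_vertex G v). \<exists>w\<in>verts (delete_vertex G v).
        \<not> reachable (delete_vertex G v) u w)"

definition path_graph :: "nat \<Rightarrow> nat ugraph" where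
  "path_graph m = ({0..<m}, {{i, Suc i} | i. Suc i < m})"

text \<open>Meaningful for \<open>m \<ge> 3\<close> only.\<close>

definition cycle_graph :: "nat \<Rightarrow> nat ugraph" where
  "cycle_graph m = ({0..<m}, {{i, Suc i mod m} | i. i < m})"

text \<open>The star \<open>K\<^bsub>1,r\<^esub>\<close>, with centre \<open>0\<close>.\<close>

definition star_graph :: "nat \<Rightarrow> nat ugraph" where
  "star_graph r = ({0..r}, {{0, i} | i. 1 \<le> i \<and> i \<le> r})"

text \<open>The infimum of the empty set is \<open>\<infinity>\<close>, so forests have infinite girth.\<close>

definition girth :: "'a ugraph \<Rightarrow> enat" where
  "girth G = Inf {enat m | m. m \<ge> 3 \<and> (\<exists>H. subgraph H G \<and> graph_iso H (cycle_graph m))}"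

definition cut_class :: "nat \<Rightarrow> nat \<Rightarrow> 'a ugraph set" where
  "cut_class n k = {G. simple_graph G \<and> connected_graph G \<and> card (verts G) = n \<and>
     card {v. cut_vertex G v} = k}"

definition cut_class_girth :: "nat \<Rightarrow> nat \<Rightarrow> nat \<Rightarrow> 'a ugraph set" where
  "cut_class_girth n k g = {G \<in> cut_class n k. enat g \<le> girth G}"

text \<open>The graph obtained from disjoint copies of \<open>G\<close> and \<open>H\<close> by identifying the vertex \<open>u\<close> of \<open>G\<close>
  with the vertex \<open>v\<close> of \<open>H\<close>. The merged vertex is \<open>Inl u\<close>.\<close>

definition identify :: "'a ugraph \<Rightarrow> 'a \<Rightarrow> 'b ugraph \<Rightarrow> 'b \<Rightarrow> ('a + 'b) ugraph" where
  "identify G u H v =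
     (Inl ` verts G \<union> Inr ` (verts H - {v}),
      (\<lambda>e. Inl ` e) ` edges G \<union>
      (\<lambda>e. (\<lambda>x. if x = v then Inl u else Inr x) ` e) ` edges H)"

text \<open>\<open>L\<^bsub>n,g\<^esub>\<close>: the cycle \<open>C\<^bsub>g\<^esub>\<close> with a path \<open>P\<^bsub>n-g+1\<^esub>\<close> attached, so that there are \<open>n\<close> vertices
  altogether; for \<open>g = n - k\<close> the path is \<open>P\<^bsub>k+1\<^esub>\<close>.\<close>

definition L_graph :: "nat \<Rightarrow> nat \<Rightarrow> (nat + nat) ugraph" where
  "L_graph n g = identify (path_graph (n - g + 1)) 0 (cycle_graph g) 0"

text \<open>The path-star tree \<open>P\<^bsub>m,r\<^esub>\<close>. Its path-part pendant vertex is \<open>Inl 0\<close>.\<close>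

definition path_star :: "nat \<Rightarrow> nat \<Rightarrow> (nat + nat) ugraph" where
  "path_star m r = identify (path_graph m) (m - 1) (star_graph r) 0"

definition Q_graph :: "nat \<Rightarrow> nat \<Rightarrow> (nat + (nat + nat)) ugraph" where
  "Q_graph n k = identify (cycle_graph (n - k - 1)) 0 (path_star k 2) (Inl 0)"

end

theory Submission
  imports Defs
begin

text \<open>Let \<open>g = n - k\<close> be the number of non-cut vertices. Through a vertex \<open>y\<close> of a connected graph that has
  \<open>m\<close> non-cut and \<open>k'\<close> cut vertices besides \<open>y\<close> there are at least \<open>m(m+1)/2 + 1 + k'\<close> connected
  subgraphs, and \<open>m + 1\<close> more if the graph contains a cycle. To see this, count the connected subgraphs
  containing a tree \<open>T\<close> and let \<open>T\<close> grow from \<open>y\<close> by edges leading to new vertices \<open>e\<close>. If \<open>e\<close> is a cut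
  vertex, \<open>T\<close> itself avoids the new edge; otherwise the graph without this edge (and without \<open>e\<close>, if
  \<open>e\<close> is pendant) is connected, and so is every stage of building it up from \<open>T\<close>.

  For a graph with a cycle the theorem follows by induction on the number of vertices. Removing a
  pendant vertex \<open>x\<close> with neighbour \<open>y\<close> loses one subgraph plus one for each connected subgraph of
  \<open>G - x\<close> through \<open>y\<close>. If \<open>y\<close> is not a cut vertex of \<open>G - x\<close>, then \<open>k\<close> drops and the bound above is
  exactly what is needed. If \<open>y\<close> is still a cut vertex, the bounds for the two sides of \<open>y\<close> multiply;
  here \<open>n = 2k\<close> is impossible because there are at least as many non-cut vertices as there are vertices
  on any cycle, and equality forces \<open>n = 2k + 1\<close>. If there is no pendant vertex, both sides of a
  cut vertex contain cycles of length at least \<open>k\<close>, and the product is too large.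

  A tree has \<open>g \<ge> 7\<close> leaves, and then the number of subtrees, which is exponential in \<open>g\<close>, exceeds the
  bound.\<close>

section \<open>Connected subgraphs and non-cut vertices\<close>

text \<open>Working with \<open>g\<close> and \<open>k\<close> instead of \<open>n\<close> and
  \<open>k\<close> makes both parameters behave well: the number of non-cut vertices never drops
  when a connected subgraph grows, so any cycle bounds \<open>g\<close> from below, and removing a
  pendant vertex lowers exactly one of \<open>g\<close> and \<open>k\<close> by one. The bound then
  only has to be compared with its two one-step increments.

  The obstacle is the step that lowers \<open>g\<close>. There the increment is about
  \<open>k * g\<close>, and the quadratic estimate through \<open>y\<close> is too weak when
  \<open>k\<close> is close to \<open>g\<close>; only the product over the two sides of
  \<open>y\<close> is large enough. The girth hypothesis enters in two inequalities: it keeps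
  \<open>k\<close> at most the number of non-cut vertices after the removal, and it makes both sides
  of a cut vertex large when both contain cycles. It is inherited because cycles of a smaller graph
  are cycles of \<open>G\<close>.

  The second extremal graph comes from a coincidence: adding a second leaf beside the end of
  L_{2k,k} creates as many subgraphs as passing to L_{2k+1,k+1}. The constant 13 serves to give
  \<open>g >= 7\<close>.\<close>

lemma simple_graphD:
  assumes "simple_graph G"
  shows "finite (verts G)" "e \<in> edges G \<Longrightarrow> e \<subseteq> verts G" "e \<in> edges G \<Longrightarrow> card e = 2"
    "finite (edges G)"
proof -
  show "finite (verts G)" "e \<in> edges G \<Longrightarrow> e \<subseteq> verts G" "e \<in> edges G \<Longrightarrow> card e = 2"
    using assms by (auto simp: simple_graph_def)
  have "edges G \<subseteq> Pow (verts G)" using assms by (auto simp: simple_graph_def)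
  then show "finite (edges G)"
    using \<open>finite (verts G)\<close> by (meson finite_Pow_iff finite_subset)
qed

lemma simple_graph_edgeD:
  assumes "simple_graph G" "{u, v} \<in> edges G"
  shows "u \<noteq> v" "u \<in> verts G" "v \<in> verts G"
  using simple_graphD(2,3)[OF assms] by (auto simp: card_insert_if split: if_splits)

lemma simple_graph_edge_at:
  assumes "simple_graph G" "e \<in> edges G" "x \<in> e"
  obtains y where "e = {x, y}" "x \<noteq> y"
proof -
  obtain a b where ab: "e = {a, b}" "a \<noteq> b"
    using simple_graphD(3)[OF assms(1,2)] by (auto simp: card_2_iff)
  then show thesis using that[of b] that[of a] assms(3) by (auto simp: insert_commute)
qed

lemma reachable_refl [simp]: "reachable G u u"
  by (simp add: reachable_def)

lemma reachable_edge: "{u, v} \<in> edges G \<Longrightarrow> reachable G u v"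
  by (auto simp: reachable_def)

lemma reachable_trans [trans]: "reachable G u v \<Longrightarrow> reachable G v w \<Longrightarrow> reachable G u w"
  by (auto simp: reachable_def)

lemma reachable_sym:
  assumes "reachable G u v"
  shows "reachable G v u"
  using assms[unfolded reachable_def]
proof (induction rule: rtrancl_induct)
  case (step y z)
  then have "{z, y} \<in> edges G" by (simp add: insert_commute)
  from reachable_trans[OF reachable_edge[OF this] step.IH] show ?case .
qed simp

lemma reachable_mono:
  assumes "reachable G u v" "edges G \<subseteq> edges H"
  shows "reachable H u v"
  using assms(1)[unfolded reachable_def]
proof (induction rule: rtrancl_induct)
  case (step y z)
  then have "{y, z} \<in> edges H" using assms(2) by auto
  from reachable_trans[OF step.IH reachable_edge[OF this]] show ?case .
qed simp

lemma reachable_closed: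
  assumes "reachable G u v" "u \<in> S" "\<And>x y. x \<in> S \<Longrightarrow> {x, y} \<in> edges G \<Longrightarrow> y \<in> S"
  shows "v \<in> S"
  using assms(1) unfolding reachable_def
  by (induction rule: rtrancl_induct) (use assms(2,3) in auto)

lemma connected_graphI:
  assumes "r \<in> verts G" "\<And>v. v \<in> verts G \<Longrightarrow> reachable G r v"
  shows "connected_graph G"
  unfolding connected_graph_def
proof (intro conjI ballI)
  fix u v assume "u \<in> verts G" "v \<in> verts G"
  then show "reachable G u v"
    using reachable_trans[OF reachable_sym[OF assms(2)] assms(2)] by simp
qed (use assms(1) in blast)

lemma connected_graph_crossing:
  assumes "connected_graph G" "S \<subseteq> verts G" "S \<noteq> {}" "S \<noteq> verts G" "simple_graph G"
  obtains u v where "u \<in> S" "v \<in> verts G - S" "{u, v} \<in> edges G"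
proof (rule ccontr)
  note found = that
  assume neg: "\<not> thesis"
  have cl: "y \<in> S" if "x \<in> S" "{x, y} \<in> edges G" for x y
  proof (rule ccontr)
    assume "y \<notin> S"
    then have "y \<in> verts G - S" using simple_graph_edgeD(3)[OF assms(5) that(2)] by simp
    then show False using found[OF that(1) _ that(2)] neg by simp
  qed
  obtain u v where "u \<in> S" "v \<in> verts G - S" using assms(2-4) by blast
  then have "reachable G u v" using assms(1,2) by (auto simp: connected_graph_def)
  then have "v \<in> S" by (rule reachable_closed) (fact \<open>u \<in> S\<close>, erule cl)
  then show False using \<open>v \<in> verts G - S\<close> by simp
qed

text \<open>Apply the hypothesis to the set reached from one vertex: an edge leaving it would reach
  further.\<close>

lemma connected_graph_by_crossing:
  assumes "verts G \<noteq> {}"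
    and "\<And>S. S \<subseteq> verts G \<Longrightarrow> S \<noteq> {} \<Longrightarrow> S \<noteq> verts G \<Longrightarrow> \<exists>u\<in>S. \<exists>v\<in>verts G - S. {u, v} \<in> edges G"
  shows "connected_graph G"
proof -
  obtain r where r: "r \<in> verts G" using assms(1) by blast
  let ?S = "{v \<in> verts G. reachable G r v}"
  have "?S = verts G"
  proof (rule ccontr)
    assume "?S \<noteq> verts G"
    moreover have "r \<in> ?S" using r by simp
    ultimately obtain u v where uv: "u \<in> ?S" "v \<in> verts G - ?S" "{u, v} \<in> edges G"
      using assms(2)[of ?S] by blast
    from uv(1) have "reachable G r u" by simp
    from reachable_trans[OF this reachable_edge[OF uv(3)]] show False using uv(2) by simp
  qed
  then show ?thesis using connected_graphI[OF r] by blast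
qed

section \<open>Inclusion of graphs, and connected subgraphs growing edge by edge\<close>

definition gle :: "'a ugraph \<Rightarrow> 'a ugraph \<Rightarrow> bool" where
  "gle T H \<longleftrightarrow> verts T \<subseteq> verts H \<and> edges T \<subseteq> edges H"

definition cgs :: "'a ugraph \<Rightarrow> 'a ugraph set" where
  "cgs G = {H. subgraph H G \<and> connected_graph H}"

definition above :: "'a ugraph \<Rightarrow> 'a ugraph \<Rightarrow> 'a ugraph set" where
  "above G T = {H \<in> cgs G. gle T H}"

definition rooted :: "'a ugraph \<Rightarrow> 'a \<Rightarrow> 'a ugraph set" where
  "rooted G y = {H \<in> cgs G. y \<in> verts H}"

lemma num_conn_subgraphs_eq: "num_conn_subgraphs G = card (cgs G)"
  by (simp add: num_conn_subgraphs_def cgs_def)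

lemma gle_refl [simp]: "gle G G" by (simp add: gle_def)

lemma gle_antisym: "gle G H \<Longrightarrow> gle H G \<Longrightarrow> G = H"
  by (auto simp: gle_def prod_eq_iff)

lemma gle_trans: "gle G H \<Longrightarrow> gle H K \<Longrightarrow> gle G K"
  by (auto simp: gle_def)

lemma cgs_iff: "H \<in> cgs G \<longleftrightarrow> simple_graph H \<and> connected_graph H \<and> gle H G"
  by (auto simp: cgs_def subgraph_def gle_def)

lemma rooted_eq_above: "rooted G y = above G ({y}, {})"
  by (auto simp: rooted_def above_def gle_def)

lemma finite_cgs [simp]: "simple_graph G \<Longrightarrow> finite (cgs G)"
  by (rule finite_subset[of _ "Pow (verts G) \<times> Pow (edges G)"])
    (auto simp: cgs_def subgraph_def simple_graphD)

lemma finite_above [simp]: "simple_graph G \<Longrightarrow> finite (above G T)"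
  by (simp add: above_def)

lemma finite_rooted [simp]: "simple_graph G \<Longrightarrow> finite (rooted G T)"
  by (simp add: rooted_def)

lemma single_cgs: "y \<in> verts G \<Longrightarrow> ({y}, {}) \<in> cgs G"
  by (auto simp: cgs_iff simple_graph_def connected_graph_def gle_def)

lemma self_cgs: "simple_graph G \<Longrightarrow> connected_graph G \<Longrightarrow> G \<in> cgs G"
  by (simp add: cgs_iff)

definition graph_union :: "'a ugraph \<Rightarrow> 'a ugraph \<Rightarrow> 'a ugraph" where
  "graph_union G H = (verts G \<union> verts H, edges G \<union> edges H)"

lemma graph_union_simps [simp]: "verts (graph_union G H) = verts G \<union> verts H" "edges (graph_union G H) = edges G \<union> edges H"
  by (simp_all add: graph_union_def)

lemma simple_graph_union: "simple_graph G \<Longrightarrow> simple_graph H \<Longrightarrow> simple_graph (graph_union G H)"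
  by (auto simp: simple_graph_def)

lemma connected_graph_union:
  assumes "connected_graph G" "connected_graph H" "y \<in> verts G" "y \<in> verts H"
  shows "connected_graph (graph_union G H)"
proof (rule connected_graphI[of y])
  fix v assume "v \<in> verts (graph_union G H)"
  then have "reachable G y v \<or> reachable H y v" using assms by (auto simp: connected_graph_def)
  then show "reachable (graph_union G H) y v" using reachable_mono by (metis graph_union_simps(2) Un_upper1 Un_upper2)
qed (use assms in auto)

lemma connected_mono_edges:
  assumes "connected_graph G" "edges G \<subseteq> edges H" "verts H = verts G"
  shows "connected_graph H"
  using assms reachable_mono unfolding connected_graph_def by metis

definition add_edge :: "'a ugraph \<Rightarrow> 'a \<Rightarrow> 'a \<Rightarrow> 'a ugraph" where
  "add_edge G u v = (insert u (insert v (verts G)), insert {u, v} (edges G))"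

lemma add_edge_simps [simp]: "verts (add_edge G u v) = insert u (insert v (verts G))"
  "edges (add_edge G u v) = insert {u, v} (edges G)"
  by (simp_all add: add_edge_def)

lemma simple_add_edge: "simple_graph G \<Longrightarrow> u \<noteq> v \<Longrightarrow> simple_graph (add_edge G u v)"
  by (auto simp: simple_graph_def)

lemma connected_add_edge:
  assumes "connected_graph G" "u \<in> verts G"
  shows "connected_graph (add_edge G u v)"
proof -
  have "connected_graph ({u, v}, {{u, v}})"
    by (rule connected_graphI[of u]) (auto intro: reachable_edge)
  from connected_graph_union[OF assms(1) this assms(2)]
  have "connected_graph (graph_union G ({u, v}, {{u, v}}))" by simp
  moreover have "graph_union G ({u, v}, {{u, v}}) = add_edge G u v" by (auto simp: graph_union_def add_edge_def)
  ultimately show ?thesis by simp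
qed

text \<open>Crossing edges are found in \<open>G\<close> and shown to lie in \<open>V\<close>. If
  \<open>S\<close> misses \<open>y\<close>, every edge at \<open>S\<close> stays in \<open>V\<close>
  anyway. If \<open>S\<close> contains \<open>y\<close>, everything outside \<open>V\<close> is
  first added to \<open>S\<close>; the edge leaving the enlarged set then ends in
  \<open>V - {y}\<close> and so lies in \<open>V\<close>.\<close>

lemma connected_side:
  assumes G: "simple_graph G" "connected_graph G" and V: "V \<subseteq> verts G" "y \<in> V"
    and side: "\<And>e. e \<in> edges G \<Longrightarrow> e \<subseteq> V \<or> e \<subseteq> insert y (verts G - V)"
  shows "connected_graph (V, {e \<in> edges G. e \<subseteq> V})"
proof (rule connected_graph_by_crossing)
  let ?K = "(V, {e \<in> edges G. e \<subseteq> V})"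
  show "verts ?K \<noteq> {}" using V by auto
  fix S assume "S \<subseteq> verts ?K" and ne: "S \<noteq> {}" and "S \<noteq> verts ?K"
  then have S: "S \<subseteq> V" "S \<noteq> {}" "S \<noteq> V" by auto
  show "\<exists>u\<in>S. \<exists>v\<in>verts ?K - S. {u, v} \<in> edges ?K"
  proof (cases "y \<in> S")
    case False
    have "S \<noteq> verts G" using S V by blast
    then obtain u v where uv: "u \<in> S" "v \<in> verts G - S" "{u, v} \<in> edges G"
      using connected_graph_crossing[OF G(2) _ S(2) _ G(1)] S V by (metis order_trans)
    then show ?thesis using side[OF uv(3)] S False by fastforce
  next
    case True
    let ?S = "S \<union> (verts G - V)"
    have "?S \<noteq> verts G" "?S \<noteq> {}" "?S \<subseteq> verts G" using S V by blast+
    then obtain u v where uv: "u \<in> ?S" "v \<in> verts G - ?S" "{u, v} \<in> edges G"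
      using connected_graph_crossing[OF G(2) _ _ _ G(1)] by metis
    then show ?thesis using side[OF uv(3)] S True by fastforce
  qed
qed

text \<open>As long as \<open>T\<close> misses a vertex, the new edge leads to a new vertex, so
  \<open>T\<close> first becomes spanning and only then receives edges between old vertices. The
  lower bounds for \<open>above\<close> rely on this last clause.\<close>

lemma cgs_grow:
  assumes G: "simple_graph G" "connected_graph G" and T: "T \<in> cgs G" and "T \<noteq> G"
  obtains u v where "u \<in> verts T" "v \<in> verts G" "{u, v} \<in> edges G - edges T" "u \<noteq> v"
    "add_edge T u v \<in> cgs G" "verts T \<noteq> verts G \<longrightarrow> v \<notin> verts T"
proof -
  have Tp: "simple_graph T" "connected_graph T" "gle T G" using T by (auto simp: cgs_iff)
  have "\<exists>u v. u \<in> verts T \<and> v \<in> verts G \<and> {u, v} \<in> edges G - edges T \<and>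
    (verts T \<noteq> verts G \<longrightarrow> v \<notin> verts T)"
  proof (cases "verts T = verts G")
    case True
    then obtain e where e: "e \<in> edges G" "e \<notin> edges T"
      using Tp(3) \<open>T \<noteq> G\<close> by (auto simp: gle_def prod_eq_iff)
    obtain u v where "e = {u, v}"
      using simple_graphD(3)[OF G(1) e(1)] by (auto simp: card_2_iff)
    then show ?thesis using e True simple_graph_edgeD[OF G(1), of u v] by blast
  next
    case False
    then obtain u v where uv: "u \<in> verts T" "v \<in> verts G - verts T" "{u, v} \<in> edges G"
      using connected_graph_crossing[OF G(2) _ _ _ G(1), of "verts T"] Tp
      by (auto simp: gle_def connected_graph_def)
    moreover have "{u, v} \<notin> edges T"
      using simple_graph_edgeD[OF Tp(1), of u v] uv by blast
    ultimately show ?thesis by blast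
  qed
  then obtain u v where uv: "u \<in> verts T" "v \<in> verts G" "{u, v} \<in> edges G - edges T"
    "verts T \<noteq> verts G \<longrightarrow> v \<notin> verts T" by blast
  have "u \<noteq> v" using uv simple_graph_edgeD[OF G(1)] by blast
  then have "add_edge T u v \<in> cgs G"
    using uv Tp(3) simple_add_edge[OF Tp(1)] connected_add_edge[OF Tp(2)]
    unfolding cgs_iff gle_def by (simp add: subset_iff)
  then show thesis using that uv \<open>u \<noteq> v\<close> by blast
qed

lemma cgs_bounds:
  assumes G: "simple_graph G" and T: "T \<in> cgs G"
  shows "card (verts T) \<le> card (verts G)" "card (edges T) \<le> card (edges G)"
    "finite (verts T)" "finite (edges T)"
proof -
  have "verts T \<subseteq> verts G" "edges T \<subseteq> edges G" using T by (simp_all add: cgs_iff gle_def)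
  moreover have "finite (verts G)" "finite (edges G)" using simple_graphD[OF G] by blast+
  ultimately show "card (verts T) \<le> card (verts G)" "card (edges T) \<le> card (edges G)"
    "finite (verts T)" "finite (edges T)"
    by (simp_all add: card_mono finite_subset)
qed

text \<open>Induction downwards from \<open>G\<close>, on the number of edges that \<open>T\<close>
  still lacks: the claim for \<open>T\<close> is reduced to the claim for \<open>T\<close> with one
  more edge.\<close>

lemma cgs_induct [consumes 3, case_names top step]:
  assumes G: "simple_graph G" "connected_graph G" and T: "T \<in> cgs G"
    and top: "P G"
    and step: "\<And>T u v. T \<in> cgs G \<Longrightarrow> u \<in> verts T \<Longrightarrow> v \<in> verts G \<Longrightarrow> {u, v} \<in> edges G \<Longrightarrow>
      {u, v} \<notin> edges T \<Longrightarrow> u \<noteq> v \<Longrightarrow> add_edge T u v \<in> cgs G \<Longrightarrow>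
      (verts T \<noteq> verts G \<Longrightarrow> v \<notin> verts T) \<Longrightarrow> P (add_edge T u v) \<Longrightarrow> P T"
  shows "P T"
  using T
proof (induction "card (edges G) - card (edges T)" arbitrary: T rule: less_induct)
  case less
  show ?case
  proof (cases "T = G")
    case False
    obtain u v where uv: "u \<in> verts T" "v \<in> verts G" "{u, v} \<in> edges G - edges T" "u \<noteq> v"
      "add_edge T u v \<in> cgs G" "verts T \<noteq> verts G \<longrightarrow> v \<notin> verts T"
      using cgs_grow[OF G less.prems False] by metis
    have "card (edges (add_edge T u v)) = Suc (card (edges T))"
      using uv cgs_bounds[OF G(1) less.prems] by simp
    then have "card (edges G) - card (edges (add_edge T u v)) < card (edges G) - card (edges T)"
      using cgs_bounds(2)[OF G(1) uv(5)] by linarith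
    from less.hyps[OF this uv(5)] show ?thesis using step[OF less.prems] uv by blast
  qed (use top in simp)
qed

text \<open>Growing \<open>T\<close> edge by edge up to \<open>G\<close> passes through one further
  connected subgraph for every missing edge.\<close>

lemma card_above_chain:
  assumes G: "simple_graph G" "connected_graph G" and T: "T \<in> cgs G"
  shows "card (edges G) + 1 \<le> card (above G T) + card (edges T)"
  using assms
proof (induction rule: cgs_induct)
  case top
  have "above G G = {G}" using G by (auto simp: above_def cgs_iff gle_antisym)
  then show ?case by simp
next
  case (step T u v)
  let ?T = "add_edge T u v"
  have "insert T (above G ?T) \<subseteq> above G T" using step.hyps by (auto simp: above_def gle_def)
  moreover have "T \<notin> above G ?T" using step.hyps by (auto simp: above_def gle_def)
  ultimately have "Suc (card (above G ?T)) \<le> card (above G T)"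
    using card_mono[OF finite_above[OF G(1)], of "insert T (above G ?T)"] G(1) by simp
  then show ?case using step cgs_bounds[OF G(1) step.hyps(1)] by simp
qed

text \<open>Each step adds one edge and at most one vertex, so edges minus vertices never
  decreases.\<close>

lemma card_edges_grow:
  assumes G: "simple_graph G" "connected_graph G" and T: "T \<in> cgs G"
  shows "card (verts G) + card (edges T) \<le> card (edges G) + card (verts T)"
  using assms
proof (induction rule: cgs_induct)
  case (step T u v)
  have "card (verts (add_edge T u v)) \<le> Suc (card (verts T))"
    using step.hyps cgs_bounds[OF G(1) step.hyps(1)] by (simp add: card_insert_if)
  then show ?case using step cgs_bounds[OF G(1) step.hyps(1)] by simp
qed simp

lemma card_edges_ge:
  assumes "simple_graph G" "connected_graph G"
  shows "card (verts G) \<le> Suc (card (edges G))"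
proof -
  obtain r where "r \<in> verts G" using assms(2) by (auto simp: connected_graph_def)
  from card_edges_grow[OF assms single_cgs[OF this]] show ?thesis by simp
qed

section \<open>Cut vertices and non-cut vertices\<close>

definition CV :: "'a ugraph \<Rightarrow> 'a set" where "CV G = {v. cut_vertex G v}"
definition NC :: "'a ugraph \<Rightarrow> 'a set" where "NC G = verts G - CV G"

lemma CV_subset: "CV G \<subseteq> verts G" by (auto simp: CV_def cut_vertex_def)
lemma NC_subset: "NC G \<subseteq> verts G" by (auto simp: NC_def)

lemma delete_vertex_simps [simp]: "verts (delete_vertex G v) = verts G - {v}"
  "edges (delete_vertex G v) = {e \<in> edges G. v \<notin> e}"
  by (simp_all add: delete_vertex_def)

lemma simple_delete [simp]: "simple_graph G \<Longrightarrow> simple_graph (delete_vertex G v)"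
  by (auto simp: simple_graph_def)

lemma NC_iff:
  "v \<in> NC G \<longleftrightarrow> v \<in> verts G \<and> (verts G = {v} \<or> connected_graph (delete_vertex G v))"
  unfolding NC_def CV_def cut_vertex_def connected_graph_def by auto

lemma NC_CV_card:
  assumes "simple_graph G"
  shows "card (NC G) + card (CV G) = card (verts G)"
proof -
  have "finite (verts G)" using assms by (rule simple_graphD)
  then show ?thesis unfolding NC_def
    using CV_subset[of G] by (simp add: card_Diff_subset card_mono finite_subset)
qed

text \<open>Adding an edge \<open>uv\<close> between old vertices keeps every non-cut vertex. If
  \<open>v\<close> is new, only \<open>u\<close> can become a cut vertex, and \<open>v\<close>
  itself compensates for it. So the number is monotone although the set is not.\<close>

lemma NC_mono:
  assumes G: "simple_graph G" "connected_graph G" and T: "T \<in> cgs G"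
  shows "card (NC T) \<le> card (NC G)"
  using assms
proof (induction rule: cgs_induct)
  case (step T u v)
  let ?T = "add_edge T u v"
  have Tp: "simple_graph T" "connected_graph T" "gle T G" using step.hyps by (auto simp: cgs_iff)
  have "finite (verts T)" "finite (verts ?T)" using simple_graphD(1)[OF Tp(1)] by simp_all
  then have fin: "finite (NC T)" "finite (NC ?T)" by (meson NC_subset finite_subset)+
  have keep: "w \<in> NC ?T" if w: "w \<in> NC T" "w \<noteq> u" for w
  proof -
    have "verts T \<noteq> {w}" using step.hyps w by auto
    then have c: "connected_graph (delete_vertex T w)" using w by (auto simp: NC_iff)
    show ?thesis
    proof (cases "w = v")
      case True
      then have "v \<in> verts T" using w by (simp add: NC_iff)
      then have "delete_vertex ?T w = delete_vertex T w" using True step.hyps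
        by (auto simp: delete_vertex_def)
      then show ?thesis using w c by (auto simp: NC_iff)
    next
      case False
      have "connected_graph (add_edge (delete_vertex T w) u v)"
        using connected_add_edge[OF c, of u v] step.hyps w by auto
      moreover have "add_edge (delete_vertex T w) u v = delete_vertex ?T w"
        using False w step.hyps by (auto simp: delete_vertex_def add_edge_def)
      ultimately show ?thesis using w by (auto simp: NC_iff)
    qed
  qed
  have "card (NC T) \<le> card (NC ?T)"
  proof (cases "v \<in> verts T")
    case True
    have "u \<in> NC ?T" if "u \<in> NC T"
    proof -
      have "delete_vertex ?T u = delete_vertex T u" using True step.hyps
        by (auto simp: delete_vertex_def)
      moreover have "verts T \<noteq> {u}" using True step.hyps by auto
      ultimately show ?thesis using that by (auto simp: NC_iff)
    qed
    then have "NC T \<subseteq> NC ?T" using keep by blast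
    then show ?thesis using card_mono[OF fin(2)] by blast
  next
    case False
    have "delete_vertex ?T v = T" using False step.hyps simple_graphD(2)[OF Tp(1)]
      by (auto simp: delete_vertex_def prod_eq_iff)
    then have "v \<in> NC ?T" using Tp by (auto simp: NC_iff)
    then have "insert v (NC T - {u}) \<subseteq> NC ?T" using keep by blast
    moreover have "v \<notin> NC T" using False by (simp add: NC_iff)
    ultimately have "Suc (card (NC T - {u})) \<le> card (NC ?T)"
      using card_mono[OF fin(2), of "insert v (NC T - {u})"] fin(1) by simp
    moreover have "card (NC T) \<le> Suc (card (NC T - {u}))"
      using fin(1) by (cases "u \<in> NC T") (simp_all add: card_Suc_Diff1)
    ultimately show ?thesis by linarith
  qed
  then show ?case using step by simp
qed simp

text \<open>A single edge has two non-cut vertices, and \<open>NC_mono\<close> compares it with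
  \<open>G\<close>.\<close>

lemma card_NC_ge_2:
  assumes "simple_graph G" "connected_graph G" "card (verts G) \<ge> 2"
  shows "card (NC G) \<ge> 2"
proof -
  obtain r where r: "r \<in> verts G" using assms(2) by (auto simp: connected_graph_def)
  have "({r}, {}) \<noteq> G" using assms(3) by auto
  from cgs_grow[OF assms(1,2) single_cgs[OF r] this]
  obtain u v where uv: "u = r" "add_edge ({r}, {}) u v \<in> cgs G" "u \<noteq> v"
    by (metis fst_conv singletonD)
  have "delete_vertex (add_edge ({r}, {}) u v) u = ({v}, {})"
    "delete_vertex (add_edge ({r}, {}) u v) v = ({u}, {})"
    using uv by (auto simp: delete_vertex_def)
  moreover have "connected_graph ({x}, {})" for x :: 'a by (simp add: connected_graph_def)
  ultimately have "NC (add_edge ({r}, {}) u v) = {u, v}"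
    using uv by (auto simp: NC_iff)
  then show ?thesis using NC_mono[OF assms(1,2) uv(2)] uv(3) by simp
qed

section \<open>Connected subgraphs through a vertex\<close>

lemma double_le_sum: "a \<le> 2 * x \<Longrightarrow> s \<le> y \<Longrightarrow> c = x + y \<Longrightarrow> a + 2 * s \<le> 2 * (c :: nat)"
  by simp

lemma simple_graph_endpoint: "simple_graph H \<Longrightarrow> e \<in> edges H \<Longrightarrow> x \<in> e \<Longrightarrow> x \<in> verts H"
  using simple_graphD(2) by blast

lemma cgs_delete:
  assumes "T \<in> cgs G" "v \<notin> verts T"
  shows "T \<in> cgs (delete_vertex G v)"
proof -
  have "v \<notin> e" if "e \<in> edges T" for e
    using simple_graph_endpoint[OF _ that] assms by (auto simp: cgs_iff)
  then show ?thesis using assms by (auto simp: cgs_iff gle_def)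
qed

lemma card_cgs_split:
  assumes G: "simple_graph G"
  shows "card (cgs G) = card (cgs (delete_vertex G x)) + card (rooted G x)"
proof -
  have "x \<notin> verts H" if "H \<in> cgs (delete_vertex G x)" for H
    using that by (auto simp: cgs_iff gle_def)
  moreover have "H \<in> cgs (delete_vertex G x)" if "H \<in> cgs G" "x \<notin> verts H" for H
    using cgs_delete[OF that] .
  moreover have "H \<in> cgs G" if "H \<in> cgs (delete_vertex G x)" for H
    using that by (auto simp: cgs_iff gle_def)
  ultimately have "cgs G = cgs (delete_vertex G x) \<union> rooted G x"
    "cgs (delete_vertex G x) \<inter> rooted G x = {}"
    by (auto simp: rooted_def)
  then show ?thesis using G card_Un_disjoint[of "cgs (delete_vertex G x)" "rooted G x"] by simp
qed

lemma card_edges_delete: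
  assumes "simple_graph G"
  shows "card (edges (delete_vertex G x)) + card {e \<in> edges G. x \<in> e} = card (edges G)"
proof -
  have "edges (delete_vertex G x) \<union> {e \<in> edges G. x \<in> e} = edges G"
    "edges (delete_vertex G x) \<inter> {e \<in> edges G. x \<in> e} = {}" by auto
  then show ?thesis using simple_graphD(4)[OF assms]
    by (metis card_Un_disjoint finite_Un)
qed

lemma delete_in_cgs:
  assumes "simple_graph G" "v \<in> NC G" "verts G \<noteq> {v}"
  shows "delete_vertex G v \<in> cgs G"
  using assms by (auto simp: NC_iff cgs_iff gle_def)

text \<open>Deleting the edge \<open>ye\<close> keeps the graph connected unless \<open>e\<close> is pendant, and in that
  case deleting \<open>e\<close> along with it does.\<close>

lemma noncut_edge_deletion:
  assumes G: "simple_graph G" "connected_graph G" and e: "e \<in> NC G" "{y, e} \<in> edges G"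
  obtains K where "K \<in> cgs G" "{y, e} \<notin> edges K" "card (edges G) = Suc (card (edges K))"
    "\<And>T. T \<in> cgs G \<Longrightarrow> e \<notin> verts T \<Longrightarrow> T \<in> cgs K"
proof -
  have ye: "y \<noteq> e" "y \<in> verts G" "e \<in> verts G" using simple_graph_edgeD[OF G(1) e(2)] by auto
  have del: "delete_vertex G e \<in> cgs G" using delete_in_cgs[OF G(1) e(1)] ye by auto
  show thesis
  proof (cases "{f \<in> edges G. e \<in> f} = {{y, e}}")
    case True
    let ?K = "delete_vertex G e"
    have "card (edges G) = Suc (card (edges ?K))"
      using card_edges_delete[OF G(1), of e] True by simp
    then show thesis using that[OF del] cgs_delete[of _ G e] by simp
  next
    case False
    then obtain f where f: "f \<in> edges G" "e \<in> f" "f \<noteq> {y, e}" using e(2) by blast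
    then obtain z where z: "f = {e, z}" "e \<noteq> z" using simple_graph_edge_at[OF G(1)] by metis
    then have zV: "z \<in> verts G" using simple_graph_edgeD[OF G(1)] f by blast
    let ?K = "(verts G, edges G - {{y, e}})"
    have "connected_graph (add_edge (delete_vertex G e) z e)"
      using connected_add_edge[of "delete_vertex G e" z e] del z zV by (auto simp: cgs_iff)
    then have "connected_graph ?K"
      by (rule connected_mono_edges) (use f z ye zV in \<open>auto simp: insert_commute\<close>)
    then have "?K \<in> cgs G" using G(1) by (auto simp: cgs_iff gle_def simple_graph_def)
    moreover have "card (edges G) = Suc (card (edges ?K))"
      using card.remove[OF simple_graphD(4)[OF G(1)] e(2)] by simp
    moreover have "T \<in> cgs ?K" if "T \<in> cgs G" "e \<notin> verts T" for T
    proof -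
      have "{y, e} \<notin> edges T" using simple_graph_edgeD(3)[of T y e] that by (auto simp: cgs_iff)
      then show ?thesis using that by (auto simp: cgs_iff gle_def)
    qed
    ultimately show thesis using that[of ?K] by simp
  qed
qed

text \<open>The chain from \<open>T\<close> upwards is built inside the graph \<open>K\<close> of
  \<open>noncut_edge_deletion\<close>. As \<open>K\<close> has one edge less than \<open>G\<close>,
  it has \<open>card (edges G) - card (edges T)\<close> members, all avoiding the edge
  \<open>ye\<close>.\<close>

lemma card_avoiding:
  assumes G: "simple_graph G" "connected_graph G" and e: "e \<in> NC G" "{y, e} \<in> edges G"
    and T: "T \<in> cgs G" "e \<notin> verts T"
  shows "card (edges G) \<le> card {H \<in> above G T. {y, e} \<notin> edges H} + card (edges T)"
proof -
  obtain K where K: "K \<in> cgs G" "{y, e} \<notin> edges K" "card (edges G) = Suc (card (edges K))"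
    "T \<in> cgs K" using noncut_edge_deletion[OF G e] T by metis
  then have Kp: "simple_graph K" "connected_graph K" "gle K G" by (auto simp: cgs_iff)
  have "above K T \<subseteq> {H \<in> above G T. {y, e} \<notin> edges H}"
    using Kp(3) K(2) by (auto simp: above_def cgs_iff gle_def)
  then have "card (above K T) \<le> card {H \<in> above G T. {y, e} \<notin> edges H}"
    by (rule card_mono[rotated]) (simp add: G(1))
  then show ?thesis using card_above_chain[OF Kp(1,2) K(4)] K(3) by simp
qed

lemma card_above_edge_split:
  assumes "simple_graph G" "T \<in> cgs G" "y \<in> verts T"
  shows "card (above G T) =
    card (above G (add_edge T y e)) + card {H \<in> above G T. {y, e} \<notin> edges H}"
proof -
  have "H \<in> above G (add_edge T y e)" if "H \<in> above G T" "{y, e} \<in> edges H" for H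
    using that simple_graph_edgeD[of H y e] by (auto simp: above_def gle_def cgs_iff)
  moreover have "H \<in> above G T" "{y, e} \<in> edges H" if "H \<in> above G (add_edge T y e)" for H
    using that by (auto simp: above_def gle_def)
  ultimately have "above G T = above G (add_edge T y e) \<union> {H \<in> above G T. {y, e} \<notin> edges H}"
    "above G (add_edge T y e) \<inter> {H \<in> above G T. {y, e} \<notin> edges H} = {}" by blast+
  then show ?thesis
    using card_Un_disjoint[of "above G (add_edge T y e)" "{H \<in> above G T. {y, e} \<notin> edges H}"]
      assms(1) by simp
qed

lemma above_growth_cases:
  assumes G: "simple_graph G" "connected_graph G" and T: "T \<in> cgs G" "verts T \<noteq> verts G"
  obtains y e where "y \<in> verts T" "e \<in> verts G - verts T" "{y, e} \<in> edges G"
    "add_edge T y e \<in> cgs G" "card (verts (add_edge T y e)) = Suc (card (verts T))"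
    "card (edges (add_edge T y e)) = Suc (card (edges T))"
proof -
  obtain y e where ye: "y \<in> verts T" "e \<in> verts G" "{y, e} \<in> edges G - edges T" "y \<noteq> e"
    "add_edge T y e \<in> cgs G" "e \<notin> verts T" using cgs_grow[OF G T(1)] T(2) by metis
  then show thesis using that[of y e] cgs_bounds[OF G(1) T(1)] by (simp add: insert_absorb)
qed

lemma outside_card:
  assumes G: "simple_graph G" and T: "T \<in> cgs G"
  shows "card (NC G - verts T) + card (CV G - verts T) + card (verts T) = card (verts G)"
proof -
  have TG: "verts T \<subseteq> verts G" using T by (auto simp: cgs_iff gle_def)
  have fin: "finite (verts G)" by (rule simple_graphD[OF G])
  have "(NC G - verts T) \<union> (CV G - verts T) = verts G - verts T"
    "(NC G - verts T) \<inter> (CV G - verts T) = {}" using CV_subset[of G] by (auto simp: NC_def)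
  then have "card (NC G - verts T) + card (CV G - verts T) = card (verts G - verts T)"
    using fin by (metis card_Un_disjoint finite_Diff finite_Un)
  then show ?thesis using TG fin by (simp add: card_Diff_subset card_mono finite_subset)
qed

section \<open>Lower bounds above a growing connected subgraph\<close>

lemma outside_step:
  assumes G: "simple_graph G" and e: "e \<in> verts G - verts T" "y \<in> verts T"
  shows "e \<in> NC G \<Longrightarrow> card (NC G - verts T) = Suc (card (NC G - verts (add_edge T y e)))"
    "e \<in> NC G \<Longrightarrow> CV G - verts T = CV G - verts (add_edge T y e)"
    "e \<notin> NC G \<Longrightarrow> card (CV G - verts T) = Suc (card (CV G - verts (add_edge T y e)))"
    "e \<notin> NC G \<Longrightarrow> NC G - verts T = NC G - verts (add_edge T y e)"
proof -
  have fin: "finite (NC G)" "finite (CV G)"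
    using simple_graphD(1)[OF G] NC_subset[of G] CV_subset[of G] finite_subset by blast+
  have eq: "X - verts (add_edge T y e) = X - verts T - {e}" for X using e by auto
  show "e \<in> NC G \<Longrightarrow> card (NC G - verts T) = Suc (card (NC G - verts (add_edge T y e)))"
    using e fin unfolding eq by (subst card.remove[of _ e]) auto
  show "e \<in> NC G \<Longrightarrow> CV G - verts T = CV G - verts (add_edge T y e)"
    unfolding eq by (auto simp: NC_def)
  show "e \<notin> NC G \<Longrightarrow> card (CV G - verts T) = Suc (card (CV G - verts (add_edge T y e)))"
    using e fin unfolding eq by (subst card.remove[of _ e]) (auto simp: NC_def)
  show "e \<notin> NC G \<Longrightarrow> NC G - verts T = NC G - verts (add_edge T y e)"
    unfolding eq by auto
qed

text \<open>\<open>T\<close> takes in one new vertex \<open>e\<close> at a time, and the subgraphs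
  are split by whether they use the edge \<open>ye\<close>. A non-cut \<open>e\<close> contributes
  at least the current \<open>m\<close> subgraphs without this edge, so these add up to 1 + ... +
  \<open>m\<close>; a cut vertex contributes \<open>T\<close> itself; the spanning subgraph at the
  end contributes the remaining one.\<close>

lemma above_lower_bound:
  assumes G: "simple_graph G" "connected_graph G" and T: "T \<in> cgs G"
    and mk: "m = card (NC G - verts T)" "k = card (CV G - verts T)"
  shows "(m + 1) * m + 2 + 2 * k \<le> 2 * card (above G T)"
  using T mk
proof (induction "card (verts G) - card (verts T)" arbitrary: T m k rule: less_induct)
  case less
  note T = less.prems(1)
  have TT: "T \<in> above G T" using T by (simp add: above_def)
  show ?case
  proof (cases "verts T = verts G")
    case True
    then have "m = 0" "k = 0" using less.prems NC_subset[of G] CV_subset[of G]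
      by (auto simp: Diff_eq_empty_iff card_eq_0_iff)
    moreover have "0 < card (above G T)" using TT G(1) by (auto simp: card_gt_0_iff)
    ultimately show ?thesis by simp
  next
    case False
    obtain y e where ye: "y \<in> verts T" "e \<in> verts G - verts T" "{y, e} \<in> edges G"
      "add_edge T y e \<in> cgs G" "card (verts (add_edge T y e)) = Suc (card (verts T))"
      "card (edges (add_edge T y e)) = Suc (card (edges T))"
      using above_growth_cases[OF G T False] by metis
    let ?T = "add_edge T y e"
    let ?A = "{H \<in> above G T. {y, e} \<notin> edges H}"
    have dec: "card (verts G) - card (verts ?T) < card (verts G) - card (verts T)"
      using cgs_bounds(1)[OF G(1) ye(4)] ye(5) by linarith
    note IH = less.hyps[OF dec ye(4) refl refl]
    note split = card_above_edge_split[OF G(1) T ye(1), of e]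
    note step = outside_step[OF G(1) ye(2,1)]
    have tot: "m + k + card (verts T) = card (verts G)"
      using outside_card[OF G(1) T] less.prems by simp
    show ?thesis
    proof (cases "e \<in> NC G")
      case True
      let ?m = "card (NC G - verts ?T)"
      have mk: "m = Suc ?m" "k = card (CV G - verts ?T)" 
        using step(1,2)[OF True] less.prems(2,3) by metis+
      have del: "delete_vertex G e \<in> cgs G" 
      proof (rule delete_in_cgs[OF G(1) True])
        have "y \<noteq> e" "y \<in> verts G" using ye(1,2) T by (auto simp: cgs_iff gle_def)
        then show "verts G \<noteq> {e}" by blast
      qed
      then have K: "simple_graph (delete_vertex G e)" "connected_graph (delete_vertex G e)"
        by (auto simp: cgs_iff)
      have TK: "T \<in> cgs (delete_vertex G e)" using cgs_delete[OF T] ye by blast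
      have "above (delete_vertex G e) T \<subseteq> ?A"
        by (auto simp: above_def cgs_iff gle_def)
      then have "card (above (delete_vertex G e) T) \<le> card ?A"
        by (rule card_mono[rotated]) (simp add: G(1))
      moreover have "card (verts (delete_vertex G e)) = card (verts G) - 1"
        using ye simple_graphD(1)[OF G(1)] by simp
      \<comment> \<open>The chain in \<open>G - e\<close> has at least as many members as there are
        vertices outside \<open>T\<close>, that is \<open>m + k\<close>.\<close>
      ultimately have "m \<le> card ?A"
        using card_above_chain[OF K TK] card_edges_grow[OF K TK] tot by linarith
      then have "(?m + 1) * ?m + 2 + 2 * k + 2 * m \<le> 2 * card (above G T)"
        unfolding mk(2) by (intro double_le_sum[OF IH _ split])
      then show ?thesis using mk(1) by (simp add: algebra_simps)
    next
      case False
      have mk: "m = card (NC G - verts ?T)" "k = Suc (card (CV G - verts ?T))"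
        using step(3,4)[OF False] less.prems(2,3) by metis+
      have "{y, e} \<notin> edges T" using ye T simple_graph_edgeD(3)[of T y e] by (auto simp: cgs_iff)
      then have "T \<in> ?A" using TT by simp
      then have "card ?A > 0"
        by (intro card_gt_0_iff[THEN iffD2] conjI) (blast, simp add: G(1))
      then have c: "1 \<le> card ?A" by simp
      show ?thesis using double_le_sum[OF IH c split] unfolding mk by simp
    qed
  qed
qed

text \<open>As long as \<open>T\<close> is a tree, \<open>G\<close> has a surplus edge over it, so
  each chain of subgraphs avoiding \<open>ye\<close> gains a member: \<open>m + 1\<close> instead of
  \<open>m\<close>. The spanning tree at the end still differs from \<open>G\<close>, hence
  contributes two.\<close>

lemma above_lower_bound_cyclic:
  assumes G: "simple_graph G" "connected_graph G" "card (verts G) \<le> card (edges G)"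
    and T: "T \<in> cgs G" "card (verts T) = Suc (card (edges T))"
    and mk: "m = card (NC G - verts T)" "k = card (CV G - verts T)"
  shows "(m + 1) * (m + 2) + 2 + 2 * k \<le> 2 * card (above G T)"
  using T mk
proof (induction "card (verts G) - card (verts T)" arbitrary: T m k rule: less_induct)
  case less
  note T = less.prems(1)
  have TT: "T \<in> above G T" using T by (simp add: above_def)
  show ?case
  proof (cases "verts T = verts G")
    case True
    then have "m = 0" "k = 0" using less.prems NC_subset[of G] CV_subset[of G]
      by (auto simp: Diff_eq_empty_iff card_eq_0_iff)
    moreover have "2 \<le> card (above G T)"
      using card_above_chain[OF G(1,2) T] G(3) less.prems(2) True by simp
    ultimately show ?thesis by simp
  next
    case False
    obtain y e where ye: "y \<in> verts T" "e \<in> verts G - verts T" "{y, e} \<in> edges G"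
      "add_edge T y e \<in> cgs G" "card (verts (add_edge T y e)) = Suc (card (verts T))"
      "card (edges (add_edge T y e)) = Suc (card (edges T))"
      using above_growth_cases[OF G(1,2) T False] by metis
    let ?T = "add_edge T y e"
    let ?A = "{H \<in> above G T. {y, e} \<notin> edges H}"
    have dec: "card (verts G) - card (verts ?T) < card (verts G) - card (verts T)"
      using cgs_bounds(1)[OF G(1) ye(4)] ye(5) by linarith
    have "card (verts ?T) = Suc (card (edges ?T))" using ye less.prems(2) by simp
    note IH = less.hyps[OF dec ye(4) this refl refl]
    note split = card_above_edge_split[OF G(1) T ye(1), of e]
    note step = outside_step[OF G(1) ye(2,1)]
    have tot: "m + k + card (verts T) = card (verts G)"
      using outside_card[OF G(1) T] less.prems by simp
    show ?thesis
    proof (cases "e \<in> NC G")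
      case True
      let ?m = "card (NC G - verts ?T)"
      have mk: "m = Suc ?m" "k = card (CV G - verts ?T)" 
        using step(1,2)[OF True] less.prems(3,4) by metis+
      have "m + 1 \<le> card ?A"
        using card_avoiding[OF G(1,2) True ye(3) T] ye(2) tot less.prems(2) G(3) by simp
      then have "(?m + 1) * (?m + 2) + 2 + 2 * k + 2 * (m + 1) \<le> 2 * card (above G T)"
        unfolding mk(2) by (intro double_le_sum[OF IH _ split])
      then show ?thesis using mk(1) by (simp add: algebra_simps)
    next
      case False
      have mk: "m = card (NC G - verts ?T)" "k = Suc (card (CV G - verts ?T))"
        using step(3,4)[OF False] less.prems(3,4) by metis+
      have "{y, e} \<notin> edges T" using ye T simple_graph_edgeD(3)[of T y e] by (auto simp: cgs_iff)
      then have "T \<in> ?A" using TT by simp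
      then have "card ?A > 0"
        by (intro card_gt_0_iff[THEN iffD2] conjI) (blast, simp add: G(1))
      then have c: "1 \<le> card ?A" by simp
      show ?thesis using double_le_sum[OF IH c split] unfolding mk by simp
    qed
  qed
qed

lemma rooted_lower_bound:
  assumes "simple_graph G" "connected_graph G" "y \<in> verts G"
    and "m = card (NC G - {y})" "k = card (CV G - {y})"
  shows "(m + 1) * m + 2 + 2 * k \<le> 2 * card (rooted G y)"
  using above_lower_bound[OF assms(1,2) single_cgs[OF assms(3)]] assms(4,5)
  by (simp add: rooted_eq_above)

lemma rooted_lower_bound_cyclic:
  assumes "simple_graph G" "connected_graph G" "card (verts G) \<le> card (edges G)" "y \<in> verts G"
    and "m = card (NC G - {y})" "k = card (CV G - {y})"
  shows "(m + 1) * (m + 2) + 2 + 2 * k \<le> 2 * card (rooted G y)"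
  using above_lower_bound_cyclic[OF assms(1-3) single_cgs[OF assms(4)]] assms(5,6)
  by (simp add: rooted_eq_above)

text \<open>The first edge of the growth is chosen to lead to a non-cut vertex. At least
  \<open>card (edges G)\<close> subgraphs through \<open>y\<close> avoid it, where the general bound
  counts only \<open>m + 1\<close>. This surplus decides equality cases.\<close>

lemma rooted_lower_bound_noncut_edge:
  assumes G: "simple_graph G" "connected_graph G" "card (verts G) \<le> card (edges G)"
    and y: "{y, e} \<in> edges G" "e \<in> NC G"
    and "m = card (NC G - {y})" "k = card (CV G - {y})"
  shows "(m + 1) * m + 2 + 2 * k + 2 * card (edges G) \<le> 2 * card (rooted G y)"
proof -
  let ?T = "({y}, {}) :: 'a ugraph"
  have ye: "y \<noteq> e" "y \<in> verts G" "e \<in> verts G" using simple_graph_edgeD[OF G(1) y(1)] by auto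
  have T: "?T \<in> cgs G" by (rule single_cgs[OF ye(2)])
  have sT: "simple_graph ?T" "connected_graph ?T" using T by (auto simp: cgs_iff)
  have T': "add_edge ?T y e \<in> cgs G"
    using simple_add_edge[OF sT(1) ye(1)] connected_add_edge[OF sT(2), of y e] ye y
    by (auto simp: cgs_iff gle_def)
  have "verts (add_edge ?T y e) = {y, e}" by auto
  then have "card (verts (add_edge ?T y e)) = Suc (card (edges (add_edge ?T y e)))"
    using ye(1) by simp
  note main = above_lower_bound_cyclic[OF G T' this refl refl]
  have "e \<in> verts G - verts ?T" "y \<in> verts ?T" using ye by auto
  note step = outside_step(1,2)[OF G(1) this y(2)]
  have c: "card (edges G) \<le> card {H \<in> above G ?T. {y, e} \<notin> edges H}"
    using card_avoiding[OF G(1,2) y(2,1) T] ye by simp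
  define m' where "m' = card (NC G - verts (add_edge ?T y e))"
  have m: "m = Suc m'" using step(1) assms(6) unfolding m'_def by (metis fst_conv)
  have k: "k = card (CV G - verts (add_edge ?T y e))" using step(2) assms(7) by (metis fst_conv)
  have "y \<in> verts ?T" by simp
  from double_le_sum[OF main c card_above_edge_split[OF G(1) T this]]
  have "(m' + 1) * (m' + 2) + 2 + 2 * k + 2 * card (edges G) \<le> 2 * card (above G ?T)"
    unfolding k m'_def .
  then show ?thesis unfolding m rooted_eq_above by simp
qed

text \<open>Peel off a non-cut vertex \<open>x\<close>; a chain from \<open>x\<close> up to
  \<open>G\<close> provides one subgraph through \<open>x\<close> per vertex of \<open>G\<close>.
  Paths attain the bound.\<close>

lemma card_cgs_ge:
  assumes "simple_graph G" "connected_graph G"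
  shows "card (verts G) * (card (verts G) + 1) \<le> 2 * card (cgs G)"
  using assms
proof (induction "card (verts G)" arbitrary: G rule: less_induct)
  case less
  note G = less.prems
  show ?case
  proof (cases "card (verts G) \<ge> 2")
    case True
    then obtain x where x: "x \<in> NC G" using card_NC_ge_2[OF G True] by fastforce
    then have xV: "x \<in> verts G" by (simp add: NC_iff)
    have "verts G \<noteq> {x}" using True by auto
    then have d: "simple_graph (delete_vertex G x)" "connected_graph (delete_vertex G x)"
      using delete_in_cgs[OF G(1) x] by (auto simp: cgs_iff)
    obtain n where n: "card (verts G) = Suc n" using True by (cases "card (verts G)") auto
    then have c: "card (verts (delete_vertex G x)) = n"
      using xV simple_graphD(1)[OF G(1)] by simp
    have "n * (n + 1) \<le> 2 * card (cgs (delete_vertex G x))"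
      using less.hyps[OF _ d] n c by simp
    moreover have "Suc n \<le> card (rooted G x)"
      using card_above_chain[OF G single_cgs[OF xV]] card_edges_ge[OF G] n
      by (simp add: rooted_eq_above)
    ultimately have "n * (n + 1) + 2 * Suc n \<le> 2 * card (cgs G)"
      using double_le_sum[OF _ _ card_cgs_split[OF G(1), of x]] by blast
    then show ?thesis using n by simp
  next
    case False
    have "card (cgs G) > 0" using self_cgs[OF G] G(1) by (auto simp: card_gt_0_iff)
    moreover have "card (verts G) = 0 \<or> card (verts G) = 1" using False by linarith
    ultimately show ?thesis by auto
  qed
qed

section \<open>Pendant vertices and separations\<close>

definition pendant :: "'a ugraph \<Rightarrow> 'a \<Rightarrow> 'a \<Rightarrow> bool" where
  "pendant G x y \<longleftrightarrow> {x, y} \<in> edges G \<and> (\<forall>e\<in>edges G. x \<in> e \<longrightarrow> e = {x, y})"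

definition induced :: "'a ugraph \<Rightarrow> 'a set \<Rightarrow> 'a ugraph" where
  "induced G S = (S, {e \<in> edges G. e \<subseteq> S})"

lemma induced_simps [simp]: "verts (induced G S) = S" "edges (induced G S) = {e \<in> edges G. e \<subseteq> S}"
  by (simp_all add: induced_def)

lemma simple_induced: "simple_graph G \<Longrightarrow> S \<subseteq> verts G \<Longrightarrow> simple_graph (induced G S)"
  by (auto simp: simple_graph_def intro: finite_subset)

lemma delete_eq_induced:
  assumes "simple_graph G"
  shows "delete_vertex G x = induced G (verts G - {x})"
  using simple_graphD(2)[OF assms] by (auto simp: delete_vertex_def induced_def)

text \<open>\<open>G\<close> is glued from its parts on \<open>A\<close> and \<open>B\<close> at the
  single vertex \<open>y\<close>. The trivial side \<open>{y}\<close> is allowed, so non-triviality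
  is demanded separately where it matters.\<close>

definition sep :: "'a ugraph \<Rightarrow> 'a \<Rightarrow> 'a set \<Rightarrow> 'a set \<Rightarrow> bool" where
  "sep G y A B \<longleftrightarrow> A \<union> B = verts G \<and> A \<inter> B = {y} \<and> (\<forall>e\<in>edges G. e \<subseteq> A \<or> e \<subseteq> B)"

lemma sep_sym: "sep G y A B \<Longrightarrow> sep G y B A"
  by (auto simp: sep_def)

lemma connected_sep:
  assumes G: "simple_graph G" "connected_graph G" and s: "sep G y A B"
  shows "connected_graph (induced G A)"
  unfolding induced_def
proof (rule connected_side[OF G])
  show "A \<subseteq> verts G" "y \<in> A" using s by (auto simp: sep_def)
  fix e assume "e \<in> edges G"
  then have "e \<subseteq> A \<or> e \<subseteq> B" using s by (simp add: sep_def)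
  moreover have "B \<subseteq> insert y (verts G - A)" using s unfolding sep_def by blast
  ultimately show "e \<subseteq> A \<or> e \<subseteq> insert y (verts G - A)" by blast
qed

lemma pendant_facts:
  assumes "simple_graph G" "pendant G x y"
  shows "x \<noteq> y" "x \<in> verts G" "y \<in> verts G" "{x, y} \<in> edges G" "{y, x} \<in> edges G"
    "e \<in> edges G \<Longrightarrow> x \<in> e \<Longrightarrow> e = {x, y}"
  using assms simple_graph_edgeD[OF assms(1), of x y] by (auto simp: pendant_def insert_commute)

lemma pendant_sep:
  assumes "simple_graph G" "pendant G x y"
  shows "sep G y (verts G - {x}) {x, y}"
  unfolding sep_def
proof (intro conjI ballI)
  show "verts G - {x} \<union> {x, y} = verts G" "(verts G - {x}) \<inter> {x, y} = {y}"
    using pendant_facts(1-3)[OF assms] by auto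
  fix e assume e: "e \<in> edges G"
  then show "e \<subseteq> verts G - {x} \<or> e \<subseteq> {x, y}"
    using pendant_facts(6)[OF assms e] simple_graphD(2)[OF assms(1) e] by blast
qed

lemma connected_pendant_delete:
  assumes "simple_graph G" "connected_graph G" "pendant G x y"
  shows "connected_graph (delete_vertex G x)"
  using connected_sep[OF assms(1,2) pendant_sep[OF assms(1,3)]] delete_eq_induced[OF assms(1)]
  by simp

lemma pendant_NC:
  assumes "simple_graph G" "connected_graph G" "pendant G x y"
  shows "x \<in> NC G"
  using connected_pendant_delete[OF assms] pendant_facts(2)[OF assms(1,3)] by (simp add: NC_iff)

lemma add_edge_pendant_delete:
  assumes "simple_graph G" "pendant G x y"
  shows "add_edge (delete_vertex G x) y x = G"
proof -
  have "verts (add_edge (delete_vertex G x) y x) = verts G"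
    using pendant_facts(2,3)[OF assms] by auto
  moreover have "edges (add_edge (delete_vertex G x) y x) = edges G"
  proof (rule set_eqI)
    fix e
    have "e \<in> edges G \<longleftrightarrow> e = {y, x}" if "x \<in> e"
      using pendant_facts(5)[OF assms] pendant_facts(6)[OF assms _ that] by (metis insert_commute)
    then show "e \<in> edges (add_edge (delete_vertex G x) y x) \<longleftrightarrow> e \<in> edges G"
      by (cases "x \<in> e") auto
  qed
  ultimately show ?thesis by (simp add: prod_eq_iff)
qed

lemma pendant_CV:
  assumes G: "simple_graph G" "pendant G x y" and "card (verts G) \<ge> 3"
  shows "y \<in> CV G"
proof -
  note p = pendant_facts[OF G]
  have "\<not> verts G \<subseteq> {x, y}"
  proof
    assume "verts G \<subseteq> {x, y}"
    then have "card (verts G) \<le> card {x, y}" by (rule card_mono[rotated]) simp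
    then show False using p(1) assms(3) by simp
  qed
  then obtain w where w: "w \<in> verts G" "w \<noteq> x" "w \<noteq> y" by blast
  have "\<not> reachable (delete_vertex G y) x w"
  proof
    assume "reachable (delete_vertex G y) x w"
    then have "w \<in> {x}"
    proof (rule reachable_closed)
      fix a b assume "a \<in> {x}" "{a, b} \<in> edges (delete_vertex G y)"
      then have "{x, b} \<in> edges G" "y \<notin> {x, b}" by auto
      then show "b \<in> {x}" using p(6)[of "{x, b}"] by blast
    qed simp
    then show False using w by simp
  qed
  then show ?thesis using p(1-3) w unfolding CV_def cut_vertex_def by auto
qed

text \<open>A connected subgraph that contains more than \<open>x\<close> can leave \<open>x\<close>
  only by the edge \<open>xy\<close>, and deleting \<open>x\<close> from it leaves a connected
  subgraph through \<open>y\<close>.\<close>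

lemma rooted_pendant_eq:
  assumes G: "simple_graph G" and p: "pendant G x y"
  shows "rooted G x = insert ({x}, {}) ((\<lambda>H. add_edge H y x) ` rooted (delete_vertex G x) y)"
    and "inj_on (\<lambda>H. add_edge H y x) (rooted (delete_vertex G x) y)"
    and "({x}, {}) \<notin> (\<lambda>H. add_edge H y x) ` rooted (delete_vertex G x) y"
    and "{H \<in> rooted G y. x \<in> verts H} = (\<lambda>H. add_edge H y x) ` rooted (delete_vertex G x) y"
proof -
  note pf = pendant_facts[OF G p]
  let ?f = "\<lambda>H. add_edge H y x"
  have notin: "x \<notin> verts H" "{y, x} \<notin> edges H" if "H \<in> rooted (delete_vertex G x) y" for H
    using that by (auto simp: rooted_def cgs_iff gle_def)
  have img: "?f H \<in> cgs G \<and> x \<in> verts (?f H) \<and> y \<in> verts (?f H)"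
    if H: "H \<in> rooted (delete_vertex G x) y" for H
  proof -
    have Hp: "simple_graph H" "connected_graph H" "gle H (delete_vertex G x)" "y \<in> verts H"
      using H by (auto simp: rooted_def cgs_iff)
    then show ?thesis using simple_add_edge[OF Hp(1) pf(1)[symmetric]]
        connected_add_edge[OF Hp(2,4), of x] pf by (auto simp: cgs_iff gle_def)
  qed
  have pre: "H \<in> ?f ` rooted (delete_vertex G x) y"
    if H: "H \<in> cgs G" "x \<in> verts H" "y \<in> verts H" for H
  proof -
    have Hp: "simple_graph H" "connected_graph H" "gle H G" using H by (auto simp: cgs_iff)
    have "{x} \<noteq> verts H" using H pf(1) by auto
    then obtain u v where uv: "u \<in> {x}" "{u, v} \<in> edges H"
      using connected_graph_crossing[OF Hp(2) _ _ _ Hp(1), of "{x}"] H by blast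
    have xy: "e = {x, y}" if "e \<in> edges H" "x \<in> e" for e
    proof -
      have "e \<in> edges G" using that(1) Hp(3) by (auto simp: gle_def)
      then show ?thesis using pf(6) that(2) by blast
    qed
    have "pendant H x y" unfolding pendant_def using uv xy by auto
    then have "delete_vertex H x \<in> cgs G \<and> ?f (delete_vertex H x) = H"
      using connected_pendant_delete[OF Hp(1,2)] add_edge_pendant_delete[OF Hp(1)] Hp
      by (auto simp: cgs_iff gle_def)
    moreover have "delete_vertex H x \<in> rooted (delete_vertex G x) y"
      using calculation cgs_delete[of "delete_vertex H x" G x] H pf(1) by (auto simp: rooted_def)
    ultimately show ?thesis by (metis imageI)
  qed
  have single: "H = ({x}, {})" if H: "H \<in> cgs G" "x \<in> verts H" "y \<notin> verts H" for H
  proof -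
    have Hp: "simple_graph H" "connected_graph H" "gle H G" using H by (auto simp: cgs_iff)
    have none: "x \<notin> e" if "e \<in> edges H" for e
    proof
      assume "x \<in> e"
      moreover have "e \<in> edges G" using that Hp(3) by (auto simp: gle_def)
      ultimately have "e = {x, y}" using pf(6) by blast
      then show False using simple_graph_endpoint[OF Hp(1) that, of y] H(3) by blast
    qed
    have V: "verts H = {x}"
    proof (rule ccontr)
      assume "verts H \<noteq> {x}"
      then obtain u v where "u \<in> {x}" "{u, v} \<in> edges H"
        using connected_graph_crossing[OF Hp(2) _ _ _ Hp(1), of "{x}"] H(2) by blast
      then show False using none by blast
    qed
    have "edges H = {}"
    proof (rule ccontr)
      assume "edges H \<noteq> {}"
      then obtain e where e: "e \<in> edges H" by blast
      then have "e \<subseteq> {x}" "card e = 2" using simple_graphD(2,3)[OF Hp(1) e] V by auto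
      then have "card e \<le> card {x}" by (intro card_mono) auto
      then show False using \<open>card e = 2\<close> by simp
    qed
    then show ?thesis using V by (simp add: prod_eq_iff)
  qed
  show "rooted G x = insert ({x}, {}) (?f ` rooted (delete_vertex G x) y)"
  proof (rule set_eqI, rule iffI)
    fix H assume "H \<in> rooted G x"
    then have H: "H \<in> cgs G" "x \<in> verts H" by (simp_all add: rooted_def)
    show "H \<in> insert ({x}, {}) (?f ` rooted (delete_vertex G x) y)"
      using pre[OF H] single[OF H] by blast
  next
    fix H assume "H \<in> insert ({x}, {}) (?f ` rooted (delete_vertex G x) y)"
    then consider "H = ({x}, {})" | H' where "H' \<in> rooted (delete_vertex G x) y" "H = ?f H'" by blast
    then show "H \<in> rooted G x"
    proof cases
      case 1
      then show ?thesis using single_cgs[OF pf(2)] by (simp add: rooted_def)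
    next
      case 2
      then show ?thesis using img[OF 2(1)] unfolding rooted_def by blast
    qed
  qed
  show "{H \<in> rooted G y. x \<in> verts H} = ?f ` rooted (delete_vertex G x) y"
  proof (rule set_eqI, rule iffI)
    fix H assume "H \<in> {H \<in> rooted G y. x \<in> verts H}"
    then show "H \<in> ?f ` rooted (delete_vertex G x) y" using pre[of H] unfolding rooted_def by blast
  next
    fix H assume "H \<in> ?f ` rooted (delete_vertex G x) y"
    then obtain H' where H': "H' \<in> rooted (delete_vertex G x) y" "H = ?f H'" by blast
    show "H \<in> {H \<in> rooted G y. x \<in> verts H}" using img[OF H'(1)] H'(2) unfolding rooted_def by blast
  qed
  show "({x}, {}) \<notin> ?f ` rooted (delete_vertex G x) y"
  proof
    assume "({x}, {}) \<in> ?f ` rooted (delete_vertex G x) y"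
    then obtain H' where H': "H' \<in> rooted (delete_vertex G x) y" "({x}, {}) = ?f H'" by blast
    have "y \<in> verts ({x}, {})" unfolding H'(2) using img[OF H'(1)] by blast
    then show False using pf(1) by simp
  qed
  show "inj_on ?f (rooted (delete_vertex G x) y)"
  proof (rule inj_onI)
    fix H H' assume H: "H \<in> rooted (delete_vertex G x) y" "H' \<in> rooted (delete_vertex G x) y"
      and eq: "?f H = ?f H'"
    have "delete_vertex (?f H) x = H" if "H \<in> rooted (delete_vertex G x) y" for H
    proof -
      have "simple_graph H" "y \<in> verts H" using that by (auto simp: rooted_def cgs_iff)
      then have "\<And>e. e \<in> edges H \<Longrightarrow> x \<notin> e"
        using simple_graph_endpoint[of H _ x] notin[OF that] by blast
      then have "edges (delete_vertex (?f H) x) = edges H" using notin[OF that] by auto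
      moreover have "verts (delete_vertex (?f H) x) = verts H"
        using notin[OF that] \<open>y \<in> verts H\<close> pf(1) by auto
      ultimately show ?thesis by (simp add: prod_eq_iff)
    qed
    then show "H = H'" using H eq by metis
  qed
qed

lemma cgs_delete_iff: "H \<in> cgs (delete_vertex G x) \<longleftrightarrow> H \<in> cgs G \<and> x \<notin> verts H"
proof
  assume "H \<in> cgs (delete_vertex G x)"
  then show "H \<in> cgs G \<and> x \<notin> verts H" by (auto simp: cgs_iff gle_def)
qed (simp add: cgs_delete)

text \<open>Each connected subgraph through \<open>y\<close> that avoids \<open>x\<close> can be
  extended by the edge \<open>yx\<close>. This doubles the count at \<open>y\<close> and, together
  with \<open>x\<close> alone, gives the count at \<open>x\<close>.\<close>

lemma card_rooted_pendant:
  assumes G: "simple_graph G" and p: "pendant G x y"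
  shows "card (rooted G x) = Suc (card (rooted (delete_vertex G x) y))"
    and "card (rooted G y) = 2 * card (rooted (delete_vertex G x) y)"
proof -
  note r = rooted_pendant_eq[OF G p]
  have fin: "finite (rooted (delete_vertex G x) y)" using G by simp
  show "card (rooted G x) = Suc (card (rooted (delete_vertex G x) y))"
    unfolding r(1) using r(3) fin card_image[OF r(2)] by simp
  let ?P = "{H \<in> rooted G y. x \<in> verts H}"
  let ?Q = "rooted (delete_vertex G x) y"
  have "rooted G y = ?P \<union> ?Q" "?P \<inter> ?Q = {}" by (auto simp: rooted_def cgs_delete_iff)
  then have "card (rooted G y) = card ?P + card ?Q"
    using card_Un_disjoint[of ?P ?Q] G by simp
  then show "card (rooted G y) = 2 * card (rooted (delete_vertex G x) y)"
    unfolding r(4) card_image[OF r(2)] by simp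
qed

lemma delete_delete: "delete_vertex (delete_vertex G x) v = delete_vertex (delete_vertex G v) x"
  by (auto simp: delete_vertex_def)

text \<open>\<open>x\<close> is still pendant in \<open>G - v\<close>, so removing it there neither
  destroys nor creates connectedness.\<close>

lemma pendant_NC_iff:
  assumes G: "simple_graph G" "connected_graph G" and p: "pendant G x y" and v: "v \<noteq> x" "v \<noteq> y"
  shows "v \<in> NC G \<longleftrightarrow> v \<in> NC (delete_vertex G x)"
proof -
  note pf = pendant_facts[OF G(1) p]
  have "y \<in> verts G" "y \<in> verts (delete_vertex G x)" using pf(1,3) by simp_all
  then have ne: "verts G \<noteq> {v}" "verts (delete_vertex G x) \<noteq> {v}" using v(2) by (metis singletonD)+
  have pv: "pendant (delete_vertex G v) x y" using p v by (auto simp: pendant_def)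
  have s: "simple_graph (delete_vertex G v)" using G by simp
  have "y \<in> verts (delete_vertex (delete_vertex G v) x)" using pf(1,3) v(2) by simp
  then have eq: "connected_graph (delete_vertex G v) \<longleftrightarrow>
      connected_graph (delete_vertex (delete_vertex G x) v)"
    unfolding delete_delete[of G x v]
    using connected_pendant_delete[OF s _ pv] add_edge_pendant_delete[OF s pv]
      connected_add_edge by metis
  have "v \<in> verts G \<longleftrightarrow> v \<in> verts (delete_vertex G x)" using v(1) by simp
  then show ?thesis using ne eq unfolding NC_iff by blast
qed

lemma pendant_NC_eq:
  assumes G: "simple_graph G" "connected_graph G" and p: "pendant G x y" and n: "card (verts G) \<ge> 3"
  shows "NC G = insert x (NC (delete_vertex G x) - {y})"
proof (rule set_eqI)
  fix v
  have "y \<notin> NC G" using pendant_CV[OF G(1) p n] by (simp add: NC_def)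
  moreover have "x \<notin> NC (delete_vertex G x)" by (simp add: NC_iff)
  ultimately show "v \<in> NC G \<longleftrightarrow> v \<in> insert x (NC (delete_vertex G x) - {y})"
    using pendant_NC_iff[OF G p, of v] pendant_NC[OF G p]
    by (cases "v = x"; cases "v = y") simp_all
qed

lemma pendant_cards:
  assumes G: "simple_graph G" "connected_graph G" and p: "pendant G x y" and n: "card (verts G) \<ge> 3"
  shows "y \<in> NC (delete_vertex G x) \<Longrightarrow> card (NC G) = card (NC (delete_vertex G x))"
    "y \<in> NC (delete_vertex G x) \<Longrightarrow> card (CV G) = Suc (card (CV (delete_vertex G x)))"
    "y \<notin> NC (delete_vertex G x) \<Longrightarrow> card (NC G) = Suc (card (NC (delete_vertex G x)))"
    "y \<notin> NC (delete_vertex G x) \<Longrightarrow> card (CV G) = card (CV (delete_vertex G x))"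
    "card (verts G) = Suc (card (verts (delete_vertex G x)))"
    "card (edges G) = Suc (card (edges (delete_vertex G x)))"
proof -
  let ?G = "delete_vertex G x"
  note pf = pendant_facts[OF G(1) p]
  have s: "simple_graph ?G" using G by simp
  have xN: "x \<notin> NC ?G" by (simp add: NC_iff)
  note eq = pendant_NC_eq[OF G p n]
  have fin: "finite (NC ?G)" using NC_subset[of ?G] simple_graphD(1)[OF s] finite_subset by blast
  have c: "card (NC G) = Suc (card (NC ?G - {y}))" using eq fin xN by simp
  show V: "card (verts G) = Suc (card (verts ?G))"
    using pf(2) simple_graphD(1)[OF G(1)] card.remove[of "verts G" x] by simp
  have "{e \<in> edges G. x \<in> e} = {{x, y}}" using pf(4,6) by blast
  then show "card (edges G) = Suc (card (edges ?G))" using card_edges_delete[OF G(1), of x] by simp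
  note t = NC_CV_card[OF G(1)] NC_CV_card[OF s]
  show 1: "card (NC G) = card (NC ?G)" if "y \<in> NC ?G" using c card.remove[OF fin that] by simp
  show 2: "card (NC G) = Suc (card (NC ?G))" if "y \<notin> NC ?G" using c that by simp
  show "card (CV G) = Suc (card (CV ?G))" if "y \<in> NC ?G" using 1[OF that] t V by linarith
  show "card (CV G) = card (CV ?G)" if "y \<notin> NC ?G" using 2[OF that] t V by linarith
qed

lemma small_degree_pendant:
  assumes G: "simple_graph G" "connected_graph G" and x: "x \<in> verts G" "verts G \<noteq> {x}"
    and d: "card {e \<in> edges G. x \<in> e} \<le> 1"
  obtains y where "pendant G x y"
proof -
  obtain u y where uy: "u \<in> {x}" "{u, y} \<in> edges G"
    using connected_graph_crossing[OF G(2) _ _ _ G(1), of "{x}"] x by blast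
  have fin: "finite {e \<in> edges G. x \<in> e}" using simple_graphD(4)[OF G(1)] by simp
  have uniq: "a = b" if "a \<in> {e \<in> edges G. x \<in> e}" "b \<in> {e \<in> edges G. x \<in> e}" for a b
    using card_le_Suc0_iff_eq[OF fin] d that by (metis One_nat_def)
  have xy: "{x, y} \<in> edges G" using uy by simp
  have "pendant G x y" unfolding pendant_def
  proof (intro conjI ballI impI)
    fix e assume "e \<in> edges G" "x \<in> e"
    with xy show "e = {x, y}" by (intro uniq) simp_all
  qed (rule xy)
  then show thesis by (rule that)
qed

text \<open>\<open>G - x\<close> is connected and so has at least \<open>card (verts G) - 2\<close>
  edges. The tree has only one more, hence at most one edge at \<open>x\<close>.\<close>

lemma tree_NC_pendant:
  assumes G: "simple_graph G" "connected_graph G" "card (verts G) = Suc (card (edges G))"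
    and x: "x \<in> NC G" "verts G \<noteq> {x}"
  obtains y where "pendant G x y"
proof -
  have xV: "x \<in> verts G" using x by (simp add: NC_iff)
  have "connected_graph (delete_vertex G x)" using x by (simp add: NC_iff)
  then have "card (verts (delete_vertex G x)) \<le> Suc (card (edges (delete_vertex G x)))"
    by (rule card_edges_ge[OF simple_delete[OF G(1)]])
  moreover have "card (verts G) = Suc (card (verts (delete_vertex G x)))"
    using xV simple_graphD(1)[OF G(1)] card.remove[of "verts G" x] by simp
  ultimately have "card {e \<in> edges G. x \<in> e} \<le> 1" using card_edges_delete[OF G(1), of x] G(3) by linarith
  then show thesis using small_degree_pendant[OF G(1,2) xV x(2)] that by blast
qed

section \<open>Separations at a cut vertex\<close>

lemma CV_sep:
  assumes G: "simple_graph G" and y: "y \<in> CV G"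
  obtains A B where "sep G y A B" "A \<noteq> {y}" "B \<noteq> {y}"
proof -
  let ?G = "delete_vertex G y"
  obtain u w where uw: "u \<in> verts ?G" "w \<in> verts ?G" "\<not> reachable ?G u w" and yV: "y \<in> verts G"
    using y by (auto simp: CV_def cut_vertex_def)
  let ?A = "insert y {v \<in> verts ?G. reachable ?G u v}"
  let ?B = "insert y {v \<in> verts ?G. \<not> reachable ?G u v}"
  have "sep G y ?A ?B" unfolding sep_def
  proof (intro conjI ballI)
    show "?A \<union> ?B = verts G" "?A \<inter> ?B = {y}" using yV by auto
    fix e assume e: "e \<in> edges G"
    obtain a b where ab: "e = {a, b}" using simple_graphD(3)[OF G e] by (auto simp: card_2_iff)
    have abV: "a \<in> verts G" "b \<in> verts G" using simple_graphD(2)[OF G e] ab by auto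
    show "e \<subseteq> ?A \<or> e \<subseteq> ?B"
    proof (cases "y \<in> e")
      case True
      then show ?thesis using ab abV by auto
    next
      case False
      then have "{a, b} \<in> edges ?G" "{b, a} \<in> edges ?G" using e ab by (auto simp: insert_commute)
      then have "reachable ?G u a \<longleftrightarrow> reachable ?G u b"
        using reachable_trans[OF _ reachable_edge] by metis
      then show ?thesis using ab abV False by auto
    qed
  qed
  moreover have "?A \<noteq> {y}" "?B \<noteq> {y}" using uw by auto
  ultimately show thesis using that by blast
qed

text \<open>Deleting \<open>v\<close> leaves the side \<open>B\<close> untouched, which is connected
  and attached at \<open>y\<close>; so the part on \<open>A\<close> alone decides whether the rest
  falls apart.\<close>

lemma sep_NC_iff:
  assumes G: "simple_graph G" "connected_graph G" and s: "sep G y A B" and v: "v \<in> A" "v \<noteq> y"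
  shows "v \<in> NC G \<longleftrightarrow> v \<in> NC (induced G A)"
proof -
  have AB: "A \<union> B = verts G" "A \<inter> B = {y}" "\<And>e. e \<in> edges G \<Longrightarrow> e \<subseteq> A \<or> e \<subseteq> B"
    using s by (auto simp: sep_def)
  have y: "y \<in> A" "y \<in> B" "v \<notin> B" using AB(2) v by auto
  have neA: "A \<noteq> {v}" using y(1) v(2) by blast
  have "y \<in> verts G" using y(1) AB(1) by auto
  then have neG: "verts G \<noteq> {v}" using v(2) by auto
  note ne = neG neA
  have s': "sep (delete_vertex G v) y (A - {v}) B"
    unfolding sep_def
  proof (intro conjI ballI)
    show "A - {v} \<union> B = verts (delete_vertex G v)" "(A - {v}) \<inter> B = {y}"
      using AB(1,2) y v by auto
    fix e assume "e \<in> edges (delete_vertex G v)"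
    then show "e \<subseteq> A - {v} \<or> e \<subseteq> B" using AB(3)[of e] by auto
  qed
  have i: "induced (delete_vertex G v) (A - {v}) = delete_vertex (induced G A) v"
    by (auto simp: induced_def delete_vertex_def)
  have "connected_graph (delete_vertex (induced G A) v)" if "connected_graph (delete_vertex G v)"
    using connected_sep[OF _ that s'] G(1) i by simp
  moreover have "connected_graph (delete_vertex G v)" if c: "connected_graph (delete_vertex (induced G A) v)"
  proof -
    have "connected_graph (graph_union (delete_vertex (induced G A) v) (induced G B))"
      using connected_graph_union[OF c connected_sep[OF G sep_sym[OF s]], of y] y v by simp
    moreover have "graph_union (delete_vertex (induced G A) v) (induced G B) = delete_vertex G v"
    proof -
      have "verts (graph_union (delete_vertex (induced G A) v) (induced G B)) = verts (delete_vertex G v)"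
        using AB(1) y by auto
      moreover have "edges (graph_union (delete_vertex (induced G A) v) (induced G B)) = edges (delete_vertex G v)"
        using AB(3) y(3) by auto
      ultimately show ?thesis by (simp add: prod_eq_iff)
    qed
    ultimately show ?thesis by simp
  qed
  ultimately show ?thesis using ne v AB(1) unfolding NC_iff by auto
qed

lemma sep_cards:
  assumes G: "simple_graph G" "connected_graph G" and s: "sep G y A B"
  shows "card (NC G - {y}) = card (NC (induced G A) - {y}) + card (NC (induced G B) - {y})"
    "card (CV G - {y}) = card (CV (induced G A) - {y}) + card (CV (induced G B) - {y})"
    "Suc (card (verts G)) = card A + card B"
    "card (edges G) = card (edges (induced G A)) + card (edges (induced G B))"
proof -
  have AB: "A \<union> B = verts G" "A \<inter> B = {y}" "\<And>e. e \<in> edges G \<Longrightarrow> e \<subseteq> A \<or> e \<subseteq> B"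
    using s by (auto simp: sep_def)
  have fin: "finite A" "finite B" using AB(1) simple_graphD(1)[OF G(1)] by (metis finite_Un)+
  note iA = sep_NC_iff[OF G s] and iB = sep_NC_iff[OF G sep_sym[OF s]]
  have sub: "NC G \<subseteq> A \<union> B" "CV G \<subseteq> A \<union> B" "NC (induced G A) \<subseteq> A" "NC (induced G B) \<subseteq> B"
    "CV (induced G A) \<subseteq> A" "CV (induced G B) \<subseteq> B"
    using NC_subset CV_subset AB(1) by (metis, metis, (metis induced_simps(1))+)
  have CVN: "CV H = verts H - NC H" for H :: "'a ugraph"
    using CV_subset[of H] by (auto simp: NC_def)
  have N: "NC G - {y} = (NC (induced G A) - {y}) \<union> (NC (induced G B) - {y})"
    using iA iB sub by blast
  have C: "CV G - {y} = (CV (induced G A) - {y}) \<union> (CV (induced G B) - {y})"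
  proof -
    have "v \<in> CV G \<longleftrightarrow> v \<in> CV (induced G A)" if "v \<in> A" "v \<noteq> y" for v
      using iA[OF that] that AB(1) unfolding CVN by auto
    moreover have "v \<in> CV G \<longleftrightarrow> v \<in> CV (induced G B)" if "v \<in> B" "v \<noteq> y" for v
      using iB[OF that] that AB(1) unfolding CVN by auto
    ultimately show ?thesis using sub by blast
  qed
  have d: "(NC (induced G A) - {y}) \<inter> (NC (induced G B) - {y}) = {}"
    "(CV (induced G A) - {y}) \<inter> (CV (induced G B) - {y}) = {}"
    using sub AB(2) by blast+
  have f: "finite (NC (induced G A) - {y})" "finite (NC (induced G B) - {y})"
    "finite (CV (induced G A) - {y})" "finite (CV (induced G B) - {y})"
    using sub fin by (meson finite_Diff finite_subset)+
  show "card (NC G - {y}) = card (NC (induced G A) - {y}) + card (NC (induced G B) - {y})"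
    unfolding N using f d by (simp add: card_Un_disjoint)
  show "card (CV G - {y}) = card (CV (induced G A) - {y}) + card (CV (induced G B) - {y})"
    unfolding C using f d by (simp add: card_Un_disjoint)
  show "Suc (card (verts G)) = card A + card B"
    using card_Un_Int[OF fin] AB(1,2) by simp
  have E: "edges G = edges (induced G A) \<union> edges (induced G B)" using AB(3) by auto
  have "edges (induced G A) \<inter> edges (induced G B) = {}"
  proof (rule ccontr)
    assume "edges (induced G A) \<inter> edges (induced G B) \<noteq> {}"
    then obtain e where e: "e \<in> edges G" "e \<subseteq> {y}" using AB(2) by auto
    then have "card e \<le> 1" using card_mono[of "{y}" e] by simp
    then show False using simple_graphD(3)[OF G(1) e(1)] by simp
  qed
  then show "card (edges G) = card (edges (induced G A)) + card (edges (induced G B))"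
    using E simple_graphD(4)[OF G(1)] by (metis card_Un_disjoint finite_Un)
qed

text \<open>The union of connected subgraphs through \<open>y\<close>, one from each side, is
  connected. Both parts are recovered by restricting to the sides, because no edge lies in
  both.\<close>

lemma sep_rooted_product:
  assumes G: "simple_graph G" and s: "sep G y A B"
  shows "card (rooted (induced G A) y) * card (rooted (induced G B) y) \<le> card (rooted G y)"
proof -
  have AB: "A \<union> B = verts G" "A \<inter> B = {y}" using s by (auto simp: sep_def)
  let ?f = "\<lambda>(H, K). graph_union H K"
  let ?X = "rooted (induced G A) y \<times> rooted (induced G B) y"
  have sub: "?f ` ?X \<subseteq> rooted G y"
  proof (rule image_subsetI)
    fix p assume "p \<in> ?X"
    then obtain H K where p: "p = (H, K)" and H: "H \<in> rooted (induced G A) y"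
      and K: "K \<in> rooted (induced G B) y" by blast
    have h: "simple_graph H" "connected_graph H" "y \<in> verts H" "verts H \<subseteq> A" "edges H \<subseteq> edges G"
      using H by (auto simp: rooted_def cgs_iff gle_def)
    have k: "simple_graph K" "connected_graph K" "y \<in> verts K" "verts K \<subseteq> B" "edges K \<subseteq> edges G"
      using K by (auto simp: rooted_def cgs_iff gle_def)
    have "gle (graph_union H K) G" using h(4,5) k(4,5) AB(1) unfolding gle_def graph_union_simps by blast
    then show "?f p \<in> rooted G y"
      using simple_graph_union[OF h(1) k(1)] connected_graph_union[OF h(2) k(2) h(3) k(3)] h(3) p
      by (simp add: rooted_def cgs_iff)
  qed
  \<comment> \<open>\<open>A\<close> and \<open>B\<close> are quantified anew, so that the fact
    serves for either side.\<close>
  have rec: "H = (verts (graph_union H K) \<inter> A, {e \<in> edges (graph_union H K). e \<subseteq> A})"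
    if sp: "A \<inter> B = {y}" and H: "H \<in> rooted (induced G A) y" and K: "K \<in> rooted (induced G B) y"
    for H K A B
  proof -
    have e: "\<not> e \<subseteq> A" if "e \<in> edges K" for e
    proof
      assume "e \<subseteq> A"
      moreover have "e \<subseteq> B" "card e = 2"
        using that K simple_graphD(3)[OF G] by (auto simp: rooted_def cgs_iff gle_def)
      ultimately have "e \<subseteq> {y}" using sp by blast
      then have "card e \<le> 1" using card_mono[of "{y}" e] by simp
      then show False using \<open>card e = 2\<close> by simp
    qed
    have hk: "verts H \<subseteq> A" "y \<in> verts H" "verts K \<subseteq> B" "\<And>e. e \<in> edges H \<Longrightarrow> e \<subseteq> A"
      using H K by (auto simp: rooted_def cgs_iff gle_def)
    have "verts K \<inter> A \<subseteq> {y}" using hk(3) sp by blast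
    then have "verts H = verts (graph_union H K) \<inter> A" using hk(1,2) by auto
    moreover have "edges H = {e \<in> edges (graph_union H K). e \<subseteq> A}" using hk(4) e by auto
    ultimately show ?thesis by (simp add: prod_eq_iff)
  qed
  have gc: "graph_union H K = graph_union K H" for H K :: "'a ugraph" by (auto simp: graph_union_def)
  have "inj_on ?f ?X"
  proof (rule inj_onI)
    fix p q assume p: "p \<in> ?X" and q: "q \<in> ?X" and eq: "?f p = ?f q"
    obtain H K where HK: "p = (H, K)" by (cases p)
    obtain H' K' where HK': "q = (H', K')" by (cases q)
    have g: "graph_union H K = graph_union H' K'" "graph_union K H = graph_union K' H'" using eq HK HK' gc by auto
    have BA: "B \<inter> A = {y}" using AB(2) by blast
    have "H = H'" using rec[OF AB(2), of H K] rec[OF AB(2), of H' K'] p q HK HK' g by simp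
    moreover have "K = K'" using rec[OF BA, of K H] rec[OF BA, of K' H'] p q HK HK' g by simp
    ultimately show "p = q" using HK HK' by simp
  qed
  from card_image[OF this] card_mono[OF _ sub] G show ?thesis by (simp add: card_cartesian_product)
qed

section \<open>Paths, cycles and lollipops\<close>

fun pedges :: "'a list \<Rightarrow> 'a set set" where
  "pedges (x # y # zs) = insert {x, y} (pedges (y # zs))"
| "pedges _ = {}"

text \<open>The cycle \<open>c\<close> with the path \<open>p\<close> hanging off the last vertex of \<open>c\<close>.\<close>

definition lollipop :: "'a list \<Rightarrow> 'a list \<Rightarrow> 'a ugraph" where
  "lollipop c p = (set (c @ p), insert {hd c, last c} (pedges (c @ p)))"

definition path_on :: "'a list \<Rightarrow> 'a ugraph" where
  "path_on p = (set p, pedges p)"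

lemma lollipop_simps [simp]: "verts (lollipop c p) = set c \<union> set p"
  "edges (lollipop c p) = insert {hd c, last c} (pedges (c @ p))"
  by (simp_all add: lollipop_def)

lemma path_on_simps [simp]: "verts (path_on p) = set p" "edges (path_on p) = pedges p"
  by (simp_all add: path_on_def)

lemma pedges_Cons: "xs \<noteq> [] \<Longrightarrow> pedges (x # xs) = insert {x, hd xs} (pedges xs)"
  by (cases xs) auto

lemma pedges_append: "p \<noteq> [] \<Longrightarrow> q \<noteq> [] \<Longrightarrow> pedges (p @ q) = insert {last p, hd q} (pedges p \<union> pedges q)"
  by (induction p rule: pedges.induct) (auto simp: pedges_Cons)

lemma pedges_subset: "e \<in> pedges xs \<Longrightarrow> e \<subseteq> set xs"
  by (induction xs rule: pedges.induct) auto

lemma pedges_card: "distinct xs \<Longrightarrow> e \<in> pedges xs \<Longrightarrow> card e = 2"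
  by (induction xs rule: pedges.induct) auto

lemma finite_pedges [simp]: "finite (pedges xs)"
  by (induction xs rule: pedges.induct) auto

lemma card_pedges: "distinct xs \<Longrightarrow> card (pedges xs) = length xs - 1"
proof (induction xs rule: pedges.induct)
  case (1 x y zs)
  have "{x, y} \<notin> pedges (y # zs)" using pedges_subset[of "{x, y}" "y # zs"] 1(2) by auto
  then show ?case using 1 by simp
qed auto

lemma pedges_map: "pedges (map f xs) = (`) f ` pedges xs"
  by (induction xs rule: pedges.induct) auto

lemma pedges_split:
  assumes "e \<in> pedges xs"
  obtains p q where "xs = p @ q" "p \<noteq> []" "q \<noteq> []" "e = {last p, hd q}"
  using assms
proof (induction xs arbitrary: thesis rule: pedges.induct)
  case (1 x y zs)
  show ?case
  proof (cases "e = {x, y}")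
    case True
    then show ?thesis using 1(2)[of "[x]" "y # zs"] by simp
  next
    case False
    then have "e \<in> pedges (y # zs)" using 1(3) by simp
    then obtain p q where "y # zs = p @ q" "p \<noteq> []" "q \<noteq> []" "e = {last p, hd q}"
      using 1(1) by blast
    then show ?thesis using 1(2)[of "x # p" q] by simp
  qed
qed simp_all

lemma simple_path_on: "distinct p \<Longrightarrow> simple_graph (path_on p)"
  using pedges_subset[of _ p] pedges_card[of p] by (simp add: simple_graph_def)

lemma connected_path_on: "p \<noteq> [] \<Longrightarrow> connected_graph (path_on p)"
proof (induction p rule: pedges.induct)
  case (1 x y zs)
  have "connected_graph (add_edge (path_on (y # zs)) y x)"
    by (rule connected_add_edge) (use 1 in auto)
  moreover have "add_edge (path_on (y # zs)) y x = path_on (x # y # zs)"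
    by (auto simp: add_edge_def path_on_def insert_commute)
  ultimately show ?case by simp
qed (auto simp: connected_graph_def)

lemma closing_edge_notin:
  assumes "distinct c" "length c \<ge> 3"
  shows "{hd c, last c} \<notin> pedges c" "hd c \<noteq> last c" "hd c \<in> set c" "last c \<in> set c"
proof -
  obtain x y z zs where c: "c = x # y # z # zs"
    using assms(2) by (auto simp: numeral_3_eq_3 Suc_le_length_iff)
  have l: "last c \<in> set (z # zs)" unfolding c by simp
  have "{x, last c} \<noteq> {x, y}" using l assms(1) unfolding c by (auto simp: doubleton_eq_iff)
  moreover have "{x, last c} \<notin> pedges (y # z # zs)"
    using pedges_subset[of "{x, last c}" "y # z # zs"] assms(1) unfolding c by auto
  ultimately show "{hd c, last c} \<notin> pedges c" unfolding c by simp
  show "hd c \<noteq> last c" using l assms(1) unfolding c by auto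
  show "hd c \<in> set c" "last c \<in> set c" unfolding c by simp_all
qed

lemma simple_lollipop:
  assumes "distinct (c @ p)" "length c \<ge> 3"
  shows "simple_graph (lollipop c p)"
proof -
  have "distinct c" using assms by simp
  note cl = closing_edge_notin[OF this assms(2)]
  have "e \<subseteq> set c \<union> set p \<and> card e = 2" if "e \<in> pedges (c @ p)" for e
    using pedges_subset[OF that] pedges_card[OF assms(1) that] by simp
  then show ?thesis using cl by (simp add: simple_graph_def)
qed

lemma connected_lollipop: "c \<noteq> [] \<Longrightarrow> connected_graph (lollipop c p)"
  using connected_mono_edges[OF connected_path_on[of "c @ p"], of "lollipop c p"] by auto

lemma lollipop_swap:
  assumes "p \<noteq> []" "q \<noteq> []"
  shows "lollipop (p @ q) [] = lollipop (q @ p) []"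
proof -
  have "edges (lollipop (p @ q) []) = edges (lollipop (q @ p) [])"
    using assms by (auto simp: pedges_append insert_commute)
  then show ?thesis using assms by (simp add: prod_eq_iff Un_commute)
qed

text \<open>A cycle may be cut open at any place. This allows a prescribed vertex or edge to be
  moved to the seam of the list.\<close>

lemma lollipop_rotate: "lollipop (rotate s c) [] = lollipop c []"
proof (cases "take (s mod length c) c = [] \<or> drop (s mod length c) c = []")
  case True
  then have "rotate s c = c"
    using append_take_drop_id[of "s mod length c" c] unfolding rotate_drop_take
    by (metis append_Nil append_Nil2)
  then show ?thesis by simp
next
  case False
  then show ?thesis using lollipop_swap[of "drop (s mod length c) c" "take (s mod length c) c"]
    unfolding rotate_drop_take by simp
qed

lemma rotate_swap: "rotate (length p) (p @ q) = q @ p"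
  by (rule rotate_append)

text \<open>Rotate \<open>v\<close> to the front; the rest of the cycle is a path along the other
  vertices.\<close>

lemma NC_cycle:
  assumes "distinct c" "length c \<ge> 3"
  shows "NC (lollipop c []) = set c"
proof
  show "NC (lollipop c []) \<subseteq> set c" using NC_subset[of "lollipop c []"] by simp
  show "set c \<subseteq> NC (lollipop c [])"
  proof
    fix v assume "v \<in> set c"
    then obtain u w where c: "c = u @ v # w" by (metis split_list)
    define d where "d = v # w @ u"
    have d: "d = rotate (length u) c" unfolding c d_def by (simp add: rotate_swap)
    have dist: "distinct d" "length d = length c" using assms unfolding d by simp_all
    have ne: "w @ u \<noteq> []" using assms(2) unfolding c by auto
    have L: "lollipop c [] = lollipop d []" unfolding d by (simp add: lollipop_rotate)
    have "connected_graph (delete_vertex (lollipop d []) v)"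
    proof (rule connected_mono_edges[OF connected_path_on[OF ne]])
      show "edges (path_on (w @ u)) \<subseteq> edges (delete_vertex (lollipop d []) v)"
      proof
        fix e assume e: "e \<in> edges (path_on (w @ u))"
        then have "v \<notin> e" using pedges_subset[of e "w @ u"] dist(1) unfolding d_def by auto
        then show "e \<in> edges (delete_vertex (lollipop d []) v)"
          using e ne unfolding d_def by (simp add: pedges_Cons)
      qed
      show "verts (delete_vertex (lollipop d []) v) = verts (path_on (w @ u))"
        using dist(1) unfolding d_def by auto
    qed
    moreover have "v \<in> set d" unfolding d_def by simp
    ultimately show "v \<in> NC (lollipop c [])" using L by (simp add: NC_iff)
  qed
qed

section \<open>Cycles contained in a graph\<close>

definition cyc :: "'a ugraph \<Rightarrow> 'a list \<Rightarrow> bool" where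
  "cyc G c \<longleftrightarrow> distinct c \<and> 3 \<le> length c \<and> gle (lollipop c []) G"

lemma cyc_cgs: "cyc G c \<Longrightarrow> lollipop c [] \<in> cgs G"
  using simple_lollipop[of c "[]"] connected_lollipop[of c "[]"]
  by (cases "c = []") (auto simp: cyc_def cgs_iff)

lemma cyc_mono: "cyc G c \<Longrightarrow> gle G G' \<Longrightarrow> cyc G' c"
  by (auto simp: cyc_def intro: gle_trans)

text \<open>A cycle has no cut vertex, and \<open>NC_mono\<close> compares it with \<open>G\<close>.
  In this way the girth hypothesis becomes a lower bound for the number of non-cut vertices.\<close>

lemma cyc_length_le_NC:
  assumes "simple_graph G" "connected_graph G" "cyc G c"
  shows "length c \<le> card (NC G)"
  using NC_mono[OF assms(1,2) cyc_cgs[OF assms(3)]] NC_cycle[of c] assms(3)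
  by (simp add: cyc_def distinct_card)

text \<open>Take a longest path: a neighbour of its end outside the path would prolong it.\<close>

lemma longest_path_end:
  assumes G: "simple_graph G" and x: "x \<in> verts G"
  obtains y ys where "distinct (y # ys)" "set (y # ys) \<subseteq> verts G" "pedges (y # ys) \<subseteq> edges G"
    "\<And>z. {y, z} \<in> edges G \<Longrightarrow> z \<in> set ys"
proof -
  let ?P = "\<lambda>xs. distinct xs \<and> set xs \<subseteq> verts G \<and> pedges xs \<subseteq> edges G \<and> xs \<noteq> []"
  have "?P [x]" using x by simp
  moreover have "\<forall>xs. ?P xs \<longrightarrow> length xs < Suc (card (verts G))"
    using card_mono[OF simple_graphD(1)[OF G]] by (metis distinct_card less_Suc_eq_le)
  ultimately have "\<exists>xs. ?P xs \<and> (\<forall>ys. ?P ys \<longrightarrow> length ys \<le> length xs)"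
    by (rule ex_has_greatest_nat)
  then obtain xs where xs: "?P xs" "\<And>ys. ?P ys \<Longrightarrow> length ys \<le> length xs" by blast
  obtain y ys where y: "xs = y # ys" using xs(1) by (cases xs) auto
  have "z \<in> set ys" if z: "{y, z} \<in> edges G" for z
  proof (rule ccontr)
    assume "z \<notin> set ys"
    then have "z \<notin> set xs" using simple_graph_edgeD(1)[OF G z] unfolding y by auto
    moreover have "z \<in> verts G" "{z, y} \<in> edges G"
      using simple_graph_edgeD(3)[OF G z] z by (simp_all add: insert_commute)
    ultimately have "?P (z # xs)" using xs(1) unfolding y by simp
    then show False using xs(2)[of "z # xs"] by simp
  qed
  then show thesis using that[of y ys] xs(1) unfolding y by blast
qed

text \<open>Stripping off a pendant vertex does not change edges minus vertices. Without pendant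
  vertices the end \<open>y\<close> of a longest path has a second neighbour \<open>z\<close>, which
  is on the path, and the segment from \<open>y\<close> to \<open>z\<close> closes to a
  cycle.\<close>

lemma cyc_exists:
  assumes "simple_graph G" "connected_graph G" "card (verts G) \<le> card (edges G)"
  obtains c where "cyc G c"
  using assms
proof (induction "card (verts G)" arbitrary: G thesis rule: less_induct)
  case less
  note G = less.prems(2,3)
  show ?case
  proof (cases "\<exists>x y. pendant G x y")
    case True
    then obtain x y where p: "pendant G x y" by blast
    let ?G = "delete_vertex G x"
    note pf = pendant_facts[OF G(1) p]
    have "card (verts G) = Suc (card (verts ?G))"
      using pf(2) simple_graphD(1)[OF G(1)] card.remove[of "verts G" x] by simp
    moreover have "{e \<in> edges G. x \<in> e} = {{x, y}}" using pf(4,6) by blast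
    then have "card (edges G) = Suc (card (edges ?G))" using card_edges_delete[OF G(1), of x] by simp
    ultimately have "card (verts ?G) < card (verts G)" "card (verts ?G) \<le> card (edges ?G)"
      using less.prems(4) by simp_all
    from less.hyps[OF this(1) _ simple_delete[OF G(1)] connected_pendant_delete[OF G p] this(2)]
    obtain c where "cyc ?G c" by blast
    then have "cyc G c" by (rule cyc_mono) (auto simp: gle_def)
    then show ?thesis using less.prems(1) by blast
  next
    case False
    obtain r where r: "r \<in> verts G" using G(2) by (auto simp: connected_graph_def)
    have "verts G \<noteq> {x}" for x
    proof
      assume V: "verts G = {x}"
      then have "edges G \<noteq> {}" using less.prems(4) by auto
      then obtain e where e: "e \<in> edges G" by blast
      then have "card e \<le> card {x}" using simple_graphD(2)[OF G(1) e] V by (intro card_mono) auto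
      then show False using simple_graphD(3)[OF G(1) e] by simp
    qed
    then have nb: "\<exists>u. {x, u} \<in> edges G" if "x \<in> verts G" for x
      using connected_graph_crossing[OF G(2) _ _ _ G(1), of "{x}"] that by blast
    from longest_path_end[OF G(1) r] obtain y ys where
      ys: "distinct (y # ys)" "set (y # ys) \<subseteq> verts G" "pedges (y # ys) \<subseteq> edges G"
      "\<And>z. {y, z} \<in> edges G \<Longrightarrow> z \<in> set ys" by metis
    obtain u where "{y, u} \<in> edges G" using nb[of y] ys(2) by auto
    then have "ys \<noteq> []" using ys(4)[of u] by auto
    then obtain w ws where w: "ys = w # ws" by (cases ys) auto
    have yw: "{y, w} \<in> edges G" using ys(3) unfolding w by simp
    obtain e where e: "e \<in> edges G" "y \<in> e" "e \<noteq> {y, w}"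
      using False yw unfolding pendant_def by blast
    obtain z where z: "e = {y, z}" using simple_graph_edge_at[OF G(1) e(1,2)] by metis
    have "z \<in> set ys" using ys(4) e(1) unfolding z by blast
    moreover have "z \<noteq> w" using e(3) unfolding z by blast
    ultimately have "z \<in> set ws" unfolding w by simp
    then obtain p q where pq: "ws = p @ z # q" by (metis split_list)
    let ?c = "y # w # p @ [z]"
    have app: "y # ys = ?c @ q" unfolding w pq by simp
    have "pedges ?c \<subseteq> pedges (y # ys)"
      unfolding app by (cases "q = []") (auto simp: pedges_append[of ?c q] simp del: pedges.simps append_Cons)
    then have "pedges ?c \<subseteq> edges G" using ys(3) by blast
    moreover have "distinct ?c" "set ?c \<subseteq> verts G" using ys(1,2) unfolding app by auto
    moreover have "{hd ?c, last ?c} \<in> edges G" using e(1) unfolding z by simp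
    ultimately have "cyc G ?c" unfolding cyc_def gle_def by simp
    then show ?thesis using less.prems(1) by blast
  qed
qed

lemma card_edges_cycle:
  assumes "distinct c" "length c \<ge> 3"
  shows "card (edges (lollipop c [])) = length c"
  using closing_edge_notin(1)[OF assms] card_pedges[OF assms(1)] assms(2) by simp

text \<open>Suppose the cycle misses a vertex \<open>x\<close>. Then \<open>G - x\<close> is
  connected and contains the cycle, so it has at least as many edges as vertices. This leaves at
  most one edge for \<open>x\<close>, whose neighbour would be a cut vertex.\<close>

lemma unicyclic_no_cut_is_cycle:
  assumes G: "simple_graph G" "connected_graph G" "card (edges G) = card (verts G)"
    and cv: "CV G = {}" and n: "card (verts G) \<ge> 3"
  obtains c where "distinct c" "length c = card (verts G)" "G = lollipop c []"
proof -
  obtain c where c: "cyc G c" using cyc_exists[OF G(1,2)] G(3) by auto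
  note C = cyc_cgs[OF c]
  have cc: "distinct c" "length c \<ge> 3" "set c \<subseteq> verts G" "edges (lollipop c []) \<subseteq> edges G"
    using c by (simp_all add: cyc_def gle_def)
  have "set c = verts G"
  proof (rule ccontr)
    assume "set c \<noteq> verts G"
    then obtain x where x: "x \<in> verts G" "x \<notin> set c" using cc(3) by blast
    have xN: "x \<in> NC G" using cv x by (simp add: NC_def)
    have ne: "verts G \<noteq> {x}" using n by auto
    have K: "simple_graph (delete_vertex G x)" "connected_graph (delete_vertex G x)"
      using delete_in_cgs[OF G(1) xN ne] by (simp_all add: cgs_iff)
    have "lollipop c [] \<in> cgs (delete_vertex G x)" using cgs_delete[OF C] x(2) by simp
    from card_edges_grow[OF K this]
    have "card (verts (delete_vertex G x)) \<le> card (edges (delete_vertex G x))"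
      using card_edges_cycle[OF cc(1,2)] distinct_card[OF cc(1)] by (simp del: lollipop_simps(2))
    moreover have "card (verts G) = Suc (card (verts (delete_vertex G x)))"
      using x(1) simple_graphD(1)[OF G(1)] card.remove[of "verts G" x] by simp
    ultimately have "card {e \<in> edges G. x \<in> e} \<le> 1"
      using card_edges_delete[OF G(1), of x] G(3) by linarith
    then obtain y where "pendant G x y" using small_degree_pendant[OF G(1,2) x(1) ne] by blast
    then show False using pendant_CV[OF G(1) _ n] cv by blast
  qed
  moreover from this have len: "length c = card (verts G)" using distinct_card[OF cc(1)] by simp
  moreover have "edges (lollipop c []) = edges G"
    using card_subset_eq[OF simple_graphD(4)[OF G(1)] cc(4)] card_edges_cycle[OF cc(1,2)] len G(3)
    by simp
  ultimately show thesis using that[OF cc(1) len] by (simp add: prod_eq_iff)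
qed

section \<open>Exact counts for cycles and lollipops\<close>

lemma path_pendant:
  assumes "distinct (x # ys)" "ys \<noteq> []"
  shows "pendant (path_on (x # ys)) x (hd ys)" "delete_vertex (path_on (x # ys)) x = path_on ys"
proof -
  have n: "x \<notin> e" if "e \<in> pedges ys" for e using pedges_subset[OF that] assms(1) by auto
  show "pendant (path_on (x # ys)) x (hd ys)"
    unfolding pendant_def path_on_simps pedges_Cons[OF assms(2)] using n by blast
  have "edges (delete_vertex (path_on (x # ys)) x) = pedges ys"
    unfolding delete_vertex_simps path_on_simps pedges_Cons[OF assms(2)] using n by blast
  then show "delete_vertex (path_on (x # ys)) x = path_on ys"
    using assms(1) by (simp add: prod_eq_iff)
qed

lemma path_prefix:
  assumes "H \<in> cgs (path_on xs)" "distinct xs" "xs \<noteq> []" "hd xs \<in> verts H"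
  shows "\<exists>l\<in>{1..length xs}. H = path_on (take l xs)"
  using assms
proof (induction xs arbitrary: H)
  case (Cons x ys)
  have H: "H \<in> rooted (path_on (x # ys)) x" using Cons.prems by (simp add: rooted_def)
  show ?case
  proof (cases "ys = []")
    case True
    then have "H = path_on (take 1 (x # ys))" using Cons.prems
      by (auto simp: cgs_iff gle_def prod_eq_iff)
    then show ?thesis by force
  next
    case False
    note P = path_pendant[OF Cons.prems(2) False]
    have s: "simple_graph (path_on (x # ys))" by (rule simple_path_on[OF Cons.prems(2)])
    have "H \<in> insert ({x}, {}) ((\<lambda>H. add_edge H (hd ys) x) ` rooted (path_on ys) (hd ys))"
      using H rooted_pendant_eq(1)[OF s P(1)] unfolding P(2) by simp
    then consider "H = ({x}, {})"
      | K where "K \<in> rooted (path_on ys) (hd ys)" "H = add_edge K (hd ys) x" by blast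
    then show ?thesis
    proof cases
      case 1
      then have "H = path_on (take 1 (x # ys))" by (simp add: path_on_def)
      then show ?thesis by force
    next
      case 2
      have "distinct ys" using Cons.prems(2) by simp
      then obtain l where l: "l \<in> {1..length ys}" "K = path_on (take l ys)"
        using Cons.IH[of K] 2(1) False by (auto simp: rooted_def)
      have ne: "take l ys \<noteq> []" "hd (take l ys) = hd ys" using l(1) False by auto
      have "hd ys \<in> set (take l ys)" using hd_in_set[OF ne(1)] ne(2) by simp
      then have "H = path_on (take (Suc l) (x # ys))"
        unfolding 2(2) l(2) using ne pedges_Cons[OF ne(1), of x]
        by (simp add: add_edge_def path_on_def insert_absorb insert_commute)
      then show ?thesis using l(1) by force
    qed
  qed
qed simp

text \<open>A proper connected subgraph of a cycle misses some edge. The rotation puts such an edge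
  at the seam with the front of the list in \<open>H\<close>, so that \<open>path_prefix\<close>
  applies to \<open>H\<close>.\<close>

lemma cycle_subgraph_rotation:
  assumes c: "distinct c" "length c \<ge> 3" and H: "H \<in> cgs (lollipop c [])" "H \<noteq> lollipop c []"
  obtains s where "hd (rotate s c) \<in> verts H"
    "{hd (rotate s c), last (rotate s c)} \<notin> edges H"
proof (cases "set c \<subseteq> verts H")
  case True
  have HG: "verts H \<subseteq> set c" "edges H \<subseteq> edges (lollipop c [])"
    using H(1) by (simp_all add: cgs_iff gle_def)
  then have "verts H = set c" using True by blast
  then have "edges H \<noteq> edges (lollipop c [])" using H(2) by (auto simp: prod_eq_iff)
  then obtain e where e: "e \<in> edges (lollipop c [])" "e \<notin> edges H" using HG(2) by blast
  show thesis
  proof (cases "e = {hd c, last c}")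
    case t: True
    have "hd c \<in> verts H" using closing_edge_notin(3)[OF c] True by blast
    then show thesis using that[of 0] e(2) t by simp
  next
    case False
    then have "e \<in> pedges c" using e(1) by simp
    then obtain p q where pq: "c = p @ q" "p \<noteq> []" "q \<noteq> []" "e = {last p, hd q}" by (rule pedges_split)
    have r: "rotate (length p) c = q @ p" unfolding pq(1) by (rule rotate_swap)
    have "hd q \<in> verts H" using pq(1,3) True by auto
    moreover have "{hd (q @ p), last (q @ p)} = e" using pq(2-4) by (simp add: insert_commute)
    ultimately show thesis using that[of "length p"] e(2) pq(3) unfolding r by simp
  qed
next
  case False
  then obtain a where a: "a \<in> set c" "a \<notin> verts H" by blast
  then obtain u v where c': "c = u @ a # v" by (metis split_list)
  have Hp: "simple_graph H" "connected_graph H" "verts H \<subseteq> set c"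
    using H(1) by (simp_all add: cgs_iff gle_def)
  obtain b where "b \<in> verts H" using Hp(2) by (auto simp: connected_graph_def)
  then have "\<exists>b\<in>set (v @ u). b \<in> verts H" using Hp(3) a(2) unfolding c' by auto
  \<comment> \<open>From the vertex \<open>a\<close> outside \<open>H\<close> go along the cycle to
    the first vertex \<open>b\<close> of \<open>H\<close>; the edge entering \<open>b\<close> is
    missing.\<close>
  then obtain y b z where yz: "v @ u = y @ b # z" "b \<in> verts H" "\<forall>w\<in>set y. w \<notin> verts H"
    using split_list_first_prop[of "v @ u" "\<lambda>b. b \<in> verts H"] by blast
  have "rotate (length u) c = (a # y) @ (b # z)" unfolding c' rotate_swap using yz(1) by simp
  then have "rotate (length (a # y)) (rotate (length u) c) = b # z @ a # y"
    using rotate_swap[of "a # y" "b # z"] by simp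
  then have r: "rotate (length (a # y) + length u) c = b # z @ a # y" by (simp only: rotate_rotate)
  have "last (a # y) \<notin> verts H" using yz(3) a(2) by (cases "y = []") auto
  then have "{b, last (a # y)} \<notin> edges H" using simple_graph_edgeD(3)[OF Hp(1)] by blast
  then show thesis using that[of "length (a # y) + length u"] yz(2) unfolding r by simp
qed

text \<open>A proper connected subgraph is a segment, given by its starting point and its number of
  vertices; the whole cycle is the one left over.\<close>

lemma card_cgs_cycle_le:
  assumes c: "distinct c" "length c \<ge> 3"
  shows "card (cgs (lollipop c [])) \<le> length c * length c + 1"
proof -
  let ?f = "\<lambda>(s, l). path_on (take l (rotate s c))"
  let ?I = "{..<length c} \<times> {1..length c}"
  have "cgs (lollipop c []) \<subseteq> insert (lollipop c []) (?f ` ?I)"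
  proof
    fix H assume H: "H \<in> cgs (lollipop c [])"
    show "H \<in> insert (lollipop c []) (?f ` ?I)"
    proof (cases "H = lollipop c []")
      case False
      obtain s where s: "hd (rotate s c) \<in> verts H"
        "{hd (rotate s c), last (rotate s c)} \<notin> edges H"
        using cycle_subgraph_rotation[OF c H False] by blast
      define t where "t = s mod length c"
      have "0 < length c" using c(2) by linarith
      then have t: "rotate s c = rotate t c" "t < length c" unfolding t_def
        using rotate_conv_mod[of s c] by simp_all
      define d where "d = rotate t c"
      have d: "distinct d" "length d = length c" "d \<noteq> []" using c unfolding d_def by auto
      have "H \<in> cgs (lollipop d [])" using H lollipop_rotate[of t c] unfolding d_def by simp
      then have "H \<in> cgs (path_on d)" using s(2) unfolding t(1) d_def[symmetric]
        by (auto simp: cgs_iff gle_def)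
      from path_prefix[OF this d(1,3)] s(1)
      obtain l where "l \<in> {1..length d}" "H = path_on (take l d)"
        unfolding t(1) d_def[symmetric] by blast
      then have "H = ?f (t, l)" "(t, l) \<in> ?I" using t(2) d(2) unfolding d_def by simp_all
      then show ?thesis by blast
    qed simp
  qed
  then have "card (cgs (lollipop c [])) \<le> card (insert (lollipop c []) (?f ` ?I))"
    by (rule card_mono[rotated]) simp
  also have "\<dots> \<le> Suc (card (?f ` ?I))" by (rule card_insert_le_m1) simp_all
  also have "card (?f ` ?I) \<le> card ?I" by (rule card_image_le) simp
  finally show ?thesis by (simp add: card_cartesian_product)
qed

text \<open>The lower bounds for the subgraphs through \<open>y\<close> and for those avoiding
  \<open>y\<close> add up to the upper bound \<open>g * g + 1\<close>, so all of them are
  equalities.\<close>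

lemma cycle_counts:
  assumes c: "distinct c" "length c = g" "g \<ge> 3" and y: "y \<in> set c"
  shows "2 * card (rooted (lollipop c []) y) = g * (g + 1) + 2"
    "2 * card (cgs (lollipop c [])) = g * (g - 1) + (g * (g + 1) + 2)"
proof -
  let ?C = "lollipop c []"
  have c3: "length c \<ge> 3" using c by simp
  have s: "simple_graph ?C" "connected_graph ?C"
    using simple_lollipop[of c "[]"] connected_lollipop[of c "[]"] c y by (cases "c = []"; simp)+
  have V: "card (verts ?C) = g" using distinct_card[OF c(1)] c(2) by simp
  have N: "NC ?C = set c" "CV ?C = {}" using NC_cycle[OF c(1) c3] CV_subset[of ?C]
    by (auto simp: NC_def)
  have E: "card (edges ?C) = g" using card_edges_cycle[OF c(1) c3] c(2) by simp
  have m: "g - 1 = card (NC ?C - {y})" "0 = card (CV ?C - {y})"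
    using N y V by simp_all
  have "card (verts ?C) \<le> card (edges ?C)" "y \<in> verts ?C" using V E y by simp_all
  from rooted_lower_bound_cyclic[OF s this m]
  have lo: "g * (g + 1) + 2 \<le> 2 * card (rooted ?C y)" using c(3) by simp
  have yN: "y \<in> NC ?C" using N y by simp
  have ne: "verts ?C \<noteq> {y}"
  proof
    assume "verts ?C = {y}"
    then show False using V c(3) by simp
  qed
  have K: "simple_graph (delete_vertex ?C y)" "connected_graph (delete_vertex ?C y)"
    using delete_in_cgs[OF s(1) yN ne] by (simp_all add: cgs_iff)
  have "card (verts (delete_vertex ?C y)) = g - 1" using V y by simp
  then have lo2: "g * (g - 1) \<le> 2 * card (cgs (delete_vertex ?C y))"
    using card_cgs_ge[OF K] c(3) by (simp add: mult.commute)
  have up: "card (cgs ?C) \<le> g * g + 1" using card_cgs_cycle_le[OF c(1) c3] c(2) by simp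
  have gg: "g * (g - 1) + (g * (g + 1) + 2) = 2 * (g * g + 1)"
    using c(3) by (cases g) (auto simp: algebra_simps)
  note sp = card_cgs_split[OF s(1), of y]
  have squeeze: "2 * r = a" "2 * t = b + a"
    if "a \<le> 2 * r" "b \<le> 2 * d" "t \<le> N" "b + a = 2 * N" "t = d + r" for a b d r t N :: nat
    using that by linarith+
  show "2 * card (rooted ?C y) = g * (g + 1) + 2" by (rule squeeze(1)[OF lo lo2 up gg sp])
  show "2 * card (cgs ?C) = g * (g - 1) + (g * (g + 1) + 2)" by (rule squeeze(2)[OF lo lo2 up gg sp])
qed

text \<open>Twice the number of connected subgraphs of \<open>L\<^bsub>g+k,g\<^esub>\<close>; bounds are doubled throughout to
  avoid division.\<close>

definition L2 :: "nat \<Rightarrow> nat \<Rightarrow> nat" where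
  "L2 g k = g * (g - 1) + k * (k + 1) + (k + 1) * (g * (g + 1) + 2)"

lemma lollipop_pendant:
  assumes "distinct (c @ p @ [x])" "length c \<ge> 3"
  shows "pendant (lollipop c (p @ [x])) x (last (c @ p))"
    "delete_vertex (lollipop c (p @ [x])) x = lollipop c p"
proof -
  have ne: "c @ p \<noteq> []" using assms by auto
  have dc: "distinct c" using assms by simp
  have E: "pedges (c @ p @ [x]) = insert {last (c @ p), x} (pedges (c @ p))"
    using pedges_append[OF ne, of "[x]"] by simp
  have n: "x \<notin> e" if "e \<in> pedges (c @ p)" for e using pedges_subset[OF that] assms(1) by auto
  have n2: "x \<notin> {hd c, last c}"
    using closing_edge_notin(3,4)[OF dc assms(2)] assms(1) by auto
  show "pendant (lollipop c (p @ [x])) x (last (c @ p))"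
    unfolding pendant_def lollipop_simps append_assoc E using n n2 by blast
  have "edges (delete_vertex (lollipop c (p @ [x])) x) = edges (lollipop c p)"
    unfolding delete_vertex_simps lollipop_simps append_assoc E using n n2 by blast
  moreover have "verts (delete_vertex (lollipop c (p @ [x])) x) = verts (lollipop c p)"
    using assms(1) by auto
  ultimately show "delete_vertex (lollipop c (p @ [x])) x = lollipop c p" by (simp add: prod_eq_iff)
qed

text \<open>Lengthening the tail by \<open>x\<close> adds \<open>x\<close> alone and one subgraph
  for each subgraph through the previous end; hence the count at the end is carried along. The three
  summands of \<open>L2\<close> belong to the cycle without its attachment vertex, the tail without
  it, and the subgraphs through it.\<close>

lemma lollipop_counts:
  assumes "distinct (c @ p)" "length c = g" "g \<ge> 3"
  shows "2 * card (rooted (lollipop c p) (last (c @ p))) = g * (g + 1) + 2 + 2 * length p \<and>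
    2 * card (cgs (lollipop c p)) = L2 g (length p)"
  using assms(1)
proof (induction p rule: rev_induct)
  case Nil
  have "c \<noteq> []" using assms by auto
  then show ?case using cycle_counts[of c g "last c"] assms Nil by (simp add: L2_def)
next
  case (snoc x p)
  have c3: "length c \<ge> 3" using assms by simp
  have s: "simple_graph (lollipop c (p @ [x]))" by (rule simple_lollipop[OF snoc.prems c3])
  have d: "distinct (c @ p)" using snoc.prems by simp
  note P = lollipop_pendant[OF snoc.prems c3]
  note r = card_rooted_pendant(1)[OF s P(1), unfolded P(2)]
  note f = card_cgs_split[OF s, of x, unfolded P(2)]
  have l: "last (c @ p @ [x]) = x" by simp
  show ?case unfolding l using f r snoc.IH[OF d] by (simp add: L2_def algebra_simps)
qed

section \<open>Numerical estimates and splits of a connected graph\<close>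

text \<open>\<open>Z\<close> is a product of two doubled counts, hence the factor 4. A quarter of
  \<open>20 Q + 8 s + 14 t\<close>, with \<open>14 t / 4\<close> weakened to \<open>3 t\<close>,
  remains as slack; for nonnegative values it vanishes only at \<open>Q = s = t = 0\<close>, which
  yields the equality case.\<close>

lemma quarter_bound:
  fixes Z K R f Q s t :: int
  assumes "Z \<le> 4 * f" "Z = 4 * (K - 2) + R" "20 * Q + 8 * s + 14 * t \<le> R" "0 \<le> t"
  shows "K - 2 + (5 * Q + 2 * s + 3 * t) \<le> f"
  using assms by simp

text \<open>Substituting \<open>a = u + 2\<close>, \<open>b = t + 1\<close>, \<open>m = k + s\<close> and eliminating \<open>p\<close> only where this is needed
  turns the difference of the two sides into a polynomial with nonnegative coefficients.\<close>

lemma product_bound_pendant: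
  fixes a b p q k m fA fB :: nat
  assumes "a \<ge> 2" "b \<ge> 1" "k = 1 + p + q" "m = a + b" "k \<le> m"
    and fA: "(a + 1) * (a + 2) + 2 + 2 * p \<le> 2 * fA"
    and fB: "(b + 1) * b + 2 + 2 * q \<le> 2 * fB"
  shows "(k + 2) * (m + 1) \<le> fA * fB + 2"
    "(k + 2) * (m + 1) = fA * fB + 2 \<Longrightarrow> b = 1 \<and> q = 0 \<and> m = k"
proof -
  define u t s P where "u = int a - 2" and "t = int b - 1" and "s = int m - int k" and "P = int p"
  define Q where "Q = int q"
  have nn: "0 \<le> u" "0 \<le> t" "0 \<le> s" "0 \<le> P" "0 \<le> Q"
    using assms(1,2,5) by (auto simp: u_def t_def s_def P_def Q_def)
  have Pe: "P = u + t + 2 - Q - s" and ab: "int a = u + 2" "int b = t + 1"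
    "int k = 1 + P + Q" "int m = u + t + 3"
    using assms(3,4) by (auto simp: u_def t_def s_def P_def Q_def)
  let ?X = "(u + 3) * (u + 4) + 2 + 2 * P" and ?Y = "(t + 2) * (t + 1) + 2 + 2 * Q"
  let ?R = "4 * Q * P + (2 * t * t + 6 * t) * P + 4 * t * s + 14 * Q * u + 2 * Q * u * u
    + 4 * s * u + 10 * t * t + 7 * t * t * u + t * t * u * u + 13 * t * u + 3 * t * u * u
    + 20 * Q + 8 * s + 14 * t"
  have id: "?X * ?Y = 4 * ((P + Q + 3) * (u + t + 4) - 2) + ?R"
    unfolding Pe by (simp add: algebra_simps)
  have R: "20 * Q + 8 * s + 14 * t \<le> ?R" using nn by simp
  have "int ((a + 1) * (a + 2) + 2 + 2 * p) \<le> int (2 * fA)" using fA by (simp only: zle_int)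
  then have X: "?X \<le> 2 * int fA" unfolding P_def u_def by (simp add: algebra_simps)
  have "int ((b + 1) * b + 2 + 2 * q) \<le> int (2 * fB)" using fB by (simp only: zle_int)
  then have Y: "?Y \<le> 2 * int fB" unfolding Q_def t_def by (simp add: algebra_simps)
  have "?X * ?Y \<le> (2 * int fA) * (2 * int fB)"
    by (rule mult_mono[OF X Y]) (use nn in simp_all)
  then have main: "(P + Q + 3) * (u + t + 4) - 2 + (5 * Q + 2 * s + 3 * t) \<le> int fA * int fB"
  proof -
    from quarter_bound[OF _ id R nn(2)] show ?thesis using \<open>?X * ?Y \<le> (2 * int fA) * (2 * int fB)\<close> by simp
  qed
  have km: "int ((k + 2) * (m + 1)) = (P + Q + 3) * (u + t + 4)"
    using ab(3,4) by (simp add: algebra_simps)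
  have le: "int ((k + 2) * (m + 1)) + (5 * Q + 2 * s + 3 * t) \<le> int (fA * fB + 2)"
    using main km by simp
  then have "int ((k + 2) * (m + 1)) \<le> int (fA * fB + 2)" using nn by linarith
  then show "(k + 2) * (m + 1) \<le> fA * fB + 2" by (simp only: zle_int)
  assume "(k + 2) * (m + 1) = fA * fB + 2"
  then have "5 * Q + 2 * s + 3 * t \<le> 0" using le by simp
  then have "Q = 0" "s = 0" "t = 0" using nn by linarith+
  then show "b = 1 \<and> q = 0 \<and> m = k" unfolding Q_def s_def t_def by simp
qed

text \<open>The inequality of \<open>product_bound_cyclic\<close> after substituting
  \<open>p + q = w + 2\<close>, \<open>k = w + 3\<close>, \<open>a = w + 2 + x\<close> and
  \<open>b = w + 2 + y\<close>: the difference has nonnegative coefficients and constant term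
  28.\<close>

lemma cyclic_poly:
  fixes w x y :: int
  shows "((w + x + 3) * (w + x + 4) + 2) * ((w + y + 3) * (w + y + 4) + 2)
      + 2 * (w + 2) * ((w + 3) * (w + 4) + 2)
    = 2 * ((2 * w + x + y + 4) * (2 * w + x + y + 3) + (w + 3) * (w + 4)
        + (w + 4) * ((2 * w + x + y + 4) * (2 * w + x + y + 5) + 2))
      + (28 + (22*w + 17*w*w + 8*w*w*w + w*w*w*w + 2*w*w*w*x + 2*w*w*w*y + 13*w*w*x + w*w*x*x
        + 4*w*w*x*y + 13*w*w*y + w*w*y*y + 19*w*x + 5*w*x*x + 2*w*x*x*y + 24*w*x*y + 2*w*x*y*y
        + 19*w*y + 5*w*y*y + 12*x + 4*x*x + 7*x*x*y + x*x*y*y + 29*x*y + 7*x*y*y + 12*y + 4*y*y))"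
  by algebra

lemma cyclic_poly_less:
  fixes w x y :: nat
  shows "2 * ((2 * w + x + y + 4) * (2 * w + x + y + 3) + (w + 3) * (w + 4)
        + (w + 4) * ((2 * w + x + y + 4) * (2 * w + x + y + 5) + 2))
    < ((w + x + 3) * (w + x + 4) + 2) * ((w + y + 3) * (w + y + 4) + 2)
      + 2 * (w + 2) * ((w + 3) * (w + 4) + 2)"
proof -
  have less: "l < r" if "r = l + (28 + c)" "0 \<le> c" for l r c :: int using that by simp
  show ?thesis
    unfolding of_nat_less_iff[where 'a = int, symmetric] of_nat_add of_nat_mult of_nat_numeral
    by (rule less[OF cyclic_poly]) simp
qed

text \<open>The hypotheses bound \<open>a\<close> and \<open>b\<close> below by \<open>d\<close>,
  the larger of 2 and \<open>k - 1 = p + q\<close>. So \<open>A\<close> and \<open>B\<close> are at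
  least the value \<open>M\<close> at \<open>d\<close>, and \<open>p * B + q * A\<close> may be
  replaced by \<open>(p + q) * M\<close>; then \<open>p\<close> and \<open>q\<close> enter only
  through their sum.\<close>

lemma product_bound_cyclic:
  fixes a b p q k fA fB :: nat
  assumes a: "a \<ge> 2" "a + 1 \<ge> k" and b: "b \<ge> 2" "b + 1 \<ge> k" and k: "k = 1 + p + q"
    and fA: "(a + 1) * (a + 2) + 2 + 2 * p \<le> 2 * fA"
    and fB: "(b + 1) * (b + 2) + 2 + 2 * q \<le> 2 * fB"
  shows "L2 (a + b) k < 2 * (fA * fB)"
proof -
  define A B where "A = (a + 1) * (a + 2) + 2" and "B = (b + 1) * (b + 2) + 2"
  have AB: "(A + 2 * p) * (B + 2 * q) \<le> (2 * fA) * (2 * fB)"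
    using mult_le_mono[OF fA fB] by (simp add: A_def B_def)
  have main: "2 * L2 (a + b) k < A * B + 2 * (p + q) * M"
    if M: "M = (d + 1) * (d + 2) + 2" and d: "d = max 2 (p + q)" for M d
  proof -
    have "d \<le> a" "d \<le> b" using a b k d by auto
    then obtain x y where xy: "a = d + x" "b = d + y" by (metis le_Suc_ex)
    consider "p + q = 0" | "p + q = 1" | w where "p + q = w + 2"
      using le_Suc_ex[of 2 "p + q"] by fastforce
    then show ?thesis
    proof cases
      case 1
      then have "d = 2" "k = 1" using d k by simp_all
      then show ?thesis unfolding A_def B_def M xy L2_def using 1 by (simp add: algebra_simps)
    next
      case 2
      then have "d = 2" "k = 2" using d k by simp_all
      then show ?thesis unfolding A_def B_def M xy L2_def using 2 by (simp add: algebra_simps)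
    next
      case 3
      then have dk: "d = w + 2" "k = w + 3" using d k by simp_all
      have e: "a + 1 = w + x + 3" "a + 2 = w + x + 4" "b + 1 = w + y + 3" "b + 2 = w + y + 4"
        "d + 1 = w + 3" "d + 2 = w + 4" "k + 1 = w + 4" "a + b = 2 * w + x + y + 4"
        "2 * w + x + y + 4 + 1 = 2 * w + x + y + 5" "2 * w + x + y + 4 - 1 = 2 * w + x + y + 3"
        unfolding xy dk by simp_all
      show ?thesis using cyclic_poly_less[of w x y]
        unfolding A_def B_def M L2_def e(7) unfolding e dk(2) 3 .
    qed
  qed
  define d where "d = max 2 (p + q)"
  define M where "M = (d + 1) * (d + 2) + 2"
  have "d \<le> a" "d \<le> b" using a b k d_def by auto
  moreover have "(d + 1) * (d + 2) + 2 \<le> (z + 1) * (z + 2) + 2" if "d \<le> z" for z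
    by (intro add_le_mono mult_le_mono order_refl that)
  ultimately have MA: "M \<le> A" "M \<le> B" unfolding M_def A_def B_def by blast+
  then have pq: "p * M \<le> p * B" "q * M \<le> q * A" by (simp_all only: mult_le_mono2)
  have add: "c + (2 * x + 2 * y) \<le> c + (2 * x' + 2 * y') + z"
    if "x \<le> x'" "y \<le> y'" for c x y x' y' z :: nat using that by simp
  have "A * B + 2 * (p + q) * M = A * B + (2 * (p * M) + 2 * (q * M))"
    by (simp add: algebra_simps)
  also have "\<dots> \<le> A * B + (2 * (p * B) + 2 * (q * A)) + 4 * (p * q)" by (rule add[OF pq])
  also have "\<dots> = (A + 2 * p) * (B + 2 * q)" by (simp add: algebra_simps)
  finally have "A * B + 2 * (p + q) * M \<le> (A + 2 * p) * (B + 2 * q)" .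
  then have "2 * L2 (a + b) k < (2 * fA) * (2 * fB)" using main[OF M_def d_def] AB by linarith
  then show ?thesis by simp
qed

text \<open>By convexity the most balanced split is the worst, and 7 = 3 + 4 gives 7 + 15 =
  22.\<close>

lemma sum_powers_ge:
  assumes "a + b = l" "l \<ge> (7 :: nat)"
  shows "22 \<le> (2 ^ a - 1) + (2 ^ b - (1 :: nat))"
proof -
  have big: "31 \<le> 2 ^ n - (1 :: nat)" if "5 \<le> n" for n
  proof -
    have "(2 :: nat) ^ 5 \<le> 2 ^ n" using that by (rule power_increasing) simp
    then show ?thesis by simp
  qed
  consider "5 \<le> a" | "5 \<le> b" | "a = 3" "b = 4" | "a = 4" "b = 3" | "a = 4" "b = 4"
    using assms by linarith
  then show ?thesis by cases (use big[of a] big[of b] in simp_all)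
qed

text \<open>\<open>L2 l k\<close> is at most cubic in \<open>l\<close> since \<open>k <= l\<close>,
  and \<open>2 ^ l\<close> alone beats it from 10 on, where \<open>l ^ 3 <= 2 ^ l\<close> begins to
  hold for good. For \<open>l = 7\<close> and \<open>l = 8\<close> the term with 44, twice the 22
  earned by each split, is indispensable when \<open>k\<close> is close to \<open>l\<close>.\<close>

lemma tree_arith:
  fixes l k :: nat
  assumes "l \<ge> 7" "1 \<le> k" "k \<le> l"
  shows "L2 l k < 2 * l + k * (k + 1) + 2 * (2 ^ l - 1) + 44 * (k - 1)"
proof -
  have cube: "n * n * n \<le> 2 ^ n" if "n \<ge> 10" for n :: nat
    using that
  proof (induction n rule: nat_induct_at_least)
    case (Suc n)
    obtain m where m: "n = m + 10" using Suc.hyps by (metis add.commute le_Suc_ex)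
    have "Suc n * Suc n * Suc n \<le> 2 * (n * n * n)" unfolding m by (simp add: algebra_simps)
    then show ?case using Suc.IH by simp
  qed simp
  obtain j where j: "k = j + 1" using assms(2) by (metis add.commute le_Suc_ex)
  consider "l = 7" | "l = 8" | "l = 9" | "l \<ge> 10" using assms by linarith
  then show ?thesis
  proof cases
    case 4
    then obtain m where m: "l = m + 10" by (metis add.commute le_Suc_ex)
    have "(k + 1) * (l * (l + 1) + 2) \<le> (l + 1) * (l * (l + 1) + 2)"
      using assms(3) by (intro mult_le_mono1) simp
    moreover have "l * (l - 1) + (l + 1) * (l * (l + 1) + 2) + 2 < 2 * l + 2 * (l * l * l)"
      unfolding m by (simp add: algebra_simps)
    moreover have "2 * (l * l * l) \<le> 2 * 2 ^ l" using cube[OF 4] by simp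
    ultimately have "l * (l - 1) + (k + 1) * (l * (l + 1) + 2) + 2 < 2 * l + 2 * 2 ^ l"
      by linarith
    then have "l * (l - 1) + (k + 1) * (l * (l + 1) + 2) < 2 * l + 2 * (2 ^ l - 1)"
      by (simp add: diff_mult_distrib2)
    then show ?thesis unfolding L2_def by linarith
  qed (use assms(3) j in \<open>simp_all add: L2_def algebra_simps\<close>)
qed

section \<open>Splits of a connected graph into two connected parts\<close>

lemma connected_insert_induced:
  assumes "connected_graph (induced G S)" "z \<in> S" "{x, z} \<in> edges G"
  shows "connected_graph (induced G (insert x S))"
  by (rule connected_mono_edges[OF connected_add_edge[of "induced G S" z x]])
    (use assms in \<open>auto simp: insert_commute\<close>)

text \<open>The edges of a spanning tree rooted at \<open>r\<close> would give such splits, each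
  edge cutting off the part \<open>D\<close> without the root. They are obtained directly: peel off
  a non-cut vertex \<open>x\<close> other than \<open>r\<close>, let \<open>x\<close> join the part
  of a neighbour \<open>z\<close> in every split of the rest, and add the split with
  \<open>D = {x}\<close>.\<close>

lemma connected_splits:
  assumes "simple_graph J" "connected_graph J" "r \<in> verts J"
  shows "\<exists>\<D>. finite \<D> \<and> Suc (card \<D>) = card (verts J) \<and>
    (\<forall>D\<in>\<D>. D \<subseteq> verts J \<and> D \<noteq> {} \<and> r \<notin> D \<and>
      connected_graph (induced J D) \<and> connected_graph (induced J (verts J - D)))"
  using assms
proof (induction "card (verts J)" arbitrary: J rule: less_induct)
  case less
  note J = less.prems
  have fin: "finite (verts J)" by (rule simple_graphD[OF J(1)])
  show ?case
  proof (cases "card (verts J) \<ge> 2")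
    case False
    have "card (verts J) \<noteq> 0" using J(3) fin by auto
    then have "Suc (card {}) = card (verts J)" using False by simp
    then show ?thesis by (intro exI[of _ "{}"]) simp
  next
    case True
    have "\<not> NC J \<subseteq> {r}"
      using card_NC_ge_2[OF J(1,2) True] card_mono[of "{r}" "NC J"] by fastforce
    then obtain x where x: "x \<in> NC J" "x \<noteq> r" by blast
    have xV: "x \<in> verts J" using x by (simp add: NC_iff)
    have ne: "verts J \<noteq> {x}" using J(3) x(2) by (metis singletonD)
    let ?J = "delete_vertex J x"
    have J': "simple_graph ?J" "connected_graph ?J"
      using delete_in_cgs[OF J(1) x(1) ne] by (simp_all add: cgs_iff)
    have r': "r \<in> verts ?J" using J(3) x(2) by simp
    have c: "card (verts J) = Suc (card (verts ?J))" using xV fin card.remove[of "verts J" x] by simp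
    then have "card (verts ?J) < card (verts J)" by simp
    from less.hyps[OF this J' r'] obtain \<D> where D: "finite \<D>" "Suc (card \<D>) = card (verts ?J)"
      "\<And>D. D \<in> \<D> \<Longrightarrow> D \<subseteq> verts ?J" "\<And>D. D \<in> \<D> \<Longrightarrow> D \<noteq> {}" "\<And>D. D \<in> \<D> \<Longrightarrow> r \<notin> D"
      "\<And>D. D \<in> \<D> \<Longrightarrow> connected_graph (induced ?J D)"
      "\<And>D. D \<in> \<D> \<Longrightarrow> connected_graph (induced ?J (verts ?J - D))" by blast
    have ind: "induced ?J S = induced J S" if "x \<notin> S" for S
      using that by (auto simp: induced_def)
    obtain u z where uz: "u \<in> {x}" "z \<in> verts J - {x}" "{u, z} \<in> edges J"
      using connected_graph_crossing[OF J(2) _ _ _ J(1), of "{x}"] xV ne by blast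
    then have z: "{x, z} \<in> edges J" "z \<in> verts ?J" by auto
    define ext where "ext D = (if z \<in> D then insert x D else D)" for D
    have xD: "x \<notin> D" if "D \<in> \<D>" for D using D(3)[OF that] by auto
    have extD: "ext D - {x} = D" if "D \<in> \<D>" for D using xD[OF that] by (auto simp: ext_def)
    have inj: "inj_on ext \<D>" using extD by (metis inj_onI)
    have new: "{x} \<notin> ext ` \<D>"
    proof
      assume "{x} \<in> ext ` \<D>"
      then obtain D' where "D' \<in> \<D>" "{x} = ext D'" by blast
      then show False using extD[of D'] D(4)[of D'] by auto
    qed
    have ok: "D \<subseteq> verts J \<and> D \<noteq> {} \<and> r \<notin> D \<and>
      connected_graph (induced J D) \<and> connected_graph (induced J (verts J - D))"
      if "D \<in> insert {x} (ext ` \<D>)" for D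
    proof -
      note Dm = that
      show ?thesis
      proof (cases "D = {x}")
      case True
      have "connected_graph (induced J {x})"
        by (rule connected_graphI[of x]) auto
      moreover have "connected_graph (induced J (verts J - {x}))"
        using J'(2) delete_eq_induced[OF J(1)] by simp
      ultimately show ?thesis using True xV x(2) by simp
    next
      case False
      then obtain D' where D': "D' \<in> \<D>" "D = ext D'" using Dm by blast
      note x' = xD[OF D'(1)]
      have c1: "connected_graph (induced J D')" using D(6)[OF D'(1)] ind[OF x'] by simp
      have c2: "connected_graph (induced J (verts ?J - D'))"
        using D(7)[OF D'(1)] ind[of "verts ?J - D'"] by simp
      have sub: "D \<subseteq> verts J" "D \<noteq> {}" "r \<notin> D"
        using D(3,4,5)[OF D'(1)] xV x(2) unfolding D'(2) ext_def by auto
      show ?thesis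
      proof (cases "z \<in> D'")
        case True
        have "connected_graph (induced J (insert x D'))"
          by (rule connected_insert_induced[OF c1 True z(1)])
        moreover have "D = insert x D'" using True by (simp add: D'(2) ext_def)
        moreover have "verts J - D = verts ?J - D'" using calculation(2) by auto
        ultimately show ?thesis using sub c2 by simp
      next
        case False
        have "z \<in> verts ?J - D'" using z(2) False by blast
        from connected_insert_induced[OF c2 this z(1)]
        have "connected_graph (induced J (insert x (verts ?J - D')))" .
        moreover have DD: "D = D'" using False by (simp add: D'(2) ext_def)
        moreover have "verts J - D = insert x (verts ?J - D')" using DD x' xV by auto
        ultimately show ?thesis using sub c1 by simp
      qed
    qed
    qed
    have "card (insert {x} (ext ` \<D>)) = Suc (card \<D>)"
      using new D(1) card_image[OF inj] by simp
    then show ?thesis using ok D(1,2) c by (intro exI[of _ "insert {x} (ext ` \<D>)"]) simp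
  qed
qed

section \<open>Trees\<close>

lemma pendant_leaf_attach:
  assumes G: "simple_graph G" and H: "H \<in> cgs G" and L: "finite L"
    "\<And>x. x \<in> L \<Longrightarrow> {h x, x} \<in> edges G \<and> h x \<in> verts H"
  shows "(verts H \<union> L, edges H \<union> (\<lambda>x. {h x, x}) ` L) \<in> cgs G"
  using L
proof (induction L rule: finite_induct)
  case empty
  then show ?case using H by simp
next
  case (insert x L)
  let ?K = "(verts H \<union> L, edges H \<union> (\<lambda>x. {h x, x}) ` L)"
  have K: "?K \<in> cgs G" using insert by blast
  have x: "{h x, x} \<in> edges G" "h x \<in> verts H" using insert.prems by auto
  have xV: "h x \<noteq> x" "h x \<in> verts G" "x \<in> verts G"
    using simple_graph_edgeD[OF G x(1)] by auto
  have Kp: "simple_graph ?K" "connected_graph ?K" "gle ?K G" using K by (simp_all add: cgs_iff)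
  have "h x \<in> verts ?K" using x(2) by simp
  note c = simple_add_edge[OF Kp(1) xV(1)] connected_add_edge[OF Kp(2) this, of x]
  have "gle (add_edge ?K (h x) x) G" using Kp(3) x xV by (simp add: gle_def)
  then have "add_edge ?K (h x) x \<in> cgs G" using c by (simp add: cgs_iff)
  moreover have "add_edge ?K (h x) x =
      (verts H \<union> insert x L, edges H \<union> (\<lambda>x. {h x, x}) ` insert x L)"
    using x(2) by (auto simp: add_edge_def)
  ultimately show ?case by simp
qed

text \<open>The cut vertices induce a connected graph \<open>J\<close>. A connected subgraph of \<open>J\<close> with \<open>w\<close> leaves next to it
  extends in \<open>2\<^sup>w\<close> ways. Besides \<open>J\<close> itself, the two parts of the \<open>k - 1\<close> splits of \<open>J\<close> carry the weight,
  since \<open>w + w' = l\<close> for the parts of a split.\<close>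

lemma pendant_tree_bound:
  fixes G :: "'a ugraph"
  assumes G: "simple_graph G" "connected_graph G" "card (verts G) \<ge> 3"
    and pend: "\<And>x. x \<in> NC G \<Longrightarrow> \<exists>y. pendant G x y"
    and lk: "l = card (NC G)" "k = card (CV G)" and l: "l \<ge> 7"
  shows "2 * l + k * (k + 1) + 2 * (2 ^ l - 1) + 44 * (k - 1) \<le> 2 * card (cgs G)"
proof -
  obtain h where h: "\<And>x. x \<in> NC G \<Longrightarrow> pendant G x (h x)" using pend by metis
  let ?I = "CV G"
  let ?J = "induced G ?I"
  have hI: "h x \<in> ?I" if "x \<in> NC G" for x using pendant_CV[OF G(1) h[OF that] G(3)] .
  have hE: "{h x, x} \<in> edges G" "\<And>e. e \<in> edges G \<Longrightarrow> x \<in> e \<Longrightarrow> e = {x, h x}"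
    if "x \<in> NC G" for x
    using pendant_facts(5,6)[OF G(1) h[OF that]] by blast+
  have disj: "x \<notin> ?I" if "x \<in> NC G" for x using that by (simp add: NC_def)
  have VNI: "x \<in> ?I \<or> x \<in> NC G" if "x \<in> verts G" for x using that by (simp add: NC_def)
  have fin: "finite (verts G)" by (rule simple_graphD[OF G(1)])
  have finN: "finite (NC G)" "finite ?I"
    using NC_subset[of G] CV_subset[of G] fin by (auto intro: finite_subset)
  obtain x0 where "x0 \<in> NC G" using l lk(1) by (metis card.empty equals0I not_numeral_le_zero)
  then have r: "h x0 \<in> ?I" by (rule hI)
  have sJ: "simple_graph ?J" by (rule simple_induced[OF G(1) CV_subset])
  have cJ: "connected_graph ?J"
  proof (rule connected_graph_by_crossing)
    show "verts ?J \<noteq> {}" using r by auto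
    fix S assume "S \<subseteq> verts ?J" and ne: "S \<noteq> {}" and "S \<noteq> verts ?J"
    then have S: "S \<subseteq> ?I" "S \<noteq> ?I" by auto
    \<comment> \<open>Leaves are put on the same side as their neighbours, so that the crossing edge
      joins two cut vertices.\<close>
    let ?S = "S \<union> {x \<in> NC G. h x \<in> S}"
    obtain i where i: "i \<in> ?I" "i \<notin> S" using S by blast
    have "i \<notin> ?S" using i disj by blast
    moreover have "i \<in> verts G" using i CV_subset[of G] by blast
    ultimately have S3: "?S \<noteq> verts G" by blast
    have S1: "?S \<subseteq> verts G" using S(1) CV_subset[of G] NC_subset[of G] by blast
    have S2: "?S \<noteq> {}" using ne by simp
    obtain u v where uv: "u \<in> ?S" "v \<in> verts G - ?S" "{u, v} \<in> edges G"
      by (rule connected_graph_crossing[OF G(2) S1 S2 S3 G(1)])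
    have uS: "u \<in> S"
    proof (rule ccontr)
      assume "u \<notin> S"
      then have u: "u \<in> NC G" "h u \<in> S" using uv(1) by auto
      have "{u, v} = {u, h u}" using hE(2)[OF u(1) uv(3)] by blast
      then have "v = h u" by (metis doubleton_eq_iff)
      then show False using u(2) uv(2) by blast
    qed
    have vI: "v \<in> ?I"
    proof (rule ccontr)
      assume "v \<notin> ?I"
      then have v: "v \<in> NC G" using VNI uv(2) by blast
      have "{u, v} = {v, h v}" using hE(2)[OF v uv(3)] by blast
      then have "u = h v" by (metis doubleton_eq_iff)
      then show False using uS v uv(2) by blast
    qed
    then show "\<exists>u\<in>S. \<exists>v\<in>verts ?J - S. {u, v} \<in> edges ?J"
      using uS uv S by auto
  qed
  define N where "N S = {x \<in> NC G. h x \<in> S}" for S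
  define w where "w S = card (N S)" for S
  have finNS: "finite (N S)" for S using finN by (simp add: N_def)
  have wI: "w ?I = l" using hI by (simp add: w_def N_def lk(1) Collect_conj_eq Int_absorb2 subset_iff)
  have wsplit: "w D + w (?I - D) = l" if "D \<subseteq> ?I" for D
  proof -
    have "N ?I = N D \<union> N (?I - D)" "N D \<inter> N (?I - D) = {}" using that by (auto simp: N_def)
    then show ?thesis using wI card_Un_disjoint[OF finNS finNS, of D "?I - D"] by (simp add: w_def)
  qed
  obtain \<D> where \<D>: "finite \<D>" "Suc (card \<D>) = card (verts ?J)"
    "\<And>D. D \<in> \<D> \<Longrightarrow> D \<subseteq> ?I" "\<And>D. D \<in> \<D> \<Longrightarrow> D \<noteq> {}" "\<And>D. D \<in> \<D> \<Longrightarrow> h x0 \<notin> D"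
    "\<And>D. D \<in> \<D> \<Longrightarrow> connected_graph (induced ?J D)"
    "\<And>D. D \<in> \<D> \<Longrightarrow> connected_graph (induced ?J (?I - D))"
    using connected_splits[OF sJ cJ, of "h x0"] r by auto
  \<comment> \<open>The subtracted 1 is counted by \<open>card (cgs ?J)\<close>, which yields the
    summand \<open>k * (k + 1)\<close>. Of the remaining excess \<open>f\<close> only the values at
    \<open>?J\<close> and at the parts of the splits are kept.\<close>
  define f where "f H = 2 ^ w (verts H) - (1 :: nat)" for H :: "'a ugraph"
  have indJ: "induced ?J D \<in> cgs ?J" if "D \<subseteq> ?I" "connected_graph (induced ?J D)" for D
    using simple_induced[OF sJ, of D] that by (auto simp: cgs_iff gle_def)
  let ?P = "induced ?J ` \<D>" and ?Q = "(\<lambda>D. induced ?J (?I - D)) ` \<D>"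
  have "induced ?J D \<in> cgs ?J" "induced ?J (?I - D) \<in> cgs ?J" if "D \<in> \<D>" for D
    using indJ[OF \<D>(3)[OF that] \<D>(6)[OF that]] indJ[OF Diff_subset \<D>(7)[OF that]] .
  then have specials: "insert ?J (?P \<union> ?Q) \<subseteq> cgs ?J"
    using self_cgs[OF sJ cJ] by (simp add: image_subset_iff)
  have vP: "h x0 \<notin> verts H" if P: "H \<in> ?P" for H
  proof -
    obtain D where "D \<in> \<D>" "H = induced ?J D" using P by blast
    then show ?thesis using \<D>(5)[of D] by simp
  qed
  have vQ: "h x0 \<in> verts H \<and> verts H \<noteq> ?I" if Q: "H \<in> ?Q" for H
  proof -
    obtain D where D: "D \<in> \<D>" "H = induced ?J (?I - D)" using Q by blast
    obtain d where "d \<in> D" using \<D>(4)[OF D(1)] by blast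
    then have "d \<in> ?I" "d \<notin> verts H" using \<D>(3)[OF D(1)] D(2) by auto
    then show ?thesis using \<D>(5)[OF D(1)] r D(2) by auto
  qed
  have "verts ?J = ?I" by simp
  \<comment> \<open>The root \<open>h x0\<close> tells the special subgraphs apart: the parts in
    \<open>?P\<close> miss it, those in \<open>?Q\<close> contain it but are not all of
    \<open>?I\<close>.\<close>
  then have d1: "?J \<notin> ?P \<union> ?Q" using vP[of ?J] vQ[of ?J] r by fastforce
  have d2: "?P \<inter> ?Q = {}"
  proof (rule equals0I)
    fix H assume H: "H \<in> ?P \<inter> ?Q"
    show False using vP[of H] vQ[of H] IntD1[OF H] IntD2[OF H] by simp
  qed
  have iP: "inj_on (induced ?J) \<D>"
  proof (rule inj_onI)
    fix D D' assume "induced ?J D = induced ?J D'"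
    from arg_cong[OF this, of verts] show "D = D'" by simp
  qed
  have iQ: "inj_on (\<lambda>D. induced ?J (?I - D)) \<D>"
  proof (rule inj_onI)
    fix D D' assume D: "D \<in> \<D>" "D' \<in> \<D>" "induced ?J (?I - D) = induced ?J (?I - D')"
    have "?I - D = ?I - D'" using arg_cong[OF D(3), of verts] by simp
    then show "D = D'" using \<D>(3)[OF D(1)] \<D>(3)[OF D(2)] by (metis double_diff order_refl)
  qed
  have "(2 ^ l - 1) + 22 * card \<D> \<le> sum f (insert ?J (?P \<union> ?Q))"
  proof -
    have "22 * card \<D> \<le> (\<Sum>D\<in>\<D>. (2 ^ w D - 1) + (2 ^ w (?I - D) - (1 :: nat)))"
      using sum_mono[of \<D> "\<lambda>_. 22" "\<lambda>D. (2 ^ w D - 1) + (2 ^ w (?I - D) - (1 :: nat))"]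
        sum_powers_ge[OF wsplit l] \<D>(3) by (simp add: mult.commute)
    also have "\<dots> = sum f ?P + sum f ?Q"
      unfolding sum.distrib sum.reindex[OF iP] sum.reindex[OF iQ] by (simp add: f_def)
    finally show ?thesis using d1 d2 \<D>(1) wI by (simp add: sum.union_disjoint f_def)
  qed
  also have "\<dots> \<le> sum f (cgs ?J)"
    by (rule sum_mono2[OF finite_cgs[OF sJ] specials]) simp
  finally have f1: "(2 ^ l - 1) + 22 * card \<D> \<le> sum f (cgs ?J)" .
  have "(\<Sum>H\<in>cgs ?J. 2 ^ w (verts H)) = (\<Sum>H\<in>cgs ?J. f H + 1)"
    by (rule sum.cong) (simp_all add: f_def)
  also have "\<dots> = sum f (cgs ?J) + card (cgs ?J)" unfolding sum.distrib by simp
  finally have f2: "(\<Sum>H\<in>cgs ?J. 2 ^ w (verts H)) = sum f (cgs ?J) + card (cgs ?J)" .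
  define \<phi> where "\<phi> = (\<lambda>(H, L). (verts H \<union> L, edges H \<union> (\<lambda>x. {h x, x}) ` L))"
  let ?X = "SIGMA H:cgs ?J. Pow (N (verts H))"
  have X: "verts H \<subseteq> ?I" "edges H \<subseteq> edges G" "L \<subseteq> NC G" "verts H \<noteq> {}"
    "\<And>e. e \<in> edges H \<Longrightarrow> e \<subseteq> ?I" "H \<in> cgs G" if "(H, L) \<in> ?X" for H L
    using that CV_subset[of G] by (auto simp: cgs_iff gle_def N_def connected_graph_def)
  have img: "\<phi> ` ?X \<subseteq> cgs G"
  proof (rule image_subsetI)
    fix p assume p: "p \<in> ?X"
    obtain H L where HL: "p = (H, L)" by (cases p)
    have L: "L \<subseteq> N (verts H)" "finite L" using p finNS finite_subset unfolding HL by auto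
    have "{h x, x} \<in> edges G \<and> h x \<in> verts H" if "x \<in> L" for x
      using that L(1) hE(1) by (auto simp: N_def)
    from pendant_leaf_attach[OF G(1) X(6)[OF p[unfolded HL]] L(2) this]
    show "\<phi> p \<in> cgs G" unfolding \<phi>_def HL by simp
  qed
  have inj: "inj_on \<phi> ?X"
  proof (rule inj_onI)
    fix p q assume p: "p \<in> ?X" and q: "q \<in> ?X" and eq: "\<phi> p = \<phi> q"
    obtain H L where HL: "p = (H, L)" by (cases p)
    obtain H' L' where HL': "q = (H', L')" by (cases q)
    have rec: "verts (\<phi> (H, L)) \<inter> ?I = verts H" "verts (\<phi> (H, L)) - ?I = L"
      "{e \<in> edges (\<phi> (H, L)). e \<subseteq> ?I} = edges H" if HL: "(H, L) \<in> ?X" for H L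
    proof -
      note x = X[OF HL]
      have L: "L \<inter> ?I = {}" using x(3) disj by blast
      show "verts (\<phi> (H, L)) \<inter> ?I = verts H" "verts (\<phi> (H, L)) - ?I = L"
        using x(1) L by (auto simp: \<phi>_def)
      show "{e \<in> edges (\<phi> (H, L)). e \<subseteq> ?I} = edges H"
        using x(5) L by (auto simp: \<phi>_def)
    qed
    have eq': "\<phi> (H, L) = \<phi> (H', L')" using eq unfolding HL HL' .
    note r = rec[OF p[unfolded HL], unfolded eq'] and r' = rec[OF q[unfolded HL']]
    have "verts H = verts H'" by (rule trans[OF r(1)[symmetric] r'(1)])
    moreover have "edges H = edges H'" by (rule trans[OF r(3)[symmetric] r'(3)])
    ultimately have "H = H'" by (simp only: prod_eq_iff)
    moreover have "L = L'" by (rule trans[OF r(2)[symmetric] r'(2)])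
    ultimately show "p = q" unfolding HL HL' by simp
  qed
  \<comment> \<open>The single leaves contain no cut vertex, so they do not arise from a subgraph of
    \<open>?J\<close>.\<close>
  let ?S = "(\<lambda>x. ({x}, {}) :: 'a ugraph) ` NC G"
  have S: "?S \<subseteq> cgs G"
    by (rule image_subsetI) (simp add: NC_iff single_cgs)
  have "card ?S = l" unfolding lk(1) by (rule card_image) (simp add: inj_on_def)
  moreover have "?S \<inter> \<phi> ` ?X = {}"
  proof (rule ccontr)
    assume "?S \<inter> \<phi> ` ?X \<noteq> {}"
    then obtain K where "K \<in> ?S" "K \<in> \<phi> ` ?X" by blast
    then obtain x p where xp: "x \<in> NC G" "K = ({x}, {})" "p \<in> ?X" "K = \<phi> p" by (elim imageE)
    obtain H L where HL: "p = (H, L)" by (cases p)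
    have x: "({x}, {}) = \<phi> (H, L)" using xp(2,4) unfolding HL by (rule subst)
    have "verts H \<subseteq> {x}" using arg_cong[OF x, of verts] by (auto simp: \<phi>_def)
    then show False using X(1,4)[OF xp(3)[unfolded HL]] disj[OF xp(1)] by blast
  qed
  moreover have "finite (\<phi> ` ?X)" by (rule finite_subset[OF img finite_cgs[OF G(1)]])
  moreover have "finite ?S" by (rule finite_subset[OF S finite_cgs[OF G(1)]])
  ultimately have "card (?S \<union> \<phi> ` ?X) = l + card ?X"
    using card_image[OF inj] by (simp add: card_Un_disjoint)
  moreover have "card (?S \<union> \<phi> ` ?X) \<le> card (cgs G)"
    using S img by (intro card_mono finite_cgs[OF G(1)]) blast
  moreover have "card ?X = (\<Sum>H\<in>cgs ?J. 2 ^ w (verts H))"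
    using finNS finite_cgs[OF sJ] by (simp add: card_SigmaI card_Pow w_def)
  ultimately have tot: "l + (sum f (cgs ?J) + card (cgs ?J)) \<le> card (cgs G)" using f2 by simp
  have kJ: "k * (k + 1) \<le> 2 * card (cgs ?J)" using card_cgs_ge[OF sJ cJ] lk(2) by simp
  have kD: "k - 1 = card \<D>" using \<D>(2) lk(2) by simp
  have "2 * l + kk + 2 * P + 44 * d \<le> 2 * C"
    if "l + (s + j) \<le> C" "kk \<le> 2 * j" "P + 22 * d \<le> s" for s j C kk P d :: nat
    using that by linarith
  from this[OF tot kJ f1] show ?thesis unfolding kD .
qed

lemma tree_strict:
  assumes G: "simple_graph G" "connected_graph G" "card (verts G) = Suc (card (edges G))"
    and lk: "l = card (NC G)" "k = card (CV G)" and b: "l \<ge> 7" "1 \<le> k" "k \<le> l"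
  shows "L2 l k < 2 * card (cgs G)"
proof -
  have n: "card (verts G) \<ge> 3" using NC_CV_card[OF G(1)] lk b by linarith
  have "\<exists>y. pendant G x y" if "x \<in> NC G" for x
  proof -
    have "verts G \<noteq> {x}" using n by auto
    then show ?thesis using tree_NC_pendant[OF G that] by blast
  qed
  from pendant_tree_bound[OF G(1,2) n this lk b(1)] tree_arith[OF b]
  show ?thesis by linarith
qed

section \<open>Graphs with a cycle\<close>

text \<open>\<open>Q\<^bsub>n,k\<^esub>\<close> is a lollipop with a second leaf at the neighbour of its end vertex.\<close>

definition fork :: "'a list \<Rightarrow> 'a list \<Rightarrow> 'a \<Rightarrow> 'a ugraph" where
  "fork c p x = add_edge (lollipop c p) (last (c @ butlast p)) x"

text \<open>Given by lists of vertices of \<open>G\<close> itself instead of up to isomorphism, so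
  that the induction can speak about the cycle, the tail and its end. In the second alternative the
  cycle has \<open>k = g - 1\<close> vertices: all but the attachment vertex are non-cut, and the
  two leaves complete the number \<open>g\<close>.\<close>

definition extremal :: "nat \<Rightarrow> nat \<Rightarrow> 'a ugraph \<Rightarrow> bool" where
  "extremal g k G \<longleftrightarrow>
    (\<exists>c p. distinct (c @ p) \<and> 3 \<le> length c \<and> length c = g \<and> length p = k \<and> G = lollipop c p) \<or>
    (g = Suc k \<and> (\<exists>c p x. distinct (c @ p @ [x]) \<and> 3 \<le> length c \<and> length c = k \<and> length p = k \<and>
      G = fork c p x))"

text \<open>Undoing the doubling, the first increment asks for
  \<open>g * (g + 1) / 2 + 1 + k\<close> subgraphs through the neighbour of a removed pendant
  vertex, the second for \<open>(k + 2) * (g + 1) - 2\<close>. The constant on the left avoids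
  subtraction.\<close>

lemma L2_Suc:
  "L2 g (Suc k) = L2 g k + 2 + (g * (g + 1) + 2 + 2 * k)"
  "L2 (Suc g) k + 4 = L2 g k + 2 + 2 * ((k + 2) * (g + 1))"
proof -
  show "L2 g (Suc k) = L2 g k + 2 + (g * (g + 1) + 2 + 2 * k)"
    unfolding L2_def by (simp add: algebra_simps)
  have "Suc g * g + k * (k + 1) + (k + 1) * (Suc g * (Suc g + 1) + 2) + 4 =
    g * (g - 1) + k * (k + 1) + (k + 1) * (g * (g + 1) + 2) + 2 + 2 * ((k + 2) * (g + 1))"
    by (cases g) (simp_all add: algebra_simps)
  then show "L2 (Suc g) k + 4 = L2 g k + 2 + 2 * ((k + 2) * (g + 1))"
    unfolding L2_def by simp
qed

text \<open>With a tail, \<open>last (c @ p)\<close> is its free end and \<open>last c\<close> is a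
  cut vertex; without a tail it is \<open>last c\<close>, and the whole cycle results.\<close>

lemma NC_lollipop:
  assumes "distinct (c @ p)" "length c \<ge> 3"
  shows "NC (lollipop c p) = insert (last (c @ p)) (set (butlast c))"
  using assms(1)
proof (induction p rule: rev_induct)
  case Nil
  have "c \<noteq> []" using assms(2) by auto
  then have "set c = insert (last c) (set (butlast c))"
    by (metis append_butlast_last_id list.simps(15) rotate1.simps(2) set_rotate1)
  then show ?case using NC_cycle[of c] Nil assms(2) by simp
next
  case (snoc x p)
  note P = lollipop_pendant[OF snoc.prems assms(2)]
  have s: "simple_graph (lollipop c (p @ [x]))" by (rule simple_lollipop[OF snoc.prems assms(2)])
  have c: "c \<noteq> []" using assms(2) by auto
  then have cn: "connected_graph (lollipop c (p @ [x]))" by (rule connected_lollipop)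
  have d: "distinct (c @ p)" using snoc.prems by simp
  have "card (set c) \<le> card (verts (lollipop c (p @ [x])))" by (rule card_mono) auto
  then have n: "3 \<le> card (verts (lollipop c (p @ [x])))" using d assms(2) by (simp add: distinct_card)
  have "last (c @ p) \<notin> set (butlast c)"
  proof (cases "p = []")
    case True
    have "distinct (butlast c @ [last c])" using d c by simp
    then show ?thesis using True by simp
  next
    case False
    then have "last (c @ p) \<in> set p" by simp
    then show ?thesis using d in_set_butlastD[of "last (c @ p)" c] by auto
  qed
  then show ?case unfolding pendant_NC_eq[OF s cn P(1) n] P(2) snoc.IH[OF d] by simp
qed

lemma pedges_neighbour:
  assumes "y \<in> set d" "length d \<ge> 2"
  shows "\<exists>e\<in>set d. {y, e} \<in> pedges d"
  using assms
proof (induction d rule: pedges.induct)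
  case (1 a b zs)
  show ?case
  proof (cases "y = a \<or> y = b")
    case True
    then show ?thesis by (auto simp: insert_commute)
  next
    case False
    then have "y \<in> set zs" using 1(2) by simp
    then have "\<exists>e\<in>set (b # zs). {y, e} \<in> pedges (b # zs)" using 1(1) by (cases zs) auto
    then show ?thesis by auto
  qed
qed auto

text \<open>The cycle without its attachment vertex is a path with at least two vertices. It
  supplies the non-cut neighbour for \<open>rooted_lower_bound_noncut_edge\<close>.\<close>

lemma lollipop_butlast_neighbour:
  assumes "y \<in> set (butlast c)" "length c \<ge> 3"
  obtains e where "e \<in> set (butlast c)" "{y, e} \<in> edges (lollipop c p)"
proof -
  obtain e where e: "e \<in> set (butlast c)" "{y, e} \<in> pedges (butlast c)"
  proof -
    have "2 \<le> length (butlast c)" using assms(2) by simp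
    from pedges_neighbour[OF assms(1) this] show ?thesis using that by blast
  qed
  have "c \<noteq> []" using assms(2) by auto
  then have cp: "c @ p = butlast c @ (last c # p)" by simp
  have "butlast c \<noteq> []" using assms(1) by auto
  then have "pedges (butlast c) \<subseteq> pedges (c @ p)" unfolding cp by (simp add: pedges_append subset_iff)
  then show thesis using that[of e] e by auto
qed

lemma add_pendant_lollipop:
  assumes "length c \<ge> 3"
  shows "add_edge (lollipop c p) (last (c @ p)) x = lollipop c (p @ [x])"
proof -
  have ne: "c @ p \<noteq> []" using assms by auto
  then have l: "last (c @ p) \<in> set c \<union> set p" by (metis last_in_set set_append)
  have "pedges (c @ p @ [x]) = insert {last (c @ p), x} (pedges (c @ p))"
    using pedges_append[OF ne, of "[x]"] by simp
  then have "edges (add_edge (lollipop c p) (last (c @ p)) x) = edges (lollipop c (p @ [x]))"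
    by (simp add: insert_commute)
  moreover have "verts (add_edge (lollipop c p) (last (c @ p)) x) = verts (lollipop c (p @ [x]))"
    using l by auto
  ultimately show ?thesis by (simp add: prod_eq_iff)
qed

text \<open>Counting through \<open>y\<close> and off \<open>y\<close> gives the bound with the
  surplus \<open>card (edges G) - g\<close>. Equality therefore makes \<open>G\<close> unicyclic,
  hence a cycle.\<close>

lemma no_cut_vertex_bound:
  assumes G: "simple_graph G" "connected_graph G" "card (verts G) \<le> card (edges G)"
    and CV: "CV G = {}" and g: "g = card (NC G)" "3 \<le> g"
  shows "L2 g 0 \<le> 2 * card (cgs G)"
    "L2 g 0 = 2 * card (cgs G) \<Longrightarrow> extremal g 0 G"
proof -
  have V: "card (verts G) = g" using NC_CV_card[OF G(1)] CV g by simp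
  have NV: "NC G = verts G" using CV by (simp add: NC_def)
  obtain y where y: "y \<in> verts G" using G(2) by (auto simp: connected_graph_def)
  have ne: "verts G \<noteq> {y}" using V g(2) by auto
  obtain u e where e: "u \<in> {y}" "{u, e} \<in> edges G"
    using connected_graph_crossing[OF G(2) _ _ _ G(1), of "{y}"] y ne by blast
  then have ye: "{y, e} \<in> edges G" by simp
  have eN: "e \<in> NC G" using simple_graph_edgeD(3)[OF G(1) ye] NV by simp
  have "g - 1 = card (NC G - {y})" "0 = card (CV G - {y})"
    using NV V y CV simple_graphD(1)[OF G(1)] by simp_all
  from rooted_lower_bound_noncut_edge[OF G ye eN this]
  have 1: "g * (g - 1) + 2 + 2 * card (edges G) \<le> 2 * card (rooted G y)"
    using g(2) by simp
  have "y \<in> NC G" using NV y by simp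
  from delete_in_cgs[OF G(1) this ne]
  have K: "simple_graph (delete_vertex G y)" "connected_graph (delete_vertex G y)"
    by (simp_all add: cgs_iff)
  have "card (verts (delete_vertex G y)) = g - 1" using V y simple_graphD(1)[OF G(1)] by simp
  then have 2: "g * (g - 1) \<le> 2 * card (cgs (delete_vertex G y))"
    using card_cgs_ge[OF K] g(2) by (simp add: mult.commute)
  obtain h where h: "g = Suc h" using g(2) by (cases g) auto
  have L: "L2 g 0 = g * (g - 1) + 2 + 2 * g + g * (g - 1)"
    unfolding h L2_def by (simp add: algebra_simps)
  have tot: "L2 g 0 + 2 * card (edges G) \<le> 2 * card (cgs G) + 2 * g"
    using 1 2 unfolding card_cgs_split[OF G(1), of y] L by simp
  then show "L2 g 0 \<le> 2 * card (cgs G)" using G(3) V by simp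
  assume "L2 g 0 = 2 * card (cgs G)"
  then have "card (edges G) = card (verts G)" using tot G(3) V by simp
  from unicyclic_no_cut_is_cycle[OF G(1,2) this CV] V g(2)
  obtain c where c: "distinct c" "length c = card (verts G)" "G = lollipop c []" by metis
  then show "extremal g 0 G" unfolding extremal_def using V g(2) by (intro disjI1 exI[of _ c] exI[of _ "[]"]) simp
qed

text \<open>The first increment of \<open>L2\<close> is precisely the lower bound for the subgraphs
  through \<open>y\<close> in \<open>G - x\<close>. In the equality case \<open>G - x\<close> is a
  lollipop and \<open>y\<close> one of its non-cut vertices. The free end prolongs the tail; a
  vertex on the cycle has a non-cut neighbour, and the surplus that this creates excludes it unless
  there is no tail.\<close>

lemma pendant_noncut_step:
  assumes G: "simple_graph G" "connected_graph G" "card (verts G) \<le> card (edges G)"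
    and p: "pendant G x y" and y: "y \<in> NC (delete_vertex G x)"
    and gk: "g = card (NC G)" "k = card (CV G)" "3 \<le> card (verts G)"
    and girth: "\<And>c. cyc G c \<Longrightarrow> k \<le> length c"
    and k: "k = Suc k'"
    and IH: "L2 g k' \<le> 2 * card (cgs (delete_vertex G x))"
      "L2 g k' = 2 * card (cgs (delete_vertex G x)) \<Longrightarrow> extremal g k' (delete_vertex G x)"
  shows "L2 g k \<le> 2 * card (cgs G)"
    "L2 g k = 2 * card (cgs G) \<Longrightarrow> extremal g k G"
proof -
  let ?G = "delete_vertex G x"
  note pf = pendant_facts[OF G(1) p]
  note cards = pendant_cards[OF G(1,2) p gk(3)]
  have G': "simple_graph ?G" "connected_graph ?G" "card (verts ?G) \<le> card (edges ?G)"
    using G connected_pendant_delete[OF G(1,2) p] cards(5,6) by simp_all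
  have g': "card (NC ?G) = g" "card (CV ?G) = k'" using cards(1,2)[OF y] gk k by simp_all
  have V: "card (verts ?G) = g + k'" using NC_CV_card[OF G'(1)] g' by simp
  have yV: "y \<in> verts ?G" using y by (simp add: NC_iff)
  have fin: "finite (NC ?G)" using NC_subset[of ?G] simple_graphD(1)[OF G'(1)] finite_subset by blast
  have gpos: "0 < g" using y fin g'(1) card_gt_0_iff by blast
  have "y \<notin> CV ?G" using y by (simp add: NC_def)
  then have m: "g - 1 = card (NC ?G - {y})" "k' = card (CV ?G - {y})" using y fin g' by simp_all
  from rooted_lower_bound_cyclic[OF G' yV m] gpos
  have R: "g * (g + 1) + 2 + 2 * k' \<le> 2 * card (rooted ?G y)" by (cases g) simp_all
  have tot: "card (cgs G) = card (cgs ?G) + Suc (card (rooted ?G y))"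
    using card_cgs_split[OF G(1), of x] card_rooted_pendant(1)[OF G(1) p] by simp
  show "L2 g k \<le> 2 * card (cgs G)" using R IH(1) unfolding k L2_Suc(1) tot by simp
  assume eq: "L2 g k = 2 * card (cgs G)"
  have e1: "L2 g k' = 2 * card (cgs ?G)" and e2: "2 * card (rooted ?G y) = g * (g + 1) + 2 + 2 * k'"
    using eq R IH(1) unfolding k L2_Suc(1) tot by simp_all
  \<comment> \<open>A fork would bring a cycle of length \<open>k' < k\<close>, against the girth
    hypothesis.\<close>
  have "\<not> (\<exists>c p x. distinct (c @ p @ [x]) \<and> 3 \<le> length c \<and> length c = k' \<and> length p = k' \<and> ?G = fork c p x)"
  proof
    assume "\<exists>c p x. distinct (c @ p @ [x]) \<and> 3 \<le> length c \<and> length c = k' \<and> length p = k' \<and> ?G = fork c p x"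
    then obtain c p z where c: "distinct (c @ p @ [z])" "3 \<le> length c" "length c = k'" "?G = fork c p z"
      by blast
    have c0: "c \<noteq> []" using c(2) by auto
    have "gle (lollipop c []) (lollipop c p)"
      using c0 by (cases "p = []") (auto simp: gle_def pedges_append)
    moreover have "gle (lollipop c p) (fork c p z)" by (auto simp: gle_def fork_def)
    moreover have "gle ?G G" by (auto simp: gle_def)
    ultimately have "gle (lollipop c []) G" unfolding c(4) using gle_trans by metis
    then have "cyc G c" using c(1,2) by (simp add: cyc_def)
    then show False using girth c(3) k by fastforce
  qed
  then obtain c p where c: "distinct (c @ p)" "3 \<le> length c" "length c = g" "length p = k'"
    "?G = lollipop c p" using IH(2)[OF e1] unfolding extremal_def by blast
  have Geq: "G = add_edge (lollipop c p) y x"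
    using add_edge_pendant_delete[OF G(1) p] c(5) by simp
  have xn: "x \<notin> set (c @ p)"
  proof -
    have "x \<notin> verts ?G" by simp
    then show ?thesis unfolding c(5) by simp
  qed
  show "extremal g k G"
  proof (cases "y = last (c @ p)")
    case True
    have "G = lollipop c (p @ [x])" using Geq add_pendant_lollipop[OF c(2)] True by simp
    then show ?thesis unfolding extremal_def using c xn k
      by (intro disjI1 exI[of _ c] exI[of _ "p @ [x]"]) simp
  next
    case False
    have yb: "y \<in> set (butlast c)" using y False NC_lollipop[OF c(1,2)] unfolding c(5) by simp
    show ?thesis
    proof (cases "k' = 0")
      case True
      then have pn: "p = []" using c(4) by simp
      have "y \<in> set c" using yb by (rule in_set_butlastD)
      then obtain u v where uv: "c = u @ y # v" by (metis split_list)
      \<comment> \<open>Without a tail every vertex of the cycle can be rotated to the seam, where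
        the new tail starts.\<close>
      define d where "d = v @ u @ [y]"
      have "rotate (length (u @ [y])) ((u @ [y]) @ v) = d" unfolding d_def rotate_swap by simp
      then have d: "d = rotate (length (u @ [y])) c" unfolding uv by simp
      have d': "distinct d" "length d = length c" "set d = set c" using c(1) unfolding d by simp_all
      have ld: "last (d @ []) = y" unfolding d_def by simp
      have d3: "3 \<le> length d" using c(2) d'(2) by simp
      have "lollipop c p = lollipop d []" unfolding pn d by (rule lollipop_rotate[symmetric])
      then have "G = lollipop d [x]"
        using Geq add_pendant_lollipop[OF d3, of "[]" x] unfolding ld by simp
      then show ?thesis unfolding extremal_def using c xn k d' True
        by (intro disjI1 exI[of _ d] exI[of _ "[x]"]) simp
    next
      case k0: False
      obtain e where e: "e \<in> set (butlast c)" "{y, e} \<in> edges ?G"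
        using lollipop_butlast_neighbour[OF yb c(2), of p] unfolding c(5) by blast
      have eN: "e \<in> NC ?G" using e(1) NC_lollipop[OF c(1,2)] unfolding c(5) by simp
      from rooted_lower_bound_noncut_edge[OF G' e(2) eN m]
      have "(g - 1 + 1) * (g - 1) + 2 + 2 * k' + 2 * card (edges ?G) \<le> g * (g + 1) + 2 + 2 * k'"
        unfolding e2 .
      moreover have "g + k' \<le> card (edges ?G)" using G'(3) V by simp
      moreover obtain h where "g = Suc h" using gpos by (cases g) auto
      \<comment> \<open>The first inequality leaves at most \<open>g\<close> edges for
        \<open>?G\<close>, the second demands \<open>g + k'\<close>.\<close>
      ultimately have "k' = 0" by (simp add: algebra_simps)
      then show ?thesis using k0 by simp
    qed
  qed
qed

section \<open>The two sides of a cut vertex\<close>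

lemma cut_vertex_split:
  assumes G: "simple_graph G" "connected_graph G" and y: "y \<in> CV G"
    and g: "g = card (NC G)" and k: "card (CV G) = Suc k'"
  obtains A B a b p q where "sep G y A B" "A \<noteq> {y}" "B \<noteq> {y}"
    "a = card (NC (induced G A) - {y})" "p = card (CV (induced G A) - {y})"
    "b = card (NC (induced G B) - {y})" "q = card (CV (induced G B) - {y})"
    "a + b = g" "p + q = k'"
proof -
  obtain A B where AB: "sep G y A B" "A \<noteq> {y}" "B \<noteq> {y}" using CV_sep[OF G(1) y] by blast
  have fin: "finite (CV G)" using CV_subset[of G] simple_graphD(1)[OF G(1)] finite_subset by blast
  have "NC G - {y} = NC G" using y by (auto simp: NC_def)
  then have "card (NC (induced G A) - {y}) + card (NC (induced G B) - {y}) = g"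
    using sep_cards(1)[OF G AB(1)] g by simp
  moreover have "card (CV (induced G A) - {y}) + card (CV (induced G B) - {y}) = k'"
    using sep_cards(2)[OF G AB(1)] y fin k by simp
  ultimately show thesis using that[OF AB refl refl refl refl] by blast
qed

lemma sep_side_facts:
  assumes G: "simple_graph G" "connected_graph G" and s: "sep G y A B" and ne: "A \<noteq> {y}"
  shows "simple_graph (induced G A)" "connected_graph (induced G A)" "y \<in> A" "2 \<le> card A"
    "A \<subseteq> verts G" "y \<in> verts G" "finite A" "Suc 0 \<le> card (NC (induced G A) - {y})"
proof -
  have AB: "A \<union> B = verts G" "A \<inter> B = {y}" using s by (auto simp: sep_def)
  show A: "A \<subseteq> verts G" "y \<in> A" using AB by auto
  then show "y \<in> verts G" by blast
  show sA: "simple_graph (induced G A)" by (rule simple_induced[OF G(1) A(1)])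
  show cA: "connected_graph (induced G A)" by (rule connected_sep[OF G s])
  show fin: "finite A" using simple_graphD(1)[OF sA] by simp
  obtain z where z: "z \<in> A" "z \<noteq> y" using ne A(2) by blast
  have "card {y, z} \<le> card A" using fin A(2) z by (intro card_mono) auto
  then show c: "2 \<le> card A" using z by simp
  then have "2 \<le> card (NC (induced G A))" using card_NC_ge_2[OF sA cA] by simp
  moreover have "card (NC (induced G A)) - card {y} \<le> card (NC (induced G A) - {y})"
    by (rule diff_card_le_card_Diff) simp
  ultimately show "Suc 0 \<le> card (NC (induced G A) - {y})" by simp
qed

text \<open>A cycle on the side is a cycle of \<open>G\<close>, so it has at least \<open>k\<close>
  vertices. The side has at least as many non-cut vertices, of which \<open>y\<close> may be
  one.\<close>

lemma sep_side_cyclic: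
  assumes G: "simple_graph G" "connected_graph G" and s: "sep G y A B" and ne: "A \<noteq> {y}"
    and E: "card A \<le> card (edges (induced G A))"
    and girth: "\<And>c. cyc G c \<Longrightarrow> k \<le> length c"
  shows "2 \<le> card (NC (induced G A) - {y})" "k \<le> card (NC (induced G A) - {y}) + 1"
    "(card (NC (induced G A) - {y}) + 1) * (card (NC (induced G A) - {y}) + 2) + 2
      + 2 * card (CV (induced G A) - {y}) \<le> 2 * card (rooted (induced G A) y)"
proof -
  note f = sep_side_facts[OF G s ne]
  have E': "card (verts (induced G A)) \<le> card (edges (induced G A))" using E by simp
  obtain c where c: "cyc (induced G A) c" using cyc_exists[OF f(1,2) E'] by blast
  have "gle (induced G A) G" using f(5) by (auto simp: gle_def)
  then have "cyc G c" by (rule cyc_mono[OF c])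
  then have "k \<le> length c" by (rule girth)
  moreover have "3 \<le> length c" using c by (simp add: cyc_def)
  moreover have "length c \<le> card (NC (induced G A))" by (rule cyc_length_le_NC[OF f(1,2) c])
  moreover have "card (NC (induced G A)) - card {y} \<le> card (NC (induced G A) - {y})"
    by (rule diff_card_le_card_Diff) simp
  ultimately show "2 \<le> card (NC (induced G A) - {y})" "k \<le> card (NC (induced G A) - {y}) + 1"
    by simp_all
  show "(card (NC (induced G A) - {y}) + 1) * (card (NC (induced G A) - {y}) + 2) + 2
      + 2 * card (CV (induced G A) - {y}) \<le> 2 * card (rooted (induced G A) y)"
    by (rule rooted_lower_bound_cyclic[OF f(1,2) E' _ refl refl]) (simp add: f(3))
qed

text \<open>A tree side has a leaf other than \<open>y\<close>. All edges of \<open>G\<close> at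
  this leaf lie on the side, so it is pendant in \<open>G\<close> as well.\<close>

lemma tree_side_pendant:
  assumes G: "simple_graph G" "connected_graph G" and s: "sep G y A B" and ne: "A \<noteq> {y}"
    and E: "\<not> card A \<le> card (edges (induced G A))"
  shows "\<exists>v z. pendant G v z"
proof -
  note f = sep_side_facts[OF G s ne]
  have t: "card (verts (induced G A)) = Suc (card (edges (induced G A)))"
    using card_edges_ge[OF f(1,2)] E by simp
  have "NC (induced G A) - {y} \<noteq> {}"
    using f(8) by (metis One_nat_def card.empty not_one_le_zero)
  then obtain v where v: "v \<in> NC (induced G A)" "v \<noteq> y" by blast
  have "verts (induced G A) \<noteq> {v}" using f(3) v(2) by auto
  from tree_NC_pendant[OF f(1,2) t v(1) this] obtain z where z: "pendant (induced G A) v z" by blast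
  have "v \<in> A" using v(1) by (simp add: NC_iff)
  then have "v \<notin> B" using s v(2) by (auto simp: sep_def)
  have "pendant G v z" unfolding pendant_def
  proof (intro conjI ballI impI)
    show "{v, z} \<in> edges G" using z by (simp add: pendant_def)
    fix e assume e: "e \<in> edges G" "v \<in> e"
    then have "e \<subseteq> A" using s \<open>v \<notin> B\<close> by (auto simp: sep_def)
    then have "e \<in> edges (induced G A)" using e(1) by simp
    then show "e = {v, z}" using z e(2) unfolding pendant_def by blast
  qed
  then show ?thesis by blast
qed

text \<open>Without pendant vertices neither side of a cut vertex is a tree, and the subgraphs
  through that vertex alone exceed the bound.\<close>

lemma no_pendant_bound:
  assumes G: "simple_graph G" "connected_graph G"
    and np: "\<not> (\<exists>x y. pendant G x y)"
    and gk: "g = card (NC G)" "k = card (CV G)" "k = Suc k'"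
    and girth: "\<And>c. cyc G c \<Longrightarrow> k \<le> length c"
  shows "L2 g k < 2 * card (cgs G)"
proof -
  have "CV G \<noteq> {}" using gk by auto
  then obtain y where y: "y \<in> CV G" by blast
  have "card (CV G) = Suc k'" using gk by simp
  from cut_vertex_split[OF G y gk(1) this] obtain A B a b p q where
    AB: "sep G y A B" "A \<noteq> {y}" "B \<noteq> {y}"
    and d: "a = card (NC (induced G A) - {y})" "p = card (CV (induced G A) - {y})"
    "b = card (NC (induced G B) - {y})" "q = card (CV (induced G B) - {y})"
    and s: "a + b = g" "p + q = k'" by metis
  have EA: "card A \<le> card (edges (induced G A))"
    using tree_side_pendant[OF G AB(1,2)] np by blast
  have EB: "card B \<le> card (edges (induced G B))"
    using tree_side_pendant[OF G sep_sym[OF AB(1)] AB(3)] np by blast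
  note A = sep_side_cyclic[OF G AB(1,2) EA girth, folded d]
  note B = sep_side_cyclic[OF G sep_sym[OF AB(1)] AB(3) EB girth, folded d]
  have k: "k = 1 + p + q" using gk(3) s(2) by simp
  have "L2 (a + b) k < 2 * (card (rooted (induced G A) y) * card (rooted (induced G B) y))"
    by (rule product_bound_cyclic[OF A(1,2) B(1,2) k A(3) B(3)])
  also have "\<dots> \<le> 2 * card (rooted G y)" using sep_rooted_product[OF G(1) AB(1)] by simp
  also have "\<dots> \<le> 2 * card (cgs G)" using card_cgs_split[OF G(1), of y] by simp
  finally show ?thesis unfolding s .
qed

text \<open>The second increment of \<open>L2\<close> is met by the product over the two sides of
  \<open>y\<close> in \<open>G - x\<close>. In the equality case one side is a single edge
  \<open>yz\<close> and \<open>G - x\<close> is the lollipop whose cycle and tail both have length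
  \<open>k\<close>. Then \<open>z\<close> is its free end, and \<open>x\<close> becomes a second
  leaf beside it.\<close>

lemma pendant_cut_step:
  assumes G: "simple_graph G" "connected_graph G" "card (verts G) \<le> card (edges G)"
    and p: "pendant G x y" and y: "y \<notin> NC (delete_vertex G x)"
    and gk: "g = card (NC G)" "k = card (CV G)" "k = Suc k'" "3 \<le> card (verts G)"
    and girth: "\<And>c. cyc G c \<Longrightarrow> k \<le> length c"
    and g: "g = Suc g'" "k \<le> g'"
    and IH: "L2 g' k \<le> 2 * card (cgs (delete_vertex G x))"
      "L2 g' k = 2 * card (cgs (delete_vertex G x)) \<Longrightarrow> extremal g' k (delete_vertex G x)"
  shows "L2 g k \<le> 2 * card (cgs G)"
    "L2 g k = 2 * card (cgs G) \<Longrightarrow> extremal g k G"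
proof -
  let ?G = "delete_vertex G x"
  note pf = pendant_facts[OF G(1) p]
  note cards = pendant_cards[OF G(1,2) p gk(4)]
  have G': "simple_graph ?G" "connected_graph ?G" "card (verts ?G) \<le> card (edges ?G)"
    using G connected_pendant_delete[OF G(1,2) p] cards(5,6) by simp_all
  have c': "g' = card (NC ?G)" "card (CV ?G) = Suc k'" using cards(3,4)[OF y] gk g by simp_all
  have yV: "y \<in> verts ?G" using pf by simp
  then have yC: "y \<in> CV ?G" using y by (simp add: NC_def)
  \<comment> \<open>The sides share only \<open>y\<close>, so if both were trees, \<open>?G\<close>
    would have fewer edges than vertices.\<close>
  have "\<exists>A B. sep ?G y A B \<and> A \<noteq> {y} \<and> B \<noteq> {y} \<and> card A \<le> card (edges (induced ?G A))"
  proof -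
    obtain A B where AB: "sep ?G y A B" "A \<noteq> {y}" "B \<noteq> {y}" using CV_sep[OF G'(1) yC] by blast
    note sc = sep_cards(3,4)[OF G'(1,2) AB(1)]
    have "card A \<le> card (edges (induced ?G A)) \<or> card B \<le> card (edges (induced ?G B))"
      using sc G'(3) by linarith
    then show ?thesis using AB sep_sym[OF AB(1)] by blast
  qed
  then obtain A B where AB: "sep ?G y A B" "A \<noteq> {y}" "B \<noteq> {y}"
    and EA: "card A \<le> card (edges (induced ?G A))" by blast
  define a p b q where d: "a = card (NC (induced ?G A) - {y})" "p = card (CV (induced ?G A) - {y})"
    "b = card (NC (induced ?G B) - {y})" "q = card (CV (induced ?G B) - {y})"
  have fin: "finite (CV ?G)" using CV_subset[of ?G] simple_graphD(1)[OF G'(1)] finite_subset by blast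
  have "NC ?G - {y} = NC ?G" using y by simp
  then have ab: "g' = a + b" using sep_cards(1)[OF G'(1,2) AB(1)] c'(1) d by simp
  have pq: "k = 1 + p + q" using sep_cards(2)[OF G'(1,2) AB(1)] yC fin c'(2) gk(3) d by simp
  have girth': "k \<le> length c" if "cyc ?G c" for c
    by (rule girth, rule cyc_mono[OF that]) (auto simp: gle_def)
  have A1: "2 \<le> a"
    unfolding d by (rule sep_side_cyclic(1)[OF G'(1,2) AB(1,2) EA girth'])
  have A2: "(a + 1) * (a + 2) + 2 + 2 * p \<le> 2 * card (rooted (induced ?G A) y)"
    unfolding d by (rule sep_side_cyclic(3)[OF G'(1,2) AB(1,2) EA girth'])
  note fB = sep_side_facts[OF G'(1,2) sep_sym[OF AB(1)] AB(3)]
  have b1: "1 \<le> b" using fB(8) d by simp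
  have "y \<in> verts (induced ?G B)" using fB(3) by simp
  note B = rooted_lower_bound[OF fB(1,2) this d(3,4)]
  note prod = product_bound_pendant[OF A1 b1 pq ab g(2) A2 B]
  have le: "(k + 2) * (g' + 1) \<le> card (rooted ?G y) + 2"
    using prod(1) sep_rooted_product[OF G'(1) AB(1)] by linarith
  have tot: "card (cgs G) = card (cgs ?G) + Suc (card (rooted ?G y))"
    using card_cgs_split[OF G(1), of x] card_rooted_pendant(1)[OF G(1) p] by simp
  have arith: "L \<le> 2 * C \<and> (L = 2 * C \<longrightarrow> L' = 2 * C' \<and> X = r + 2)"
    if "L + 4 = L' + 2 + 2 * X" "X \<le> r + 2" "L' \<le> 2 * C'" "C = C' + Suc r"
    for L L' C C' X r :: nat using that by linarith
  note fin_arith = arith[OF L2_Suc(2) le IH(1) tot, folded g(1)]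
  then show "L2 g k \<le> 2 * card (cgs G)" by blast
  assume "L2 g k = 2 * card (cgs G)"
  with fin_arith have e1: "L2 g' k = 2 * card (cgs ?G)"
    and e2: "(k + 2) * (g' + 1) = card (rooted ?G y) + 2" by blast+
  have "(k + 2) * (g' + 1) = card (rooted (induced ?G A) y) * card (rooted (induced ?G B) y) + 2"
    using e2 prod(1) sep_rooted_product[OF G'(1) AB(1)] by linarith
  from prod(2)[OF this] have eq: "b = 1" "q = 0" "g' = k" by auto
  \<comment> \<open>The fork alternative for \<open>?G\<close> would require
    \<open>g' = k + 1\<close>.\<close>
  obtain c r where c: "distinct (c @ r)" "3 \<le> length c" "length c = g'" "length r = k"
    "?G = lollipop c r"
    using IH(2)[OF e1] eq(3) unfolding extremal_def by auto
  have rne: "r \<noteq> []" using c(4) gk(3) by auto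
  define r' t where "r' = butlast r" and "t = last r"
  have r: "r = r' @ [t]" using rne unfolding r'_def t_def by simp
  have "card (NC (induced ?G B) - {y}) = 1" using eq(1) d(3) by simp
  then obtain z where z: "NC (induced ?G B) - {y} = {z}" by (auto simp: card_1_singleton_iff)
  have fB': "finite (CV (induced ?G B))"
    using CV_subset[of "induced ?G B"] fB(7) finite_subset by auto
  have "CV (induced ?G B) - {y} = {}" using eq(2) d(4) fB' by simp
  moreover have "B = NC (induced ?G B) \<union> CV (induced ?G B)"
    using CV_subset[of "induced ?G B"] by (auto simp: NC_def)
  ultimately have "B - {y} = {z}" using z by blast
  then have B: "B = {y, z}" "z \<noteq> y" using fB(3) by auto
  have zV: "z \<in> verts ?G" using fB(5) B(1) by blast
  have zA: "z \<notin> A" using AB(1) B by (auto simp: sep_def)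
  have inB: "e \<subseteq> {y, z}" if "e \<in> edges ?G" "z \<in> e" for e
    using AB(1) that zA B(1) unfolding sep_def by blast
  have zedge: "e = {z, y}" if e: "e \<in> edges ?G" "z \<in> e" for e
  proof -
    obtain w where w: "e = {z, w}" "z \<noteq> w" using simple_graph_edge_at[OF G'(1) e] by metis
    then have "w = y" using inB[OF e] by auto
    then show ?thesis using w(1) by simp
  qed
  have zs: "{z} \<subseteq> verts ?G" "{z} \<noteq> {}" using zV by simp_all
  have zne: "{z} \<noteq> verts ?G"
  proof
    assume "{z} = verts ?G"
    with yV have "y \<in> {z}" by (simp only:)
    then show False using B(2) by simp
  qed
  obtain u v where uv: "u \<in> {z}" "{u, v} \<in> edges ?G"
    by (rule connected_graph_crossing[OF G'(2) zs zne G'(1)])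
  have pz: "pendant ?G z y"
    unfolding pendant_def
  proof (intro conjI ballI impI)
    have "{u, v} = {z, y}" by (rule zedge[OF uv(2)]) (use uv(1) in simp)
    then show "{z, y} \<in> edges ?G" using uv(2) by simp
  qed (rule zedge)
  have zN: "z \<in> insert (last (c @ r)) (set (butlast c))"
    using pendant_NC[OF G'(1,2) pz] NC_lollipop[OF c(1,2)] unfolding c(5) by simp
  \<comment> \<open>On the cycle \<open>z\<close> would have a non-cut neighbour, but its only
    neighbour \<open>y\<close> is a cut vertex.\<close>
  have "z \<notin> set (butlast c)"
  proof
    assume "z \<in> set (butlast c)"
    then obtain e where e: "e \<in> set (butlast c)" "{z, e} \<in> edges ?G"
      using lollipop_butlast_neighbour[OF _ c(2), of z r] unfolding c(5) by blast
    have "{z, e} = {z, y}" by (rule zedge[OF e(2)]) simp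
    then have "e = y" by (metis doubleton_eq_iff)
    then have "y \<in> NC ?G" using e(1) NC_lollipop[OF c(1,2)] unfolding c(5) by simp
    then show False using y by simp
  qed
  then have zt: "z = t" using zN r by simp
  have "distinct (c @ r' @ [t])" using c(1) unfolding r .
  from lollipop_pendant(1)[OF this c(2)] have "{t, last (c @ r')} \<in> edges ?G"
    unfolding c(5) r by (simp add: pendant_def)
  then have "{t, last (c @ r')} = {z, y}" by (rule zedge) (simp add: zt)
  then have ylast: "y = last (c @ butlast r)" unfolding zt r'_def by (metis doubleton_eq_iff)
  have Geq: "G = fork c r x"
    using add_edge_pendant_delete[OF G(1) p, symmetric] unfolding c(5) fork_def ylast .
  have "x \<notin> verts ?G" by simp
  then have "x \<notin> set (c @ r)" unfolding c(5) by simp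
  then have "distinct (c @ r @ [x])" using c(1) by simp
  then show "extremal g k G" unfolding extremal_def using c eq(3) g(1) Geq by blast
qed

theorem cyclic_bound:
  assumes "simple_graph G" "connected_graph G" "card (verts G) \<le> card (edges G)"
    and "g = card (NC G)" "k = card (CV G)" "k \<le> g"
    and "\<And>c. cyc G c \<Longrightarrow> k \<le> length c"
  shows "L2 g k \<le> 2 * card (cgs G) \<and> (L2 g k = 2 * card (cgs G) \<longrightarrow> extremal g k G)"
  using assms
proof (induction "card (verts G)" arbitrary: G g k rule: less_induct)
  case less
  note G = less.prems(1-3) and gk = less.prems(4-6) and girth = less.prems(7)
  obtain c0 where c0: "cyc G c0" using cyc_exists[OF G] by blast
  have g3: "3 \<le> g" using cyc_length_le_NC[OF G(1,2) c0] c0 gk(1) by (simp add: cyc_def)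
  then have V3: "3 \<le> card (verts G)" using NC_CV_card[OF G(1)] gk by linarith
  show ?case
  proof (cases k)
    case 0
    have "finite (CV G)" using CV_subset[of G] simple_graphD(1)[OF G(1)] finite_subset by blast
    then have "CV G = {}" using 0 gk(2) by simp
    from no_cut_vertex_bound[OF G this gk(1) g3] show ?thesis unfolding 0 by blast
  next
    case (Suc k')
    show ?thesis
    proof (cases "\<exists>x y. pendant G x y")
      case False
      have "L2 g k < 2 * card (cgs G)"
        by (rule no_pendant_bound[OF G(1,2) False gk(1,2) Suc girth])
      then show ?thesis by simp
    next
      case True
      then obtain x y where p: "pendant G x y" by blast
      let ?G = "delete_vertex G x"
      note cards = pendant_cards[OF G(1,2) p V3]
      have less': "card (verts ?G) < card (verts G)" using cards(5) by linarith
      have G': "simple_graph ?G" "connected_graph ?G" "card (verts ?G) \<le> card (edges ?G)"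
        using G connected_pendant_delete[OF G(1,2) p] cards(5,6) by simp_all
      have cyc': "cyc G c" if "cyc ?G c" for c
        by (rule cyc_mono[OF that]) (auto simp: gle_def)
      show ?thesis
      proof (cases "y \<in> NC ?G")
        case True
        have c: "g = card (NC ?G)" "k' = card (CV ?G)" using cards(1,2)[OF True] gk Suc by simp_all
        have le: "k' \<le> g" using gk(3) Suc by simp
        have gi: "k' \<le> length c" if "cyc ?G c" for c using girth[OF cyc'[OF that]] Suc by simp
        have IH: "L2 g k' \<le> 2 * card (cgs ?G)"
          "L2 g k' = 2 * card (cgs ?G) \<Longrightarrow> extremal g k' ?G"
          using less.hyps[OF less' G' c le gi] by blast+
        from pendant_noncut_step[OF G p True gk(1,2) V3 girth Suc IH] show ?thesis by blast
      next
        case False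
        have c: "card (NC ?G) = card (NC ?G)" "k = card (CV ?G)" "g = Suc (card (NC ?G))"
          using cards(3,4)[OF False] gk by simp_all
        obtain c1 where c1: "cyc ?G c1" using cyc_exists[OF G'] by blast
        \<comment> \<open>When \<open>g\<close> drops, \<open>k <= g\<close> survives only thanks to
          the girth hypothesis: a cycle of \<open>G - x\<close> has at least \<open>k\<close>
          vertices, and \<open>G - x\<close> has at least as many non-cut vertices.\<close>
        have le: "k \<le> card (NC ?G)"
          using girth[OF cyc'[OF c1]] cyc_length_le_NC[OF G'(1,2) c1] by linarith
        have gi: "k \<le> length c" if "cyc ?G c" for c using girth[OF cyc'[OF that]] .
        have IH: "L2 (card (NC ?G)) k \<le> 2 * card (cgs ?G)"
          "L2 (card (NC ?G)) k = 2 * card (cgs ?G) \<Longrightarrow> extremal (card (NC ?G)) k ?G"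
          using less.hyps[OF less' G' c(1,2) le gi] by blast+
        from pendant_cut_step[OF G p False gk(1,2) Suc V3 girth c(3) le IH] show ?thesis by blast
      qed
    qed
  qed
qed

section \<open>Isomorphic copies and the theorem\<close>

lemma graph_iso_image:
  assumes G: "simple_graph G" and f: "inj_on f (verts G)"
    and H: "verts H = f ` verts G" "edges H = (`) f ` edges G"
  shows "graph_iso G H"
  unfolding graph_iso_def
proof (intro exI[of _ f] conjI ballI)
  show "bij_betw f (verts G) (verts H)" using f H(1) by (simp add: bij_betw_def)
  fix u v assume uv: "u \<in> verts G" "v \<in> verts G"
  show "{u, v} \<in> edges G \<longleftrightarrow> {f u, f v} \<in> edges H"
  proof
    assume "{u, v} \<in> edges G"
    then have "f ` {u, v} \<in> edges H" unfolding H(2) by (rule imageI)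
    then show "{f u, f v} \<in> edges H" by simp
  next
    assume "{f u, f v} \<in> edges H"
    then obtain e where e: "e \<in> edges G" "f ` {u, v} = f ` e" unfolding H(2) by auto
    have "{u, v} \<subseteq> verts G" "e \<subseteq> verts G" using uv simple_graphD(2)[OF G e(1)] by auto
    then have "{u, v} = e" using inj_on_image_eq_iff[OF f] e(2) by blast
    then show "{u, v} \<in> edges G" using e(1) by simp
  qed
qed

lemma graph_iso_sym:
  assumes "graph_iso G H"
  shows "graph_iso H G"
proof -
  obtain f where f: "bij_betw f (verts G) (verts H)"
    "\<And>u v. u \<in> verts G \<Longrightarrow> v \<in> verts G \<Longrightarrow> {u, v} \<in> edges G \<longleftrightarrow> {f u, f v} \<in> edges H"
    using assms by (auto simp: graph_iso_def)
  let ?g = "inv_into (verts G) f"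
  have g: "bij_betw ?g (verts H) (verts G)" by (rule bij_betw_inv_into[OF f(1)])
  have mem: "?g u \<in> verts G" "f (?g u) = u" if "u \<in> verts H" for u
    using bij_betwE[OF g] bij_betw_inv_into_right[OF f(1)] that by blast+
  have "{u, v} \<in> edges H \<longleftrightarrow> {?g u, ?g v} \<in> edges G" if "u \<in> verts H" "v \<in> verts H" for u v
    using f(2)[OF mem(1)[OF that(1)] mem(1)[OF that(2)]] mem(2) that by simp
  then show ?thesis unfolding graph_iso_def using g by blast
qed

lemma reachable_image:
  assumes "reachable K u v" "\<And>e. e \<in> edges K \<Longrightarrow> f ` e \<in> edges L"
  shows "reachable L (f u) (f v)"
  using assms(1)[unfolded reachable_def]
proof (induction rule: rtrancl_induct)
  case (step y z)
  have "{f y, f z} \<in> edges L" using assms(2)[of "{y, z}"] step.hyps(2) by simp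
  from reachable_trans[OF step.IH reachable_edge[OF this]] show ?case .
qed simp

lemma card_cgs_iso_le:
  assumes G: "simple_graph G" and H: "simple_graph H" and iso: "graph_iso G H"
  shows "card (cgs G) \<le> card (cgs H)"
proof -
  obtain f where f: "bij_betw f (verts G) (verts H)"
    "\<And>u v. u \<in> verts G \<Longrightarrow> v \<in> verts G \<Longrightarrow> {u, v} \<in> edges G \<longleftrightarrow> {f u, f v} \<in> edges H"
    using iso by (auto simp: graph_iso_def)
  have inj: "inj_on f (verts G)" using f(1) by (rule bij_betw_imp_inj_on)
  define \<Phi> where "\<Phi> K = (f ` verts K, (`) f ` edges K)" for K
  have \<Phi>: "\<Phi> K \<in> cgs H" if K: "K \<in> cgs G" for K
  proof -
    have Kp: "simple_graph K" "connected_graph K" "verts K \<subseteq> verts G" "edges K \<subseteq> edges G"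
      using K by (simp_all add: cgs_iff gle_def)
    have edge: "f ` e \<in> edges H \<and> f ` e \<subseteq> f ` verts K \<and> card (f ` e) = 2" if e: "e \<in> edges K" for e
    proof -
      have eK: "e \<subseteq> verts K" "card e = 2" using simple_graphD(2,3)[OF Kp(1) e] .
      then obtain u v where uv: "e = {u, v}" by (auto simp: card_2_iff)
      have "u \<in> verts G" "v \<in> verts G" "{u, v} \<in> edges G" using eK(1) Kp(3,4) e unfolding uv by auto
      then have "f ` e \<in> edges H" using f(2)[of u v] unfolding uv by simp
      moreover have "card (f ` e) = card e"
        using eK(1) Kp(3) inj by (intro card_image) (meson inj_on_subset order_trans)
      ultimately show ?thesis using eK by (simp add: image_mono)
    qed
    have "simple_graph (\<Phi> K)"
      using edge simple_graphD(1)[OF Kp(1)] unfolding simple_graph_def \<Phi>_def by auto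
    moreover have "connected_graph (\<Phi> K)"
    proof -
      obtain r where r: "r \<in> verts K" using Kp(2) by (auto simp: connected_graph_def)
      show ?thesis
      proof (rule connected_graphI[of "f r"])
        show "f r \<in> verts (\<Phi> K)" using r by (simp add: \<Phi>_def)
        fix v assume "v \<in> verts (\<Phi> K)"
        then obtain u where u: "u \<in> verts K" "v = f u" by (auto simp: \<Phi>_def)
        have "reachable K r u" using Kp(2) r u(1) by (simp add: connected_graph_def)
        then have "reachable (\<Phi> K) (f r) (f u)" by (rule reachable_image) (simp add: \<Phi>_def)
        then show "reachable (\<Phi> K) (f r) v" using u(2) by simp
      qed
    qed
    moreover have "f ` verts K \<subseteq> verts H"
      using image_mono[OF Kp(3), of f] bij_betw_imp_surj_on[OF f(1)] by simp
    then have "gle (\<Phi> K) H" using edge unfolding gle_def \<Phi>_def by auto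
    ultimately show ?thesis by (simp add: cgs_iff)
  qed
  have "inj_on \<Phi> (cgs G)"
  proof (rule inj_onI)
    fix K L assume K: "K \<in> cgs G" and L: "L \<in> cgs G" and eq: "\<Phi> K = \<Phi> L"
    have KL: "verts K \<subseteq> verts G" "edges K \<subseteq> Pow (verts G)" "verts L \<subseteq> verts G" "edges L \<subseteq> Pow (verts G)"
    proof -
      have EG: "edges G \<subseteq> Pow (verts G)" using simple_graphD(2)[OF G] by blast
      have "gle K G" "gle L G" using K L by (simp_all add: cgs_iff)
      then show "verts K \<subseteq> verts G" "edges K \<subseteq> Pow (verts G)" "verts L \<subseteq> verts G"
        "edges L \<subseteq> Pow (verts G)"
        using order_trans[OF _ EG] unfolding gle_def by blast+
    qed
    have V: "f ` verts K = f ` verts L" and E: "(`) f ` edges K = (`) f ` edges L"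
      using eq by (simp_all add: \<Phi>_def)
    have "verts K = verts L" using inj_on_image_eq_iff[OF inj KL(1,3)] V by simp
    moreover have "edges K = edges L"
      using inj_on_image_eq_iff[OF inj_on_image_Pow[OF inj] KL(2,4)] E by simp
    ultimately show "K = L" by (simp add: prod_eq_iff)
  qed
  then have "card (cgs G) = card (\<Phi> ` cgs G)" by (simp add: card_image)
  also have "\<dots> \<le> card (cgs H)" using \<Phi> by (intro card_mono finite_cgs[OF H] image_subsetI)
  finally show ?thesis .
qed

lemma card_cgs_iso:
  assumes "simple_graph G" "simple_graph H" "graph_iso G H"
  shows "card (cgs G) = card (cgs H)"
  using card_cgs_iso_le[OF assms] card_cgs_iso_le[OF assms(2,1) graph_iso_sym[OF assms(3)]]
  by (rule antisym)

text \<open>Lollipops and forks are determined by their vertex lists, so such a map is all that an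
  isomorphism between two of them requires.\<close>

lemma distinct_list_map:
  assumes "distinct xs" "distinct ys" "length xs = length ys"
  obtains f where "map f xs = ys" "inj_on f (set xs)"
proof -
  let ?i = "inv_into {..<length xs} ((!) xs)"
  let ?f = "\<lambda>x. ys ! ?i x"
  have inj: "inj_on ((!) xs) {..<length xs}" using assms(1) by (intro inj_on_nth) auto
  have "map ?f xs = ys"
  proof (rule nth_equalityI)
    fix i assume "i < length (map ?f xs)"
    then have "i < length xs" by simp
    then show "map ?f xs ! i = ys ! i" using inv_into_f_f[OF inj, of i] by simp
  qed (simp add: assms(3))
  moreover from this have "inj_on ?f (set xs)" using assms(2) distinct_map[of ?f xs] by simp
  ultimately show thesis by (rule that)
qed

lemma lollipop_map:
  assumes "c \<noteq> []"
  shows "verts (lollipop (map f c) (map f p)) = f ` verts (lollipop c p)"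
    "edges (lollipop (map f c) (map f p)) = (`) f ` edges (lollipop c p)"
  using assms by (simp_all add: image_Un hd_map last_map pedges_map flip: map_append)

lemma lollipop_iso:
  assumes "distinct (c @ p)" "length c \<ge> 3" "distinct (c' @ p')"
    "length c = length c'" "length p = length p'"
  shows "graph_iso (lollipop c p) (lollipop c' p')"
proof -
  obtain f where f: "map f (c @ p) = c' @ p'" "inj_on f (set (c @ p))"
    using distinct_list_map[OF assms(1,3)] assms(4,5) by auto
  have "map f c = c'" "map f p = p'" using f(1) assms(4) by simp_all
  moreover have "c \<noteq> []" using assms(2) by auto
  ultimately show ?thesis
    using graph_iso_image[OF simple_lollipop[OF assms(1,2)], of f "lollipop c' p'"]
      lollipop_map[of c f p] f(2) by simp
qed

lemma simple_fork:
  assumes "distinct (c @ p @ [x])" "length c \<ge> 3"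
  shows "simple_graph (fork c p x)"
proof -
  have d: "distinct (c @ p)" using assms(1) by simp
  have "c @ butlast p \<noteq> []" using assms(2) by auto
  then have "last (c @ butlast p) \<in> set (c @ butlast p)" by (rule last_in_set)
  then have "last (c @ butlast p) \<noteq> x" using assms(1) in_set_butlastD[of x p] by auto
  then show ?thesis unfolding fork_def by (rule simple_add_edge[OF simple_lollipop[OF d assms(2)]])
qed

lemma fork_iso:
  assumes "distinct (c @ p @ [x])" "length c \<ge> 3" "distinct (c' @ p' @ [x'])"
    "length c = length c'" "length p = length p'"
  shows "graph_iso (fork c p x) (fork c' p' x')"
proof -
  obtain f where f: "map f (c @ p @ [x]) = c' @ p' @ [x']" "inj_on f (set (c @ p @ [x]))"
    using distinct_list_map[OF assms(1,3)] assms(4,5) by auto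
  have m: "map f c = c'" "map f p = p'" "f x = x'" using f(1) assms(4,5) by simp_all
  have c: "c \<noteq> []" using assms(2) by auto
  then have l: "last (c' @ butlast p') = f (last (c @ butlast p))"
    unfolding m(1,2)[symmetric] map_butlast[symmetric] map_append[symmetric] by (intro last_map) simp
  have "c @ butlast p \<noteq> []" using c by simp
  then have "last (c @ butlast p) \<in> set (c @ butlast p)" by (rule last_in_set)
  then have "last (c @ butlast p) \<in> set c \<union> set p" by (auto dest: in_set_butlastD)
  then have V: "verts (fork c p x) = set (c @ p @ [x])" unfolding fork_def by auto
  have "verts (fork c' p' x') = f ` verts (fork c p x)"
    "edges (fork c' p' x') = (`) f ` edges (fork c p x)"
    unfolding fork_def l add_edge_simps lollipop_map[OF c, of f p, unfolded m] using m(3) by simp_all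
  then show ?thesis using graph_iso_image[OF simple_fork[OF assms(1,2)]] f(2) V by simp
qed

text \<open>The end \<open>t\<close> of the tail is itself pendant at \<open>y\<close>, so the count
  at \<open>y\<close> is twice that of the lollipop without \<open>t\<close>. The result
  \<open>k * (k + 1) + 2 * k\<close> equals \<open>(k + 2) * (k + 1) - 2\<close>, exactly what the
  second increment of \<open>L2\<close> asks for at \<open>g = k\<close>; this is why a second
  extremal graph exists.\<close>

lemma fork_count:
  assumes "distinct (c @ p @ [x])" "length c = k" "length p = k" "3 \<le> k"
  shows "2 * card (cgs (fork c p x)) = L2 (Suc k) k"
proof -
  have c3: "length c \<ge> 3" using assms by simp
  have s: "simple_graph (fork c p x)" by (rule simple_fork[OF assms(1) c3])
  obtain r t where p: "p = r @ [t]" using assms(3,4) by (cases p rule: rev_cases) auto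
  have d: "distinct (c @ r @ [t])" "distinct (c @ p)" "distinct (c @ r)" using assms(1) unfolding p by auto
  define y where "y = last (c @ r)"
  have "c @ r \<noteq> []" using c3 by auto
  then have yin: "y \<in> set (c @ r)" unfolding y_def by (rule last_in_set)
  then have yV: "y \<in> verts (lollipop c p)" unfolding p by auto
  have xn: "x \<notin> verts (lollipop c p)" "x \<noteq> y" using assms(1) yin unfolding p by auto
  have F: "fork c p x = add_edge (lollipop c p) y x" unfolding fork_def p y_def by simp
  have sl: "simple_graph (lollipop c p)" by (rule simple_lollipop[OF d(2) c3])
  have xe: "x \<notin> e" if "e \<in> edges (lollipop c p)" for e
    using simple_graph_endpoint[OF sl that] xn(1) by blast
  have pend: "pendant (fork c p x) x y"
    unfolding pendant_def F add_edge_simps using xe by (auto simp only: insert_iff insert_commute)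
  have "edges (delete_vertex (fork c p x) x) = edges (lollipop c p)"
    unfolding F add_edge_simps delete_vertex_simps using xe by blast
  moreover have "verts (delete_vertex (fork c p x) x) = verts (lollipop c p)"
    unfolding F add_edge_simps delete_vertex_simps using yV xn by blast
  ultimately have del: "delete_vertex (fork c p x) x = lollipop c p" by (simp add: prod_eq_iff)
  have st: "simple_graph (lollipop c (r @ [t]))" using sl p by simp
  note P = lollipop_pendant[OF d(1) c3, folded y_def]
  have "card (rooted (lollipop c p) y) = 2 * card (rooted (lollipop c r) y)"
    using card_rooted_pendant(2)[OF st P(1)] P(2) p by simp
  moreover have "2 * card (rooted (lollipop c r) y) = k * (k + 1) + 2 + 2 * length r"
    using lollipop_counts[OF d(3) assms(2,4)] unfolding y_def by blast
  moreover have "card (cgs (fork c p x)) = card (cgs (lollipop c p)) + Suc (card (rooted (lollipop c p) y))"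
    using card_cgs_split[OF s, of x] card_rooted_pendant(1)[OF s pend] del by simp
  moreover have "2 * card (cgs (lollipop c p)) = L2 k k"
    using lollipop_counts[OF d(2) assms(2,4)] assms(3) by simp
  moreover have "k = Suc (length r)" using assms(3) p by simp
  moreover note L2_Suc(2)[of k k]
  ultimately show ?thesis by (simp add: algebra_simps)
qed

section \<open>The graphs of the theorem as lollipops and forks\<close>

lemma pedges_upt: "pedges [a..<b] = {{i, Suc i} | i. a \<le> i \<and> Suc i < b}"
proof (induction b)
  case (Suc b)
  show ?case
  proof (cases "a < b")
    case True
    then obtain b' where b': "b = Suc b'" "a \<le> b'" by (cases b) auto
    have "last [a..<b] = b'" using b' by simp
    then have "pedges [a..<Suc b] = insert {b', b} (pedges [a..<b])"
      using pedges_append[of "[a..<b]" "[b]"] True by simp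
    also have "\<dots> = {{i, Suc i} | i. a \<le> i \<and> Suc i < Suc b}"
      unfolding Suc.IH using b' by (auto simp: less_Suc_eq)
    finally show ?thesis .
  next
    case False
    then have "pedges [a..<Suc b] = {}" by (cases "a = b") auto
    moreover have "{{i, Suc i} | i. a \<le> i \<and> Suc i < Suc b} = {}" using False by auto
    ultimately show ?thesis by simp
  qed
qed simp

lemma path_graph_eq: "path_graph m = path_on [0..<m]"
  by (simp add: path_graph_def path_on_def pedges_upt)

lemma cycle_graph_eq:
  assumes "g \<ge> 2"
  shows "cycle_graph g = lollipop [0..<g] []"
proof -
  obtain h where h: "g = Suc h" "1 \<le> h" using assms by (cases g) auto
  have "{{i, Suc i mod g} | i. i < g} = insert {h, 0} {{i, Suc i} | i. Suc i < g}" (is "?L = ?R")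
  proof
    show "?L \<subseteq> ?R"
    proof
      fix e assume "e \<in> ?L"
      then obtain i where i: "e = {i, Suc i mod g}" "i < g" by blast
      show "e \<in> ?R"
      proof (cases "i = h")
        case True
        then show ?thesis using i h by simp
      next
        case False
        then show ?thesis using i h by auto
      qed
    qed
    show "?R \<subseteq> ?L"
    proof
      fix e assume "e \<in> ?R"
      then consider "e = {h, 0}" | i where "e = {i, Suc i}" "Suc i < g" by blast
      then show "e \<in> ?L"
      proof cases
        case 1
        then have "e = {h, Suc h mod g}" "h < g" using h by simp_all
        then show ?thesis by blast
      next
        case 2
        then have "e = {i, Suc i mod g}" "i < g" by simp_all
        then show ?thesis by blast
      qed
    qed
  qed
  moreover have "hd [0..<g] = 0" "last [0..<g] = h" using h by (simp_all add: upt_rec[of 0])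
  ultimately show ?thesis
    unfolding cycle_graph_def lollipop_def by (simp add: pedges_upt insert_commute)
qed

text \<open>The cycle is listed as 1, ..., \<open>g - 1\<close>, 0, so that the identified vertex
  comes last, where \<open>lollipop\<close> attaches the tail.\<close>

lemma L_graph_eq:
  assumes "g \<ge> 3"
  shows "L_graph (g + k) g =
    lollipop (map Inr [1..<g] @ [Inl 0]) (map Inl [1..<Suc k])"
proof -
  let ?h = "\<lambda>x. if x = (0::nat) then Inl (0::nat) else Inr x"
  obtain h where h: "g = Suc h" "1 < h" using assms by (cases g) auto
  have gl: "[0..<g] = 0 # [1..<g]" using h by (simp add: upt_rec[of 0])
  have hm: "map ?h [1..<g] = map Inr [1..<g]" by simp
  have km: "map Inl [0..<Suc k] = Inl 0 # map Inl [1..<Suc k]" by (simp add: upt_rec[of 0])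
  have l: "last [1..<g] = h" "hd [1..<g] = 1" "[1..<g] \<noteq> []" using h by auto
  have E1: "(`) Inl ` pedges [0..<Suc k] = pedges (map Inl [0..<Suc k])" by (rule pedges_map[symmetric])
  have ce: "edges (cycle_graph g) = insert {0, h} (insert {0, 1} (pedges [1..<g]))"
    using cycle_graph_eq[of g] h l unfolding gl by (simp add: pedges_Cons)
  have R: "(`) ?h ` pedges [1..<g] = pedges (map Inr [1..<g])"
    unfolding pedges_map[symmetric] hm ..
  have "?h ` {0, h} = {Inl 0, Inr h}" "?h ` {0, 1} = {Inl 0, Inr 1}" using h by auto
  then have E2: "(`) ?h ` edges (cycle_graph g) =
      insert {Inl 0, Inr h} (insert {Inl 0, Inr 1} (pedges (map Inr [1..<g])))"
    unfolding ce image_insert R by simp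
  have V: "{0..<g} - {0} = set [1..<g]" "{0..<Suc k} = insert 0 (set [1..<Suc k])" by auto
  have path: "edges (path_graph (g + k - g + 1)) = pedges [0..<Suc k]"
    "verts (path_graph (g + k - g + 1)) = {0..<Suc k}"
    unfolding path_graph_eq by (simp_all del: upt_Suc)
  have vc: "verts (cycle_graph g) = {0..<g}" by (simp add: cycle_graph_def)
  have "verts (L_graph (g + k) g) =
      verts (lollipop (map Inr [1..<g] @ [Inl 0]) (map Inl [1..<Suc k]))"
    unfolding L_graph_def identify_def fst_conv path vc V by auto
  moreover have "edges (L_graph (g + k) g) =
      edges (lollipop (map Inr [1..<g] @ [Inl 0]) (map Inl [1..<Suc k]))"
  proof -
    have app: "(map Inr [1..<g] @ [Inl 0]) @ map Inl [1..<Suc k] = map Inr [1..<g] @ map Inl [0..<Suc k]"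
      unfolding km by simp
    have "pedges ((map Inr [1..<g] @ [Inl 0]) @ map Inl [1..<Suc k]) =
        insert {Inr h, Inl 0} (pedges (map Inr [1..<g]) \<union> pedges (map Inl [0..<Suc k]))"
    proof -
      let ?I = "map Inr [1..<g] :: (nat + nat) list" and ?P = "map Inl [0..<Suc k] :: (nat + nat) list"
      have "?P \<noteq> []" "hd ?P = Inl 0" unfolding km by simp_all
      moreover have "?I \<noteq> []" "last ?I = Inr h" using l by (simp_all add: last_map)
      ultimately show ?thesis unfolding app using pedges_append[of ?I ?P] by (simp only: not_False_eq_True simp_thms)
    qed
    moreover have "hd (map Inr [1..<g] @ [Inl 0 :: nat + nat]) = Inr 1" using l by (simp add: hd_map)
    ultimately have "edges (lollipop (map Inr [1..<g] @ [Inl 0]) (map Inl [1..<Suc k])) =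
        insert {Inr 1, Inl 0} (insert {Inr h, Inl 0} (pedges (map Inr [1..<g]) \<union> pedges (map Inl [0..<Suc k])))"
      by (simp del: upt_Suc)
    then show ?thesis
      unfolding L_graph_def identify_def snd_conv path E1 E2 by (auto simp only: insert_commute Un_iff insert_iff)
  qed
  ultimately show ?thesis by (simp only: prod_eq_iff)
qed

text \<open>For \<open>n = 2 * k + 1\<close> the cycle has \<open>k\<close> vertices. The star leaf
  \<open>Inr (Inr 1)\<close> ends the tail; the centre, merged with the path vertex
  \<open>k - 1\<close>, is thus the last vertex before it, where \<open>fork\<close> hangs the other
  leaf \<open>Inr (Inr 2)\<close>.\<close>

lemma Q_graph_eq:
  assumes "k \<ge> 3"
  shows "Q_graph (2 * k + 1) k =
    fork (map Inl ([1..<k] @ [0])) (map (Inr \<circ> Inl) [1..<k] @ [Inr (Inr 1)]) (Inr (Inr 2))"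
proof -
  let ?c = "map Inl ([1..<k] @ [0]) :: (nat + nat + nat) list"
  let ?r = "map (Inr \<circ> Inl) [1..<k] :: (nat + nat + nat) list"
  let ?h = "\<lambda>x. if x = Inl (0::nat) then Inl (0::nat) else Inr x :: nat + nat + nat"
  obtain h where h: "k = Suc h" "1 < h" using assms by (cases k) auto
  have kl: "[0..<k] = 0 # [1..<k]" using h by (simp add: upt_rec[of 0])
  have l: "last [1..<k] = h" "hd [1..<k] = 1" "[1..<k] \<noteq> []" using h by auto
  have "cycle_graph k = lollipop ([1..<k] @ [0]) []"
    using cycle_graph_eq[of k] lollipop_swap[of "[0]" "[1..<k]"] l(3) h unfolding kl by simp
  then have cv: "verts (cycle_graph k) = set ([1..<k] @ [0])"
    and ce: "edges (cycle_graph k) = insert {1, 0} (pedges ([1..<k] @ [0]))" using l by simp_all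
  have CE: "(`) Inl ` edges (cycle_graph k) = insert {Inl 1, Inl 0} (pedges ?c)"
    unfolding ce pedges_map by simp
  have PE: "(`) Inl ` edges (path_graph k) = insert {Inl 0, Inl 1} ((`) Inl ` pedges [1..<k])"
    unfolding path_graph_eq path_on_simps kl pedges_Cons[OF l(3)] using l by simp
  have st: "edges (star_graph 2) = {{0, 1}, {0, 2}}"
  proof -
    have "{{0, i} | i. 1 \<le> i \<and> i \<le> (2::nat)} = (\<lambda>i. {0, i}) ` {1, 2}"
      by (auto simp: le_Suc_eq numeral_2_eq_2)
    then show ?thesis by (simp add: star_graph_def)
  qed
  have sv: "verts (star_graph 2) - {0} = {1, 2}" by (auto simp: star_graph_def)
  have psv: "verts (path_star k 2) = Inl ` set (0 # [1..<k]) \<union> {Inr 1, Inr 2}"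
    unfolding path_star_def identify_def fst_conv sv path_graph_eq path_on_simps kl by simp
  have pse: "edges (path_star k 2) = insert {Inl 0, Inl 1} ((`) Inl ` pedges [1..<k]) \<union>
      {{Inl h, Inr 1}, {Inl h, Inr 2}}"
  proof -
    let ?s = "\<lambda>x. if x = (0::nat) then Inl (k - 1) else Inr x :: nat + nat"
    have "?s ` {0, 1} = {Inl h, Inr 1}" "?s ` {0, 2} = {Inl h, Inr 2}" using h(1) by auto
    then show ?thesis
      unfolding path_star_def identify_def snd_conv PE st image_insert image_empty by simp
  qed
  have "(`) ?h ` ((`) Inl ` pedges [1..<k]) = pedges (map ?h (map Inl [1..<k]))"
    by (simp only: pedges_map)
  also have "map ?h (map Inl [1..<k]) = ?r" by simp
  finally have R: "(`) ?h ` ((`) Inl ` pedges [1..<k]) = pedges ?r" .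
  have E2: "(`) ?h ` edges (path_star k 2) = insert {Inl 0, Inr (Inl 1)} (pedges ?r) \<union>
      {{Inr (Inl h), Inr (Inr 1)}, {Inr (Inl h), Inr (Inr 2)}}"
    unfolding pse image_Un image_insert R using h(2) by simp
  have k1: "2 * k + 1 - k - 1 = k" by simp
  have lr: "last (?c @ ?r) = Inr (Inl h)" "?r \<noteq> []" "hd ?r = Inr (Inl 1)" "last ?r = Inr (Inl h)"
    using l by (simp_all add: last_map hd_map)
  have "pedges (?c @ ?r @ [Inr (Inr 1)]) =
      insert {Inl 0, Inr (Inl 1)} (pedges ?c \<union> insert {Inr (Inl h), Inr (Inr 1)} (pedges ?r))"
    using pedges_append[of ?c "?r @ [Inr (Inr 1)]"] pedges_append[of ?r "[Inr (Inr 1)]"] lr by simp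
  moreover have "hd ?c = Inl 1" "last ?c = Inl 0" using l by (simp_all add: hd_map)
  ultimately have FE: "edges (fork ?c (?r @ [Inr (Inr 1)]) (Inr (Inr 2))) =
      insert {Inr (Inl h), Inr (Inr 2)} (insert {Inl 1, Inl 0}
        (insert {Inl 0, Inr (Inl 1)} (pedges ?c \<union> insert {Inr (Inl h), Inr (Inr 1)} (pedges ?r))))"
    unfolding fork_def add_edge_simps lollipop_simps butlast_snoc lr(1) by simp
  have "edges (Q_graph (2 * k + 1) k) = edges (fork ?c (?r @ [Inr (Inr 1)]) (Inr (Inr 2)))"
    unfolding FE Q_graph_def identify_def snd_conv k1 CE E2 by blast
  moreover have "verts (Q_graph (2 * k + 1) k) = verts (fork ?c (?r @ [Inr (Inr 1)]) (Inr (Inr 2)))"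
  proof -
    have "verts (path_star k 2) - {Inl 0} = Inl ` set [1..<k] \<union> {Inr 1, Inr 2}"
      unfolding psv by auto
    then have "verts (Q_graph (2 * k + 1) k) =
        Inl ` set ([1..<k] @ [0]) \<union> Inr ` (Inl ` set [1..<k] \<union> {Inr 1, Inr 2})"
      unfolding Q_graph_def identify_def fst_conv k1 cv by simp
    moreover have "Inr (Inl h) \<in> set ?r" using lr(2,4) last_in_set[of ?r] by simp
    then have "verts (fork ?c (?r @ [Inr (Inr 1)]) (Inr (Inr 2))) =
        set ?c \<union> set ?r \<union> {Inr (Inr 1), Inr (Inr 2)}"
      unfolding fork_def add_edge_simps lollipop_simps butlast_snoc lr(1) by auto
    ultimately show ?thesis by (simp only: set_map image_Un image_comp) auto
  qed
  ultimately show ?thesis by (simp only: prod_eq_iff)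
qed

text \<open>The passage from \<open>girth\<close>, which speaks of isomorphic copies of
  \<open>cycle_graph\<close>, to the vertex lists of \<open>cyc\<close>.\<close>

lemma girth_le_cycle:
  assumes "cyc G c"
  shows "girth G \<le> enat (length c)"
proof -
  have c: "distinct c" "3 \<le> length c" using assms by (simp_all add: cyc_def)
  have "subgraph (lollipop c []) G"
    using cyc_cgs[OF assms] by (simp add: cgs_def)
  moreover have "graph_iso (lollipop c []) (cycle_graph (length c))"
    using lollipop_iso[of c "[]" "[0..<length c]" "[]"] cycle_graph_eq[of "length c"] c by simp
  ultimately show ?thesis unfolding girth_def using c(2) by (intro Inf_lower) blast
qed

theorem theorem4p10:
  fixes G :: "'a ugraph" and n k :: nat
  assumes "n \<ge> 13" and "k \<ge> 1" and "n \<ge> 2 * k"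
    and "G \<in> cut_class_girth n k k"
  shows "num_conn_subgraphs G \<ge> num_conn_subgraphs (L_graph n (n - k)) \<and>
    (n \<noteq> 2 * k + 1 \<longrightarrow>
      (num_conn_subgraphs G = num_conn_subgraphs (L_graph n (n - k)) \<longleftrightarrow>
        graph_iso G (L_graph n (n - k)))) \<and>
    (n = 2 * k + 1 \<longrightarrow>
      (num_conn_subgraphs G = num_conn_subgraphs (L_graph n (n - k)) \<longleftrightarrow>
        graph_iso G (L_graph (2 * k + 1) (k + 1)) \<or> graph_iso G (Q_graph (2 * k + 1) k)))"
proof -
  define g where "g = n - k"
  \<comment> \<open>\<open>n >= 2 * k\<close> gives \<open>2 * g >= n >= 13\<close>, hence
    \<open>g >= 7\<close>.\<close>
  have n: "n = g + k" and g7: "7 \<le> g" and kg: "k \<le> g" using assms(1,3) by (simp_all add: g_def)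
  have G: "simple_graph G" "connected_graph G" "card (verts G) = n" "card (CV G) = k"
    and gir: "enat k \<le> girth G"
    using assms(4) by (simp_all add: cut_class_girth_def cut_class_def CV_def)
  have gN: "g = card (NC G)" using NC_CV_card[OF G(1)] G(3,4) n by simp
  have girth: "k \<le> length c" if "cyc G c" for c
    using order_trans[OF gir girth_le_cycle[OF that]] by simp
  define c p where "c = map Inr [1..<g] @ [Inl 0 :: nat + nat]"
    and "p = (map Inl [1..<Suc k] :: (nat + nat) list)"
  have cp: "distinct (c @ p)" "length c = g" "3 \<le> length c" "length p = k"
    using g7 by (auto simp: c_def p_def distinct_map inj_on_def)
  have L: "L_graph n g = lollipop c p" using L_graph_eq[of g k] g7 unfolding n c_def p_def by simp
  have sL: "simple_graph (L_graph n g)" unfolding L by (rule simple_lollipop[OF cp(1,3)])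
  have FL: "2 * card (cgs (L_graph n g)) = L2 g k"
    using lollipop_counts[OF cp(1,2)] g7 cp(4) unfolding L by simp
  have isoL: "card (cgs G) = card (cgs (L_graph n g))" if "graph_iso G (L_graph n g)"
    by (rule card_cgs_iso[OF G(1) sL that])
  have isoQ: "card (cgs G) = card (cgs (L_graph n g))"
    if iso: "graph_iso G (Q_graph (2 * k + 1) k)" and nk: "n = 2 * k + 1"
  proof -
    have k3: "3 \<le> k" and gk: "g = Suc k" using assms(1) nk n by simp_all
    let ?c = "map Inl ([1..<k] @ [0]) :: (nat + nat + nat) list"
    let ?p = "map (Inr \<circ> Inl) [1..<k] @ [Inr (Inr 1)] :: (nat + nat + nat) list"
    let ?x = "Inr (Inr 2) :: nat + nat + nat"
    have d: "distinct (?c @ ?p @ [?x])" "length ?c = k" "length ?p = k"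
      using k3 by (auto simp: distinct_map inj_on_def)
    have "simple_graph (Q_graph (2 * k + 1) k)"
      unfolding Q_graph_eq[OF k3] by (rule simple_fork[OF d(1)]) (simp only: d(2) k3)
    from card_cgs_iso[OF G(1) this iso] show ?thesis
      using fork_count[OF d k3] FL unfolding Q_graph_eq[OF k3] gk by simp
  qed
  have bound: "L2 g k \<le> 2 * card (cgs G) \<and> (L2 g k = 2 * card (cgs G) \<longrightarrow> extremal g k G)"
  proof (cases "card (verts G) \<le> card (edges G)")
    case True
    show ?thesis by (rule cyclic_bound[OF G(1,2) True gN G(4)[symmetric] kg girth])
  next
    case False
    then have "card (verts G) = Suc (card (edges G))" using card_edges_ge[OF G(1,2)] by simp
    from tree_strict[OF G(1,2) this gN G(4)[symmetric] g7 assms(2) kg] show ?thesis by simp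
  qed
  have ext: "graph_iso G (L_graph n g) \<or> (n = 2 * k + 1 \<and> graph_iso G (Q_graph (2 * k + 1) k))"
    if "extremal g k G"
    using that unfolding extremal_def
  proof (elim disjE exE conjE)
    fix c' p' assume "distinct (c' @ p')" "3 \<le> length c'" "length c' = g" "length p' = k" "G = lollipop c' p'"
    then have "graph_iso G (L_graph n g)" unfolding L using lollipop_iso[of c' p' c p] cp by simp
    then show ?thesis ..
  next
    fix c' p' x assume f: "g = Suc k" "distinct (c' @ p' @ [x])" "3 \<le> length c'" "length c' = k"
      "length p' = k" "G = fork c' p' x"
    then have k3: "3 \<le> k" by simp
    have "graph_iso G (Q_graph (2 * k + 1) k)"
      unfolding Q_graph_eq[OF k3] f(6)
      by (rule fork_iso[OF f(2,3)]) (use f k3 in \<open>auto simp: distinct_map inj_on_def\<close>)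
    then show ?thesis using f(1) n by simp
  qed
  have Lg: "L_graph (2 * k + 1) (k + 1) = L_graph n g" if "n = 2 * k + 1"
  proof -
    have "2 * k + 1 = n" "k + 1 = g" using that n by simp_all
    then show ?thesis by (simp only:)
  qed
  have eq: "card (cgs G) = card (cgs (L_graph n g)) \<longrightarrow> extremal g k G"
    using bound FL by simp
  have "card (cgs (L_graph n g)) \<le> card (cgs G)" using bound FL by simp
  then show ?thesis unfolding num_conn_subgraphs_eq g_def[symmetric]
    using eq ext isoL isoQ Lg by metis
qed

end
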